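(* Let $\mathbb{K}$ be a field, $R=\mathbb{K}[x_1,\ldots,x_n]$, and let $I\subset R$ be a nonzero proper square-free polymatroidal ideal generated in degree $d$. Then $$\mathrm{v}(I^{(k)})\le\mathrm{v}(I^k)=dk-1=\mathrm{reg}(R/I^k)\le\mathrm{reg}(R/I^{(k)})\quad\text{for all }k\ge 1.$$ Moreover, if $I^{(k)}$ has a linear resolution for some $k\ge 2$, then $$\mathrm{v}(I^{(k)})=\mathrm{v}(I^k)=dk-1=\mathrm{reg}(R/I^k)=\mathrm{reg}(R/I^{(k)})\quad\text{for all }k\ge 1.$$
   Context: $R$ has its standard grading. A polymatroidal ideal $I$ is a monomial ideal, generated in a single degree, satisfying the following exchange condition: for any two minimal monomial generators $u=x_1^{a_1}\cdots x_n^{a_n}$ and $v=x_1^{b_1}\cdots x_n^{b_n}$ of $I$ and each $i$ with $a_i>b_i$, there exists $j$ such that $a_j<b_j$ and $\frac{x_ju}{x_i}$ is a minimal generator of $I$. It is square-free if its minimal monomial generators are square-free. The $k$-th symbolic power is $I^{(k)}=\bigcap_{P\in\mathrm{Min}(I)}(I^kR_P\cap R)$, where $\mathrm{Min}(I)=\mathrm{Ass}(R/I)$ is the set of minimal primes of $I$. For a proper graded ideal $J\subset R$, the v-number is $\mathrm{v}(J)=\min\{e\ge 0\mid \exists f\in R_e,\ \mathfrak{p}\in\mathrm{Ass}(J)\text{ with }(J:f)=\mathfrak{p}\}$, where $\mathrm{Ass}(J)$ is the set of associated primes of $R/J$, and $\mathrm{reg}(R/J)=\max\{j-i\mid\beta_{i,j}(R/J)\ne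 0\}$ is the Castelnuovo-Mumford regularity ($\beta_{i,j}$ the graded Betti numbers). *)

theory Defs
  imports
    "HOL-Library.Poly_Mapping"
    "HOL-Computational_Algebra.Fraction_Field"
    "Jordan_Normal_Form.Matrix_Kernel"
begin

text \<open>
  The polynomial ring over \<open>'k\<close> with variables indexed by \<open>'n\<close>: a polynomial is a finitely
  supported map from exponent vectors to coefficients. A linear order on \<open>'n\<close> is required only
  because the library derives the integral domain instance from it.
\<close>

type_synonym 'n expo = "'n \<Rightarrow>\<^sub>0 nat"
type_synonym ('n, 'k) mpoly = "'n expo \<Rightarrow>\<^sub>0 'k"

definition expo_deg :: "'n::finite expo \<Rightarrow> nat" where
  "expo_deg a = (\<Sum>i\<in>UNIV. Poly_Mapping.lookup a i)"

text \<open>The zero polynomial is homogeneous of every degree, so this is \<open>p \<in> R\<^sub>e\<close>.\<close>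

definition homogeneous :: "nat \<Rightarrow> ('n::finite, 'k::zero) mpoly \<Rightarrow> bool" where
  "homogeneous e p \<longleftrightarrow> (\<forall>a\<in>Poly_Mapping.keys p. expo_deg a = e)"

definition monomial :: "'n expo \<Rightarrow> ('n, 'k::zero_neq_one) mpoly" where
  "monomial a = Poly_Mapping.single a 1"


section \<open>Ideals\<close>

text \<open>Ideals are the submodules of the ring, regarded as a module over itself.\<close>

global_interpretation ideals: Modules.module "(*) :: 'a::comm_ring_1 \<Rightarrow> 'a \<Rightarrow> 'a"
  defines is_ideal = ideals.subspace
    and ideal_gen = ideals.span
  by standard (simp_all add: algebra_simps)

definition is_prime_ideal :: "'a::comm_ring_1 set \<Rightarrow> bool" where
  "is_prime_ideal P \<longleftrightarrow>
     is_ideal P \<and> P \<noteq> UNIV \<and> (\<forall>a b. a * b \<in> P \<longrightarrow> a \<in> P \<or> b \<in> P)"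

definition ideal_mult :: "'a::comm_ring_1 set \<Rightarrow> 'a set \<Rightarrow> 'a set" where
  "ideal_mult I J = ideal_gen {a * b |a b. a \<in> I \<and> b \<in> J}"

primrec ideal_power :: "'a::comm_ring_1 set \<Rightarrow> nat \<Rightarrow> 'a set" where
  "ideal_power I 0 = UNIV"
| "ideal_power I (Suc k) = ideal_mult I (ideal_power I k)"

definition ideal_colon :: "'a::comm_ring_1 set \<Rightarrow> 'a \<Rightarrow> 'a set" where
  "ideal_colon J f = {g. g * f \<in> J}"

text \<open>\<open>J : f\<close> is the annihilator of the class of \<open>f\<close> in \<open>R/J\<close>.\<close>

definition Ass :: "'a::comm_ring_1 set \<Rightarrow> 'a set set" where
  "Ass J = {P. is_prime_ideal P \<and> (\<exists>f. P = ideal_colon J f)}"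

definition minimal_primes :: "'a::comm_ring_1 set \<Rightarrow> 'a set set" where
  "minimal_primes I =
     {P. is_prime_ideal P \<and> I \<subseteq> P \<and> (\<forall>Q. is_prime_ideal Q \<and> I \<subseteq> Q \<and> Q \<subseteq> P \<longrightarrow> Q = P)}"

text \<open>
  For a domain \<open>R\<close>, the localization at a prime \<open>P\<close> is the subring of fractions \<open>a/s\<close> with
  \<open>s \<notin> P\<close> of the fraction field. \<open>extend_local J P\<close> is the ideal \<open>J R\<^sub>P\<close> in it.
\<close>

definition extend_local :: "'a::idom set \<Rightarrow> 'a set \<Rightarrow> 'a fract set" where
  "extend_local J P = {Fract a s |a s. a \<in> J \<and> s \<notin> P}"

definition symbolic_power :: "'a::idom set \<Rightarrow> nat \<Rightarrow> 'a set" where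
  "symbolic_power I k =
     (\<Inter>P\<in>minimal_primes I. {r. Fract r 1 \<in> extend_local (ideal_power I k) P})"


section \<open>Polymatroidal ideals\<close>

definition monomial_ideal :: "('n::finite, 'k::field) mpoly set \<Rightarrow> bool" where
  "monomial_ideal I \<longleftrightarrow> (\<exists>A. I = ideal_gen (monomial ` A))"

text \<open>
  Exponent vectors of the minimal monomial generators, that is, of the monomials in \<open>I\<close> that are
  minimal with respect to divisibility.
\<close>

definition min_gens :: "('n::finite, 'k::field) mpoly set \<Rightarrow> 'n expo set" where
  "min_gens I =
     {a. monomial a \<in> I \<and>
         (\<forall>b. monomial b \<in> I \<and> (monomial b :: ('n, 'k) mpoly) dvd monomial a \<longrightarrow> b = a)}"

definition generated_in_degree :: "nat \<Rightarrow> ('n::finite, 'k::field) mpoly set \<Rightarrow> bool" where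
  "generated_in_degree d I \<longleftrightarrow> (\<forall>a\<in>min_gens I. expo_deg a = d)"

text \<open>
  On exponent vectors, \<open>x\<^sub>j u / x\<^sub>i\<close> is \<open>a - e\<^sub>i + e\<^sub>j\<close>; the truncated subtraction is harmless
  because \<open>a\<^sub>i > b\<^sub>i \<ge> 0\<close>.
\<close>

definition polymatroidal :: "('n::finite, 'k::field) mpoly set \<Rightarrow> bool" where
  "polymatroidal I \<longleftrightarrow>
     monomial_ideal I \<and> (\<exists>d. generated_in_degree d I) \<and>
     (\<forall>a\<in>min_gens I. \<forall>b\<in>min_gens I. \<forall>i. Poly_Mapping.lookup a i > Poly_Mapping.lookup b i \<longrightarrow>
        (\<exists>j. Poly_Mapping.lookup a j < Poly_Mapping.lookup b j \<and>
             a - Poly_Mapping.single i 1 + Poly_Mapping.single j 1 \<in> min_gens I))"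

definition squarefree_ideal :: "('n::finite, 'k::field) mpoly set \<Rightarrow> bool" where
  "squarefree_ideal I \<longleftrightarrow> (\<forall>a\<in>min_gens I. \<forall>i. Poly_Mapping.lookup a i \<le> 1)"


section \<open>The v-number\<close>

definition v_number :: "('n::finite, 'k::field) mpoly set \<Rightarrow> nat" where
  "v_number J = (LEAST e. \<exists>f. homogeneous e f \<and> (\<exists>P\<in>Ass J. ideal_colon J f = P))"


section \<open>Graded Betti numbers and regularity\<close>

text \<open>
  Minimal graded free resolutions of a module \<open>A/B\<close>, where \<open>B \<subseteq> A\<close> are homogeneous ideals; this
  covers both \<open>R/J\<close> (as \<open>UNIV/J\<close>) and \<open>J\<close> (as \<open>J/0\<close>). The \<open>i\<close>-th free module is
  \<open>F\<^sub>i = \<Oplus>\<^sub>c R(-(s i ! c))\<close>, with elements the column vectors of length \<open>length (s i)\<close>. The matrix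
  \<open>\<phi> i\<close> represents \<open>F\<^sub>i\<^sub>+\<^sub>1 \<rightarrow> F\<^sub>i\<close>, and \<open>\<epsilon>\<close> lists representatives in \<open>A\<close> of the images of the basis
  of \<open>F\<^sub>0\<close> in \<open>A/B\<close>. The conditions are, in this order: the shapes and degrees of the maps,
  surjectivity of \<open>F\<^sub>0 \<rightarrow> A/B\<close>, exactness at \<open>F\<^sub>0\<close> and at \<open>F\<^sub>i\<^sub>+\<^sub>1\<close>, and minimality
  (the entries of each \<open>\<phi> i\<close> have zero constant term).
\<close>

definition minimal_graded_resolution ::
    "('n::finite, 'k::field) mpoly set \<Rightarrow> ('n, 'k) mpoly set \<Rightarrow>
     (nat \<Rightarrow> nat list) \<Rightarrow> ('n, 'k) mpoly vec \<Rightarrow> (nat \<Rightarrow> ('n, 'k) mpoly mat) \<Rightarrow> bool" where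
  "minimal_graded_resolution A B s \<epsilon> \<phi> \<longleftrightarrow>
     \<epsilon> \<in> carrier_vec (length (s 0)) \<and>
     (\<forall>c<length (s 0). \<epsilon> $ c \<in> A \<and> homogeneous (s 0 ! c) (\<epsilon> $ c)) \<and>
     (\<forall>i. \<phi> i \<in> carrier_mat (length (s i)) (length (s (Suc i)))) \<and>
     (\<forall>i. \<forall>r<length (s i). \<forall>c<length (s (Suc i)).
        \<forall>a\<in>Poly_Mapping.keys (\<phi> i $$ (r, c)). expo_deg a + s i ! r = s (Suc i) ! c) \<and>
     A = {scalar_prod \<epsilon> f + b |f b. f \<in> carrier_vec (length (s 0)) \<and> b \<in> B} \<and>
     {f \<in> carrier_vec (length (s 0)). scalar_prod \<epsilon> f \<in> B} =
       (\<lambda>g. \<phi> 0 *\<^sub>v g) ` carrier_vec (length (s 1)) \<and>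
     (\<forall>i. mat_kernel (\<phi> i) = (\<lambda>g. \<phi> (Suc i) *\<^sub>v g) ` carrier_vec (length (s (Suc (Suc i))))) \<and>
     (\<forall>i. \<forall>r<length (s i). \<forall>c<length (s (Suc i)). Poly_Mapping.lookup (\<phi> i $$ (r, c)) 0 = 0)"

text \<open>
  \<open>\<beta>\<^sub>i\<^sub>,\<^sub>j(A/B)\<close> is the number of summands \<open>R(-j)\<close> of \<open>F\<^sub>i\<close>. It does not depend on the chosen minimal
  resolution, as these are unique up to graded isomorphism.
\<close>

definition graded_betti ::
    "('n::finite, 'k::field) mpoly set \<Rightarrow> ('n, 'k) mpoly set \<Rightarrow> nat \<Rightarrow> nat \<Rightarrow> nat" where
  "graded_betti A B i j =
     count_list ((SOME s. \<exists>\<epsilon> \<phi>. minimal_graded_resolution A B s \<epsilon> \<phi>) i) j"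

definition reg_quot :: "('n::finite, 'k::field) mpoly set \<Rightarrow> int" where
  "reg_quot J = Max {int j - int i |i j. graded_betti UNIV J i j \<noteq> 0}"

text \<open>The resolution in question is that of the ideal \<open>J\<close> itself, not of \<open>R/J\<close>.\<close>

definition has_linear_resolution :: "('n::finite, 'k::field) mpoly set \<Rightarrow> bool" where
  "has_linear_resolution J \<longleftrightarrow> (\<exists>q. \<forall>i j. graded_betti J {0} i j \<noteq> 0 \<longrightarrow> j = i + q)"

end

theory Submission
  imports Defs
begin

text \<open>
  The minimal generators of \<open>I\<close> are the bases of a matroid, those of \<open>I\<^sup>k\<close> are the sums of \<open>k\<close> bases, and
  \<open>I\<^sup>(\<^sup>k\<^sup>)\<close> consists of the polynomials whose monomials have weight at least \<open>k\<close> on every minimal cover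
  (cocircuit). For a basis \<open>X\<close> and \<open>i \<in> X\<close>, the monomial \<open>x\<^sub>X\<^sup>k / x\<^sub>i\<close> has the same colon ideal with respect to
  both ideals, the prime of the fundamental cocircuit of \<open>i\<close>; this bounds both v-numbers by \<open>d k - 1\<close>,
  and a prime containing \<open>I\<^sup>k\<close> contains a variable, so the degrees in \<open>I\<^sup>k\<close> give equality for \<open>I\<^sup>k\<close>.

  Sums of bases satisfy the dual exchange property, so \<open>I\<^sup>k\<close> has linear quotients and hence a linear
  resolution. On the other hand \<open>x\<^sub>X\<^sup>k\<close> is a minimal generator of \<open>I\<^sup>(\<^sup>k\<^sup>)\<close>, so
  \<open>\<beta>\<^sub>1\<close> is nonzero in degree \<open>d k\<close>. If \<open>I\<^sup>(\<^sup>k\<^sup>)\<close> is generated in a single degree for some \<open>k \<ge> 2\<close>, this degree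
  is therefore \<open>d k\<close>; a circuit with at least three elements would give an element of smaller degree, so
  \<open>I\<close> is a product of primes in disjoint sets of variables, and symbolic and ordinary powers agree.
\<close>

section \<open>Exponent vectors\<close>

text \<open>\<open>graded_betti\<close> reads its numbers off an arbitrarily chosen resolution, and
  \<open>Max\<close> is meaningful only on finite nonempty sets. Hence three general facts precede
  any statement about regularity: proper homogeneous ideals have minimal resolutions, the degrees
  occurring in them do not depend on the choice, and for a monomial ideal only finitely many
  differences of degrees occur. The first rests on finite generation of graded submodules, the
  second on the comparison of resolutions, the third on a Taylor resolution. Since regularity and
  linearity depend only on which degrees occur in each position, the Betti numbers themselves are
  never compared; one inclusion of degree sets, valid against resolutions that need not be minimal,
  does all the work.

  The two regularities are treated unequally: for \<open>I^k\<close> the degrees of a whole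
  resolution are determined, whereas for the symbolic power one generator gives the lower bound.
  Likewise \<open>v_number\<close> is a \<open>LEAST\<close>, so its lower bound also needs a
  witness that the minimum is attained.\<close>

abbreviation (input) "lookup \<equiv> Poly_Mapping.lookup"
abbreviation (input) "keys \<equiv> Poly_Mapping.keys"
abbreviation (input) "unit_expo i \<equiv> Poly_Mapping.single i (Suc 0)"

text \<open>Divisibility of monomials. The order \<open>\<le>\<close> on \<open>poly_mapping\<close>
  is lexicographic and serves other purposes: division with remainder and the ordering of
  generators.\<close>

definition expo_le :: "'n expo \<Rightarrow> 'n expo \<Rightarrow> bool"  (infix "\<preceq>" 50) where
  "a \<preceq> b \<longleftrightarrow> (\<forall>i. lookup a i \<le> lookup b i)"

lemma expo_le_refl [simp]: "a \<preceq> a"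
  by (simp add: expo_le_def)

lemma expo_le_trans [trans]: "a \<preceq> b \<Longrightarrow> b \<preceq> c \<Longrightarrow> a \<preceq> c"
  unfolding expo_le_def by (meson le_trans)

lemma expo_le_antisym: "a \<preceq> b \<Longrightarrow> b \<preceq> a \<Longrightarrow> a = b"
  by (rule poly_mapping_eqI) (simp add: expo_le_def antisym)

lemma expo_le_add1 [simp]: "a \<preceq> a + b"
  by (simp add: expo_le_def lookup_add)

lemma expo_le_add2 [simp]: "a \<preceq> b + a"
  by (simp add: expo_le_def lookup_add)

lemma expo_add_mono: "a \<preceq> b \<Longrightarrow> c \<preceq> d \<Longrightarrow> a + c \<preceq> b + d"
  by (simp add: expo_le_def lookup_add add_mono)

lemma expo_add_diff: "a \<preceq> b \<Longrightarrow> a + (b - a) = b"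
  by (rule poly_mapping_eqI) (simp add: expo_le_def lookup_add lookup_minus)

lemma expo_diff_add: "a \<preceq> b \<Longrightarrow> (b - a) + a = b"
  by (metis add.commute expo_add_diff)

lemma expo_diff_le_iff: "a - b \<preceq> c \<longleftrightarrow> a \<preceq> c + b"
  by (simp add: expo_le_def lookup_add lookup_minus le_diff_conv)

lemma unit_expo_le_iff: "unit_expo i \<preceq> a \<longleftrightarrow> lookup a i > 0"
  by (auto simp: expo_le_def lookup_single when_def)

lemma expo_deg_add [simp]: "expo_deg (a + b) = expo_deg a + expo_deg b"
  by (simp add: expo_deg_def lookup_add sum.distrib)

lemma expo_deg_zero [simp]: "expo_deg 0 = 0"
  by (simp add: expo_deg_def)

lemma expo_deg_unit [simp]: "expo_deg (unit_expo i) = 1"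
  by (simp add: expo_deg_def lookup_single when_def)

lemma expo_deg_mono: "a \<preceq> b \<Longrightarrow> expo_deg a \<le> expo_deg b"
  by (simp add: expo_deg_def expo_le_def sum_mono)

lemma expo_deg_eq_0_iff: "expo_deg a = 0 \<longleftrightarrow> a = 0"
  by (auto simp: expo_deg_def intro: poly_mapping_eqI)

lemma expo_le_deg_eq: "a \<preceq> b \<Longrightarrow> expo_deg a = expo_deg b \<Longrightarrow> a = b"
  by (metis add.right_neutral add_left_cancel expo_add_diff expo_deg_add expo_deg_eq_0_iff)

lemma finite_expo_deg: "finite {a :: 'n::finite expo. expo_deg a = e}"
proof -
  have "lookup ` {a :: 'n expo. expo_deg a = e} \<subseteq> (\<Pi>\<^sub>E i\<in>UNIV. {..e})"
    by (auto simp: expo_deg_def intro: member_le_sum)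
  then have "finite (lookup ` {a :: 'n expo. expo_deg a = e})"
    by (rule finite_subset) (simp add: finite_PiE)
  then show ?thesis
    by (rule finite_imageD) (simp add: inj_on_def)
qed

section \<open>Dickson's lemma\<close>

lemma nat_seq_incseq_subseq:
  fixes f :: "nat \<Rightarrow> nat"
  shows "\<exists>g. strict_mono g \<and> incseq (f \<circ> g)"
proof -
  obtain g :: "nat \<Rightarrow> nat" where g: "strict_mono g" "monoseq (\<lambda>n. f (g n))"
    using seq_monosub[of f] by blast
  show ?thesis
  proof (cases "incseq (\<lambda>n. f (g n))")
    case True
    with g show ?thesis by (auto simp: comp_def)
  next
    case False
    with g(2) have dec: "decseq (\<lambda>n. f (g n))" by (auto simp: monoseq_iff)
    \<comment> \<open>A decreasing sequence of naturals is constant once it reaches its least value,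
      and a constant tail is increasing.\<close>
    define m where "m = (LEAST v. v \<in> range (\<lambda>n. f (g n)))"
    have "m \<in> range (\<lambda>n. f (g n))" unfolding m_def by (rule LeastI[of _ "f (g 0)"]) auto
    then obtain N where N: "m = f (g N)" by auto
    have "f (g n) = m" if "n \<ge> N" for n
      using decseqD[OF dec that] N Least_le[of "\<lambda>v. v \<in> range (\<lambda>n. f (g n))" "f (g n)"]
      by (auto simp: m_def)
    then have "incseq (f \<circ> (\<lambda>n. g (n + N)))" by (simp add: comp_def)
    moreover have "strict_mono (\<lambda>n. g (n + N))" using g(1) by (auto simp: strict_mono_def)
    ultimately show ?thesis by blast
  qed
qed

lemma expo_seq_incseq_subseq:
  fixes f :: "nat \<Rightarrow> 'n expo"
  assumes "finite V"
  shows "\<exists>g. strict_mono g \<and> (\<forall>i\<in>V. incseq (\<lambda>n. lookup (f (g n)) i))"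
  using assms
proof (induction V)
  case empty
  show ?case by (auto intro: exI[of _ id] simp: strict_mono_def)
next
  case (insert i V)
  then obtain g where g: "strict_mono g" "\<forall>i\<in>V. incseq (\<lambda>n. lookup (f (g n)) i)" by blast
  obtain h where h: "strict_mono h" "incseq ((\<lambda>n. lookup (f (g n)) i) \<circ> h)"
    using nat_seq_incseq_subseq by blast
  have "strict_mono (g \<circ> h)" using g h by (simp add: strict_mono_o)
  moreover have "incseq (\<lambda>n. lookup (f ((g \<circ> h) n)) j)" if "j \<in> insert i V" for j
    using that g(2) h by (auto simp: comp_def incseq_def strict_mono_less_eq)
  ultimately show ?case by blast
qed

text \<open>If no finite \<open>T\<close> worked, one could keep choosing elements of
  \<open>S\<close> divisible by none of the earlier choices; a coordinatewise increasing subsequence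
  of such a sequence is impossible. The recursion carries the list of all earlier choices, because
  each choice depends on them.\<close>

lemma dickson:
  fixes S :: "'n::finite expo set"
  shows "\<exists>T. finite T \<and> T \<subseteq> S \<and> (\<forall>a\<in>S. \<exists>b\<in>T. b \<preceq> a)"
proof (rule ccontr)
  assume neg: "\<not> ?thesis"
  have step: "\<exists>a. a \<in> S \<and> (\<forall>b\<in>set bs. \<not> b \<preceq> a)" if "set bs \<subseteq> S" for bs
  proof (rule ccontr)
    assume "\<not> ?thesis"
    then have "\<forall>a\<in>S. \<exists>b\<in>set bs. b \<preceq> a" by blast
    with that have "finite (set bs) \<and> set bs \<subseteq> S \<and> (\<forall>a\<in>S. \<exists>b\<in>set bs. b \<preceq> a)" by simp
    with neg show False by (metis (lifting))
  qed
  define next_elt where "next_elt bs = (SOME a. a \<in> S \<and> (\<forall>b\<in>set bs. \<not> b \<preceq> a))" for bs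
  define L where "L = rec_nat [] (\<lambda>_ bs. next_elt bs # bs)"
  have L_Suc: "L (Suc n) = next_elt (L n) # L n" for n by (simp add: L_def)
  have next_elt: "next_elt bs \<in> S \<and> (\<forall>b\<in>set bs. \<not> b \<preceq> next_elt bs)" if "set bs \<subseteq> S" for bs
    unfolding next_elt_def using step[OF that] by (rule someI_ex)
  have L: "set (L n) \<subseteq> S" for n
    by (induction n) (auto simp: L_Suc next_elt, simp add: L_def)
  define f where "f n = next_elt (L n)" for n
  have mem: "f m \<in> set (L n)" if "m < n" for m n
    using that by (induction n) (auto simp: L_Suc f_def less_Suc_eq)
  have bad: "\<not> f m \<preceq> f n" if "m < n" for m n
    using next_elt[OF L, of n] mem[OF that] by (auto simp: f_def)
  obtain g where g: "strict_mono g" "\<forall>i\<in>UNIV. incseq (\<lambda>n. lookup (f (g n)) i)"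
    using expo_seq_incseq_subseq[of UNIV f] by auto
  then have "f (g 0) \<preceq> f (g 1)" by (auto simp: expo_le_def incseq_def)
  with bad[of "g 0" "g 1"] g(1) show False by (simp add: strict_mono_def)
qed


section \<open>Restricting polynomials to a set of monomials\<close>

text \<open>One projection serves for homogeneous components, lowest-weight parts, constant terms
  and the terms divisible by a given monomial.\<close>

definition restrict_keys :: "('a \<Rightarrow> bool) \<Rightarrow> ('a \<Rightarrow>\<^sub>0 'b::zero) \<Rightarrow> ('a \<Rightarrow>\<^sub>0 'b)" where
  "restrict_keys P p = Poly_Mapping.mapp (\<lambda>a c. c when P a) p"

lemma lookup_restrict_keys: "lookup (restrict_keys P p) a = (lookup p a when P a)"
  by (auto simp: restrict_keys_def lookup_mapp when_def in_keys_iff)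

lemma keys_restrict_keys [simp]: "keys (restrict_keys P p) = {a \<in> keys p. P a}"
  by (auto simp: in_keys_iff lookup_restrict_keys)

lemma restrict_keys_zero [simp]: "restrict_keys P 0 = 0"
  by (rule poly_mapping_eqI) (simp add: lookup_restrict_keys)

lemma restrict_keys_add:
  "restrict_keys P (p + q) = restrict_keys P p + restrict_keys P (q :: _ \<Rightarrow>\<^sub>0 'b::monoid_add)"
  by (rule poly_mapping_eqI) (simp add: lookup_restrict_keys lookup_add when_add_distrib)

lemma restrict_keys_sum:
  "restrict_keys P (\<Sum>x\<in>A. f x) = (\<Sum>x\<in>A. restrict_keys P (f x :: _ \<Rightarrow>\<^sub>0 'b::comm_monoid_add))"
  by (induction A rule: infinite_finite_induct) (auto simp: restrict_keys_add)

lemma restrict_keys_split: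
  "restrict_keys P p + restrict_keys (\<lambda>a. \<not> P a) p = (p :: _ \<Rightarrow>\<^sub>0 'b::monoid_add)"
  by (rule poly_mapping_eqI) (simp add: lookup_restrict_keys lookup_add when_def)

lemma restrict_keys_id: "(\<And>a. a \<in> keys p \<Longrightarrow> P a) \<Longrightarrow> restrict_keys P p = p"
  by (rule poly_mapping_eqI) (auto simp: lookup_restrict_keys when_def in_keys_iff)

lemma restrict_keys_eq_0: "(\<And>a. a \<in> keys p \<Longrightarrow> \<not> P a) \<Longrightarrow> restrict_keys P p = 0"
  by (rule poly_mapping_eqI) (auto simp: lookup_restrict_keys when_def in_keys_iff)

lemma keys_multE:
  assumes "c \<in> keys (p * q)"
  obtains a b where "c = a + b" "a \<in> keys p" "b \<in> keys q"
  using assms keys_mult[of p q] by blast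

text \<open>The typical case is a homogeneous \<open>p\<close>: all its terms shift degrees by the
  same amount, so multiplication by \<open>p\<close> commutes with taking components.\<close>

lemma restrict_keys_mult:
  fixes p q :: "'a::monoid_add \<Rightarrow>\<^sub>0 'b::semiring_0"
  assumes "\<And>a b. a \<in> keys p \<Longrightarrow> P (a + b) \<longleftrightarrow> Q b"
  shows "restrict_keys P (p * q) = p * restrict_keys Q q"
proof -
  have "p * q = p * restrict_keys Q q + p * restrict_keys (\<lambda>b. \<not> Q b) q"
    by (simp flip: distrib_left add: restrict_keys_split)
  moreover have "restrict_keys P (p * restrict_keys Q q) = p * restrict_keys Q q"
    using assms by (intro restrict_keys_id) (auto elim!: keys_multE)
  moreover have "restrict_keys P (p * restrict_keys (\<lambda>b. \<not> Q b) q) = 0"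
    using assms by (intro restrict_keys_eq_0) (auto elim!: keys_multE)
  ultimately show ?thesis by (simp add: restrict_keys_add)
qed

text \<open>The product of the lowest-weight parts is nonzero in a domain, and no other product of
  terms reaches as low a weight, so it survives in \<open>p * q\<close>. Both the primality of
  variable ideals and the description of localized powers rest on this.\<close>

lemma keys_mult_weight_min:
  fixes p q :: "('n::{finite,linorder}, 'k::field) mpoly" and w :: "'n expo \<Rightarrow> nat"
  assumes add: "\<And>a b. w (a + b) = w a + w b" and "p \<noteq> 0" "q \<noteq> 0"
  shows "\<exists>c\<in>keys (p * q). w c = Min (w ` keys p) + Min (w ` keys q)"
proof -
  define m where "m p = Min (w ` keys p)" for p :: "('n, 'k) mpoly"
  define p0 p1 where "p0 = restrict_keys (\<lambda>a. w a = m p) p"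
    and "p1 = restrict_keys (\<lambda>a. w a \<noteq> m p) p"
  define q0 q1 where "q0 = restrict_keys (\<lambda>a. w a = m q) q"
    and "q1 = restrict_keys (\<lambda>a. w a \<noteq> m q) q"
  have p: "p = p0 + p1" and q: "q = q0 + q1"
    by (simp_all add: p0_def p1_def q0_def q1_def restrict_keys_split)
  have m: "m r \<in> w ` keys r" "\<And>a. a \<in> keys r \<Longrightarrow> m r \<le> w a" if "r \<noteq> 0" for r
    using that by (auto simp: m_def)
  have ne: "restrict_keys (\<lambda>a. w a = m r) r \<noteq> 0" if r: "r \<noteq> 0" for r
  proof -
    obtain a where "a \<in> keys r" "w a = m r" using m(1)[OF r] by (metis imageE)
    then have "a \<in> keys (restrict_keys (\<lambda>a. w a = m r) r)" by simp
    then show ?thesis by (metis empty_iff keys_zero)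
  qed
  have "p0 \<noteq> 0" "q0 \<noteq> 0" unfolding p0_def q0_def using assms ne by blast+
  then have "keys (p0 * q0) \<noteq> {}" by simp
  then obtain c where c: "c \<in> keys (p0 * q0)" by blast
  then have wc: "w c = m p + m q"
    by (auto elim!: keys_multE simp: p0_def q0_def add)
  have "c \<notin> keys (p0 * q1)"
  proof
    assume "c \<in> keys (p0 * q1)"
    then obtain a b where ab: "c = a + b" "a \<in> keys p0" "b \<in> keys q1" by (rule keys_multE)
    then have "w a = m p" "w b > m q" using m(2)[OF assms(3), of b]
      by (auto simp: p0_def q1_def)
    with ab wc show False by (simp add: add)
  qed
  moreover have "c \<notin> keys (p1 * q)"
  proof
    assume "c \<in> keys (p1 * q)"
    then obtain a b where ab: "c = a + b" "a \<in> keys p1" "b \<in> keys q" by (rule keys_multE)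
    then have "w a > m p" "w b \<ge> m q" using m(2)[OF assms(3), of b] m(2)[OF assms(2), of a]
      by (auto simp: p1_def)
    with ab wc show False by (simp add: add)
  qed
  moreover have "p * q = p0 * q0 + p0 * q1 + p1 * q"
    by (simp add: p q algebra_simps)
  ultimately have "c \<in> keys (p * q)" using c by (simp add: in_keys_iff lookup_add)
  then show ?thesis using wc by (auto simp: m_def)
qed


section \<open>Monomial ideals\<close>

lemma monomial_mult [simp]: "monomial a * monomial b = (monomial (a + b) :: ('n, 'k::field) mpoly)"
  by (simp add: monomial_def mult_single)

lemma keys_monomial [simp]: "keys (monomial a :: ('n, 'k::field) mpoly) = {a}"
  by (simp add: monomial_def)

lemma monomial_zero [simp]: "monomial 0 = 1"
  by (simp add: monomial_def)

lemma lookup_mult_monomial: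
  fixes p :: "('n, 'k::field) mpoly"
  shows "lookup (p * monomial u) (a + u) = lookup p a"
proof -
  have "restrict_keys (\<lambda>b. b = a + u) (monomial u * p) = monomial u * restrict_keys (\<lambda>b. b = a) p"
    by (rule restrict_keys_mult) (auto simp: add.commute)
  also have "restrict_keys (\<lambda>b. b = a) p = Poly_Mapping.single a (lookup p a)"
    by (rule poly_mapping_eqI) (auto simp: lookup_restrict_keys lookup_single when_def)
  also have "monomial u * \<dots> = Poly_Mapping.single (a + u) (lookup p a)"
    by (simp add: monomial_def mult_single add.commute)
  finally have "lookup (restrict_keys (\<lambda>b. b = a + u) (monomial u * p)) (a + u) = lookup p a"
    by simp
  then show ?thesis by (simp add: lookup_restrict_keys mult.commute)
qed

lemma keys_mult_monomial:
  fixes p :: "('n, 'k::field) mpoly"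
  shows "keys (p * monomial u) = (\<lambda>a. a + u) ` keys p"
proof
  show "keys (p * monomial u) \<subseteq> (\<lambda>a. a + u) ` keys p" by (auto elim!: keys_multE)
  show "(\<lambda>a. a + u) ` keys p \<subseteq> keys (p * monomial u)"
    by (auto simp: in_keys_iff lookup_mult_monomial)
qed

text \<open>The ideal generated by the monomials with exponents in \<open>A\<close>, see \<open>ideal_gen_monomials\<close>.\<close>

definition MI :: "'n expo set \<Rightarrow> ('n, 'k::field) mpoly set" where
  "MI A = {p. \<forall>a\<in>keys p. \<exists>u\<in>A. u \<preceq> a}"

lemma is_idealI:
  assumes "0 \<in> J" "\<And>p q. p \<in> J \<Longrightarrow> q \<in> J \<Longrightarrow> p + q \<in> J" "\<And>c p. p \<in> J \<Longrightarrow> c * p \<in> J"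
  shows "is_ideal J"
  using assms by (simp add: ideals.subspace_def)

lemma is_ideal_MI: "is_ideal (MI A)"
proof (rule is_idealI)
  fix p q :: "('a, 'b) mpoly"
  assume p: "p \<in> MI A"
  show "p + q \<in> MI A" if "q \<in> MI A"
    using p that Poly_Mapping.keys_add[of p q] by (fastforce simp: MI_def)
  show "q * p \<in> MI A"
    unfolding MI_def
  proof (clarify elim!: keys_multE)
    fix a b assume "b \<in> keys p"
    then obtain u where "u \<in> A" "u \<preceq> b" using p by (auto simp: MI_def)
    moreover have "b \<preceq> a + b" by simp
    ultimately show "\<exists>u\<in>A. u \<preceq> a + b" using expo_le_trans by blast
  qed
qed (simp add: MI_def)

lemma monomial_in_MI_iff [simp]: "monomial a \<in> MI A \<longleftrightarrow> (\<exists>u\<in>A. u \<preceq> a)"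
  by (simp add: MI_def)

lemma monomial_in_MI: "a \<in> A \<Longrightarrow> monomial a \<in> MI A"
  by (auto simp: MI_def intro: bexI[of _ a])

lemma mult_monomial_in_MI_iff: "p * monomial u \<in> MI A \<longleftrightarrow> (\<forall>b\<in>keys p. \<exists>v\<in>A. v \<preceq> b + u)"
  by (auto simp: MI_def keys_mult_monomial)

lemma MI_single_multiple:
  assumes "p \<in> MI {u}"
  shows "\<exists>q. p = q * monomial u"
proof -
  have inj: "inj (\<lambda>a. a + u)" by (auto intro: injI)
  \<comment> \<open>Pulling coefficients back along the injective shift by \<open>u\<close> is
    division by \<open>monomial u\<close>. It discards only coefficients at exponents not divisible
    by \<open>u\<close>, where \<open>p\<close> has none.\<close>
  have "p = Poly_Mapping.map_key (\<lambda>a. a + u) p * monomial u"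
  proof (rule poly_mapping_eqI)
    fix a
    show "lookup p a = lookup (Poly_Mapping.map_key (\<lambda>a. a + u) p * monomial u) a"
    proof (cases "u \<preceq> a")
      case True
      then have "lookup (Poly_Mapping.map_key (\<lambda>a. a + u) p * monomial u) (a - u + u) = lookup p (a - u + u)"
        by (simp only: lookup_mult_monomial map_key.rep_eq[OF inj] comp_def)
      then show ?thesis using True by (simp add: expo_diff_add)
    next
      case False
      then have "a \<notin> keys p" using assms by (auto simp: MI_def)
      moreover have "a \<notin> keys (Poly_Mapping.map_key (\<lambda>a. a + u) p * monomial u)"
        using False by (auto simp: keys_mult_monomial)
      ultimately show ?thesis by (simp add: in_keys_iff)
    qed
  qed
  then show ?thesis by blast
qed

text \<open>Each term is assigned to one generator dividing it. The generators form an indexed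
  family, since later the coefficients belong to positions in a list that may repeat a
  monomial.\<close>

lemma MI_finite_combination:
  assumes "finite S" "p \<in> MI (u ` S)"
  shows "\<exists>q. p = (\<Sum>l\<in>S. q l * monomial (u l))"
  using assms
proof (induction S arbitrary: p)
  case empty
  then have "p = 0" by (simp add: MI_def)
  then show ?case by simp
next
  case (insert l S)
  define p1 p2 where "p1 = restrict_keys (\<lambda>a. u l \<preceq> a) p"
    and "p2 = restrict_keys (\<lambda>a. \<not> u l \<preceq> a) p"
  have "p1 \<in> MI {u l}" by (simp add: p1_def MI_def)
  then obtain r where r: "p1 = r * monomial (u l)" using MI_single_multiple by blast
  have "p2 \<in> MI (u ` S)" using insert.prems by (auto simp: p2_def MI_def)
  then obtain q where q: "p2 = (\<Sum>l\<in>S. q l * monomial (u l))" using insert.IH by blast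
  have "p = p1 + p2" by (simp add: p1_def p2_def restrict_keys_split)
  also have "\<dots> = (\<Sum>l'\<in>insert l S. (if l' = l then r else q l') * monomial (u l'))"
  proof -
    have "(\<Sum>l'\<in>S. (if l' = l then r else q l') * monomial (u l')) = p2"
      unfolding q by (rule sum.cong) (use insert.hyps in auto)
    then show ?thesis using insert.hyps by (simp add: r)
  qed
  finally show ?case by (rule exI[of "\<lambda>q. p = (\<Sum>l\<in>insert l S. q l * monomial (u l))" "\<lambda>l'. if l' = l then r else q l'"])
qed

lemma is_ideal_sum:
  assumes "is_ideal J" "\<And>x. x \<in> A \<Longrightarrow> f x \<in> J"
  shows "(\<Sum>x\<in>A. f x) \<in> J"
  using assms ideals.subspace_sum by blast

lemma ideal_gen_monomials: "ideal_gen (monomial ` A) = (MI A :: ('n, 'k::field) mpoly set)"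
proof
  show "ideal_gen (monomial ` A) \<subseteq> (MI A :: ('n, 'k) mpoly set)"
    by (intro ideals.span_minimal is_ideal_MI image_subsetI monomial_in_MI)
  show "(MI A :: ('n, 'k) mpoly set) \<subseteq> ideal_gen (monomial ` A)"
  proof
    fix p :: "('n, 'k) mpoly" assume p: "p \<in> MI A"
    have "\<forall>a\<in>keys p. \<exists>u. u \<in> A \<and> u \<preceq> a" using p by (auto simp: MI_def)
    then obtain g where g: "g a \<in> A \<and> g a \<preceq> a" if "a \<in> keys p" for a by metis
    define S where "S = g ` keys p"
    have "p \<in> MI (id ` S)" using g by (auto simp: MI_def S_def)
    then obtain q where q: "p = (\<Sum>l\<in>S. q l * monomial (id l))"
      using MI_finite_combination[of S p id] by (auto simp: S_def)
    have "S \<subseteq> A" using g by (auto simp: S_def)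
    then have "q l * monomial l \<in> ideal_gen (monomial ` A)" if "l \<in> S" for l
      using that by (intro ideals.span_scale ideals.span_base) auto
    then show "p \<in> ideal_gen (monomial ` A)" unfolding q id_def by (rule ideals.span_sum)
  qed
qed

lemma MI_minimal:
  assumes "is_ideal J" "\<And>a. a \<in> A \<Longrightarrow> monomial a \<in> J"
  shows "MI A \<subseteq> J"
  unfolding ideal_gen_monomials[symmetric] using assms by (intro ideals.span_minimal) auto

lemma MI_subset_iff: "(MI A :: ('n, 'k::field) mpoly set) \<subseteq> MI B \<longleftrightarrow> (\<forall>a\<in>A. \<exists>b\<in>B. b \<preceq> a)"
proof
  assume sub: "(MI A :: ('n, 'k) mpoly set) \<subseteq> MI B"
  show "\<forall>a\<in>A. \<exists>b\<in>B. b \<preceq> a"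
  proof
    fix a assume "a \<in> A"
    then have "(monomial a :: ('n, 'k) mpoly) \<in> MI A" by (rule monomial_in_MI)
    then have "(monomial a :: ('n, 'k) mpoly) \<in> MI B" using sub by blast
    then show "\<exists>b\<in>B. b \<preceq> a" by simp
  qed
next
  assume "\<forall>a\<in>A. \<exists>b\<in>B. b \<preceq> a"
  then show "(MI A :: ('n, 'k) mpoly set) \<subseteq> MI B" by (intro MI_minimal is_ideal_MI) simp
qed

lemma MI_cong:
  assumes "\<And>b. (\<exists>a\<in>A. a \<preceq> b) \<longleftrightarrow> (\<exists>a\<in>A'. a \<preceq> b)"
  shows "MI A = MI A'"
  using assms by (auto simp: MI_def)

lemma ideal_mult_MI:
  "ideal_mult (MI A) (MI B) = (MI {a + b |a b. a \<in> A \<and> b \<in> B} :: ('n, 'k::field) mpoly set)"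
proof
  show "ideal_mult (MI A) (MI B) \<subseteq> (MI {a + b |a b. a \<in> A \<and> b \<in> B} :: ('n, 'k) mpoly set)"
    unfolding ideal_mult_def
  proof (rule ideals.span_minimal[OF _ is_ideal_MI], clarify)
    fix p q :: "('n, 'k) mpoly"
    assume p: "p \<in> MI A" and q: "q \<in> MI B"
    show "p * q \<in> MI {a + b |a b. a \<in> A \<and> b \<in> B}"
      unfolding MI_def
    proof (clarify elim!: keys_multE)
      fix a b assume "a \<in> keys p" "b \<in> keys q"
      then obtain u v where "u \<in> A" "v \<in> B" "u \<preceq> a" "v \<preceq> b"
        using p q unfolding MI_def by blast
      then show "\<exists>u\<in>{a + b |a b. a \<in> A \<and> b \<in> B}. u \<preceq> a + b"
        by (intro bexI[of _ "u + v"]) (auto intro: expo_add_mono)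
    qed
  qed
  show "(MI {a + b |a b. a \<in> A \<and> b \<in> B} :: ('n, 'k) mpoly set) \<subseteq> ideal_mult (MI A) (MI B)"
  proof (rule MI_minimal)
    fix c assume "c \<in> {a + b |a b. a \<in> A \<and> b \<in> B}"
    then obtain a b where ab: "c = a + b" "a \<in> A" "b \<in> B" by blast
    then have "monomial a * monomial b \<in> (ideal_mult (MI A) (MI B) :: ('n, 'k) mpoly set)"
      unfolding ideal_mult_def
      by (intro ideals.span_base CollectI exI conjI) (auto intro!: monomial_in_MI simp del: monomial_in_MI_iff)
    then show "monomial c \<in> (ideal_mult (MI A) (MI B) :: ('n, 'k) mpoly set)" by (simp add: ab)
  qed (simp add: ideal_mult_def)
qed

lemma monomial_dvd_iff: "(monomial b :: ('n, 'k::field) mpoly) dvd monomial a \<longleftrightarrow> b \<preceq> a"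
proof
  assume "(monomial b :: ('n, 'k) mpoly) dvd monomial a"
  then obtain q where "(monomial a :: ('n, 'k) mpoly) = q * monomial b" by (metis dvdE mult.commute)
  then have "a \<in> keys (q * monomial b)" by (metis keys_monomial insertI1)
  then show "b \<preceq> a" by (auto simp: keys_mult_monomial)
next
  assume "b \<preceq> a"
  then have "(monomial a :: ('n, 'k) mpoly) = monomial b * monomial (a - b)"
    by (simp add: expo_add_diff)
  then show "(monomial b :: ('n, 'k) mpoly) dvd monomial a" by (rule dvdI)
qed

lemma MI_min_gens:
  assumes "monomial_ideal I"
  shows "I = MI (min_gens I)"
proof -
  obtain A where I: "I = MI A" using assms by (auto simp: monomial_ideal_def ideal_gen_monomials)
  have "\<exists>u\<in>min_gens I. u \<preceq> a" if "monomial a \<in> I" for a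
    using that
  proof (induction "expo_deg a" arbitrary: a rule: less_induct)
    case less
    show ?case
    proof (cases "a \<in> min_gens I")
      case True
      then show ?thesis using expo_le_refl by blast
    next
      case False
      then obtain b where b: "monomial b \<in> I" "b \<preceq> a" "b \<noteq> a"
        using less.prems by (auto simp: min_gens_def monomial_dvd_iff)
      then have "expo_deg b < expo_deg a" using expo_deg_mono[of b a] expo_le_deg_eq[of b a] by linarith
      then show ?thesis using less.hyps b expo_le_trans by blast
    qed
  qed
  then have "MI A \<subseteq> MI (min_gens I)" unfolding MI_subset_iff using I by (auto intro: expo_le_refl)
  moreover have "MI (min_gens I) \<subseteq> I" unfolding I
    by (rule MI_minimal[OF is_ideal_MI]) (auto simp: min_gens_def)
  ultimately show ?thesis using I by blast
qed


section \<open>Graded free modules\<close>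

text \<open>
  As in \<open>minimal_graded_resolution\<close>, a list \<open>s\<close> of degrees stands for the graded free module
  \<open>\<Oplus>\<^sub>r R(-(s ! r))\<close>.
\<close>

definition homog_vec :: "nat list \<Rightarrow> nat \<Rightarrow> ('n::finite, 'k::field) mpoly vec \<Rightarrow> bool" where
  "homog_vec s e v \<longleftrightarrow> (\<forall>r<length s. \<forall>a\<in>keys (v $ r). expo_deg a + s ! r = e)"

definition comp_vec :: "nat list \<Rightarrow> nat \<Rightarrow> ('n::finite, 'k::field) mpoly vec \<Rightarrow> ('n, 'k) mpoly vec" where
  "comp_vec s e v = vec (length s) (\<lambda>r. restrict_keys (\<lambda>a. expo_deg a + s ! r = e) (v $ r))"

definition graded_mat :: "nat list \<Rightarrow> nat list \<Rightarrow> ('n::finite, 'k::field) mpoly mat \<Rightarrow> bool" where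
  "graded_mat s t \<phi> \<longleftrightarrow> \<phi> \<in> carrier_mat (length s) (length t) \<and>
     (\<forall>r<length s. \<forall>c<length t. \<forall>a\<in>keys (\<phi> $$ (r, c)). expo_deg a + s ! r = t ! c)"

definition const_free_mat :: "('n, 'k::field) mpoly mat \<Rightarrow> bool" where
  "const_free_mat \<phi> \<longleftrightarrow> (\<forall>r<dim_row \<phi>. \<forall>c<dim_col \<phi>. lookup (\<phi> $$ (r, c)) 0 = 0)"

definition submod :: "nat \<Rightarrow> 'a::comm_ring_1 vec set \<Rightarrow> bool" where
  "submod m N \<longleftrightarrow> N \<subseteq> carrier_vec m \<and> 0\<^sub>v m \<in> N \<and>
     (\<forall>v\<in>N. \<forall>w\<in>N. v + w \<in> N) \<and> (\<forall>p. \<forall>v\<in>N. p \<cdot>\<^sub>v v \<in> N)"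

definition graded_submod :: "nat list \<Rightarrow> ('n::finite, 'k::field) mpoly vec set \<Rightarrow> bool" where
  "graded_submod s N \<longleftrightarrow> submod (length s) N \<and> (\<forall>v\<in>N. \<forall>e. comp_vec s e v \<in> N)"

definition mat_image :: "'a::comm_ring_1 mat \<Rightarrow> 'a vec set" where
  "mat_image \<phi> = (\<lambda>g. \<phi> *\<^sub>v g) ` carrier_vec (dim_col \<phi>)"

lemma mult_mat_vec_index:
  assumes "\<phi> \<in> carrier_mat m n" "v \<in> carrier_vec n" "r < m"
  shows "(\<phi> *\<^sub>v v) $ r = (\<Sum>c<n. \<phi> $$ (r, c) * v $ c)"
  using assms by (auto simp: scalar_prod_def atLeast0LessThan intro!: sum.cong)

lemma mult_mat_vec_add:
  fixes \<phi> :: "'a::comm_ring_1 mat"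
  assumes "\<phi> \<in> carrier_mat m n" "v \<in> carrier_vec n" "w \<in> carrier_vec n"
  shows "\<phi> *\<^sub>v (v + w) = \<phi> *\<^sub>v v + \<phi> *\<^sub>v w"
  using assms by (simp add: mult_add_distrib_mat_vec)

lemma mult_mat_vec_smult:
  fixes \<phi> :: "'a::comm_ring_1 mat"
  assumes "\<phi> \<in> carrier_mat m n" "v \<in> carrier_vec n"
  shows "\<phi> *\<^sub>v (p \<cdot>\<^sub>v v) = p \<cdot>\<^sub>v (\<phi> *\<^sub>v v)"
  using assms by (intro eq_vecI) auto

lemma mult_mat_vec_zero:
  fixes \<phi> :: "'a::comm_ring_1 mat"
  assumes "\<phi> \<in> carrier_mat m n"
  shows "\<phi> *\<^sub>v 0\<^sub>v n = 0\<^sub>v m"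
  using assms by (intro eq_vecI) auto

lemma submodD:
  assumes "submod m N"
  shows "v \<in> N \<Longrightarrow> v \<in> carrier_vec m" "0\<^sub>v m \<in> N" "v \<in> N \<Longrightarrow> w \<in> N \<Longrightarrow> v + w \<in> N"
    "v \<in> N \<Longrightarrow> p \<cdot>\<^sub>v v \<in> N"
  using assms by (auto simp: submod_def)

lemma submod_diff:
  assumes "submod m N" "v \<in> N" "w \<in> N"
  shows "v - w \<in> N"
proof -
  have "v - w = v + (- 1) \<cdot>\<^sub>v w"
    using submodD(1)[OF assms(1)] assms by (intro eq_vecI) auto
  then show ?thesis using submodD[OF assms(1)] assms by simp
qed

lemma submod_mat_image:
  assumes "\<phi> \<in> carrier_mat m n"
  shows "submod m (mat_image \<phi>)"
  unfolding submod_def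
proof (intro conjI ballI allI)
  show "mat_image \<phi> \<subseteq> carrier_vec m" using assms by (auto simp: mat_image_def)
  show "0\<^sub>v m \<in> mat_image \<phi>" unfolding mat_image_def
    by (rule image_eqI[of _ _ "0\<^sub>v n"]) (use assms in \<open>auto simp: mult_mat_vec_zero\<close>)
  fix v p assume "v \<in> mat_image \<phi>"
  then obtain g where g: "v = \<phi> *\<^sub>v g" "g \<in> carrier_vec n" using assms by (auto simp: mat_image_def)
  show "p \<cdot>\<^sub>v v \<in> mat_image \<phi>" unfolding mat_image_def
    by (rule image_eqI[of _ _ "p \<cdot>\<^sub>v g"]) (use assms g mult_mat_vec_smult[OF assms g(2)] in auto)
  fix w assume "w \<in> mat_image \<phi>"
  then obtain h where h: "w = \<phi> *\<^sub>v h" "h \<in> carrier_vec n" using assms by (auto simp: mat_image_def)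
  show "v + w \<in> mat_image \<phi>" unfolding mat_image_def
    by (rule image_eqI[of _ _ "g + h"]) (use assms g h mult_mat_vec_add[OF assms g(2) h(2)] in auto)
qed

lemma mat_image_colsD:
  assumes "\<phi> \<in> carrier_mat m n" "c < n"
  shows "col \<phi> c \<in> mat_image \<phi>"
  unfolding mat_image_def
proof (rule image_eqI)
  show "col \<phi> c = \<phi> *\<^sub>v unit_vec n c" using assms by (intro eq_vecI) auto
qed (use assms in auto)

text \<open>Columns with coefficient 0 may lie outside \<open>N\<close>; this is used when a
  redundant generator is removed.\<close>

lemma mult_mat_vec_in_submod:
  assumes N: "submod m N" and \<phi>: "\<phi> \<in> carrier_mat m n" and v: "v \<in> carrier_vec n"
    and "\<And>c. c < n \<Longrightarrow> v $ c = 0 \<or> col \<phi> c \<in> N"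
  shows "\<phi> *\<^sub>v v \<in> N"
proof -
  define part where "part j = vec m (\<lambda>r. \<Sum>c<j. \<phi> $$ (r, c) * v $ c)" for j
  have "part j \<in> N" if "j \<le> n" for j
    using that
  proof (induction j)
    case 0
    have "part 0 = 0\<^sub>v m" by (intro eq_vecI) (auto simp: part_def)
    then show ?case using submodD(2)[OF N] by simp
  next
    case (Suc j)
    have "part (Suc j) = part j + v $ j \<cdot>\<^sub>v col \<phi> j"
      using \<phi> Suc.prems by (intro eq_vecI) (auto simp: part_def mult.commute)
    moreover have "v $ j \<cdot>\<^sub>v col \<phi> j \<in> N"
    proof (cases "v $ j = 0")
      case True
      then have "v $ j \<cdot>\<^sub>v col \<phi> j = 0\<^sub>v m" using \<phi> by (intro eq_vecI) auto
      then show ?thesis using submodD(2)[OF N] by simp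
    next
      case False
      then show ?thesis using assms(4)[of j] Suc.prems submodD(4)[OF N] by auto
    qed
    ultimately show ?case using Suc submodD(3)[OF N] by auto
  qed
  moreover have "\<phi> *\<^sub>v v = part n"
    by (rule eq_vecI) (use \<phi> in \<open>auto simp: part_def mult_mat_vec_index[OF \<phi> v] simp del: index_mult_mat_vec\<close>)
  ultimately show ?thesis by simp
qed

lemma mat_image_subset_iff:
  assumes "submod m N" "\<phi> \<in> carrier_mat m n"
  shows "mat_image \<phi> \<subseteq> N \<longleftrightarrow> (\<forall>c<n. col \<phi> c \<in> N)"
  using mult_mat_vec_in_submod[OF assms] mat_image_colsD[OF assms(2)] assms(2)
  by (auto simp: mat_image_def)

lemma comp_vec_carrier [simp]: "comp_vec s e v \<in> carrier_vec (length s)"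
  by (simp add: comp_vec_def)

lemma homog_comp_vec [simp]: "homog_vec s e (comp_vec s e v)"
  by (simp add: homog_vec_def comp_vec_def)

lemma comp_vec_homog: "v \<in> carrier_vec (length s) \<Longrightarrow> homog_vec s e v \<Longrightarrow> comp_vec s e v = v"
  by (intro eq_vecI) (auto simp: comp_vec_def homog_vec_def restrict_keys_id)

lemma graded_mat_carrier: "graded_mat s t \<phi> \<Longrightarrow> \<phi> \<in> carrier_mat (length s) (length t)"
  by (simp add: graded_mat_def)

lemma graded_mat_cols_iff:
  "graded_mat s t \<phi> \<longleftrightarrow>
    \<phi> \<in> carrier_mat (length s) (length t) \<and> (\<forall>c<length t. homog_vec s (t ! c) (col \<phi> c))"
  by (auto simp: graded_mat_def homog_vec_def)

lemma comp_vec_mult: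
  assumes \<phi>: "graded_mat s t \<phi>" and v: "v \<in> carrier_vec (length t)"
  shows "\<phi> *\<^sub>v comp_vec t e v = comp_vec s e (\<phi> *\<^sub>v v)"
proof (rule eq_vecI)
  note c = graded_mat_carrier[OF \<phi>]
  show "dim_vec (\<phi> *\<^sub>v comp_vec t e v) = dim_vec (comp_vec s e (\<phi> *\<^sub>v v))"
    using c by (simp add: comp_vec_def)
  fix r assume "r < dim_vec (comp_vec s e (\<phi> *\<^sub>v v))"
  then have r: "r < length s" by (simp add: comp_vec_def)
  have "restrict_keys (\<lambda>a. expo_deg a + s ! r = e) (\<phi> $$ (r, c) * v $ c) =
      \<phi> $$ (r, c) * restrict_keys (\<lambda>a. expo_deg a + t ! c = e) (v $ c)" if "c < length t" for c
    using \<phi> r that by (intro restrict_keys_mult) (auto simp: graded_mat_def)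
  then show "(\<phi> *\<^sub>v comp_vec t e v) $ r = comp_vec s e (\<phi> *\<^sub>v v) $ r"
    using r by (simp add: mult_mat_vec_index[OF c] v comp_vec_def restrict_keys_sum
        del: index_mult_mat_vec)
qed

lemma graded_submod_kernel:
  assumes \<phi>: "graded_mat s t \<phi>"
  shows "graded_submod t (mat_kernel \<phi>)"
proof -
  note c = graded_mat_carrier[OF \<phi>]
  have "submod (length t) (mat_kernel \<phi>)"
    unfolding submod_def mat_kernel[OF c]
    using c by (auto simp: mult_mat_vec_add[OF c] mult_mat_vec_smult[OF c] mult_mat_vec_zero[OF c])
  moreover have "comp_vec t e v \<in> mat_kernel \<phi>" if "v \<in> mat_kernel \<phi>" for v e
  proof -
    have v: "v \<in> carrier_vec (length t)" "\<phi> *\<^sub>v v = 0\<^sub>v (length s)"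
      using that mat_kernelD[OF c] by auto
    have "comp_vec s e (0\<^sub>v (length s)) = (0\<^sub>v (length s) :: ('a, 'b) mpoly vec)"
      by (intro eq_vecI) (auto simp: comp_vec_def)
    then show ?thesis using comp_vec_mult[OF \<phi> v(1)] v by (simp add: mat_kernel[OF c])
  qed
  ultimately show ?thesis by (simp add: graded_submod_def)
qed

text \<open>Free modules are projective: a matrix factors through \<open>\<psi>\<close> as soon as
  each column has a preimage. \<open>P\<close> carries homogeneity for graded lifts and is trivial
  for homotopies.\<close>

lemma exists_lift:
  fixes \<psi> :: "'a::comm_ring_1 mat"
  assumes \<psi>: "\<psi> \<in> carrier_mat l m" and M: "M \<in> carrier_mat l n"
    and im: "\<And>c. c < n \<Longrightarrow> \<exists>g\<in>carrier_vec m. P c g \<and> \<psi> *\<^sub>v g = col M c"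
  shows "\<exists>L\<in>carrier_mat m n. \<psi> * L = M \<and> (\<forall>c<n. P c (col L c))"
proof -
  obtain g where g: "\<And>c. c < n \<Longrightarrow> g c \<in> carrier_vec m \<and> P c (g c) \<and> \<psi> *\<^sub>v g c = col M c"
    using im by metis
  define L where "L = mat m n (\<lambda>(r, c). g c $ r)"
  have col: "col L c = g c" if "c < n" for c
    using that g[OF that] by (intro eq_vecI) (auto simp: L_def)
  have "\<psi> * L = M"
  proof (rule mat_col_eqI)
    fix c assume "c < dim_col M"
    then have "c < n" using M by simp
    then show "col (\<psi> * L) c = col M c"
      using col g \<psi> by (subst col_mult2[OF \<psi>, of _ n]) (auto simp: L_def)
  qed (use \<psi> M in \<open>auto simp: L_def\<close>)
  then show ?thesis using col g by (intro bexI[of _ L]) (auto simp: L_def)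
qed

text \<open>A preimage of a column need not be homogeneous, but its component in the degree of the
  column is again a preimage.\<close>

lemma exists_graded_lift:
  assumes \<psi>: "graded_mat s t \<psi>" and M: "graded_mat s u M"
    and im: "mat_image M \<subseteq> mat_image \<psi>"
  shows "\<exists>L. graded_mat t u L \<and> \<psi> * L = M"
proof -
  note c = graded_mat_carrier[OF \<psi>] graded_mat_carrier[OF M]
  have "\<exists>g\<in>carrier_vec (length t). homog_vec t (u ! i) g \<and> \<psi> *\<^sub>v g = col M i" if "i < length u" for i
  proof -
    have "col M i \<in> mat_image \<psi>" using im mat_image_colsD[OF c(2) that] by blast
    then obtain g where g: "g \<in> carrier_vec (length t)" "\<psi> *\<^sub>v g = col M i"
      using c(1) by (auto simp: mat_image_def)
    have "homog_vec s (u ! i) (col M i)" using M that by (auto simp: graded_mat_cols_iff)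
    then have "\<psi> *\<^sub>v comp_vec t (u ! i) g = col M i"
      using comp_vec_mult[OF \<psi> g(1)] g c that by (simp add: comp_vec_homog)
    then show ?thesis by (intro bexI[of _ "comp_vec t (u ! i) g"]) auto
  qed
  from exists_lift[OF c(1,2) this] show ?thesis
    by (auto simp: graded_mat_cols_iff[of t u])
qed

lemma graded_mat_mult:
  assumes \<phi>: "graded_mat s t \<phi>" and \<psi>: "graded_mat t u \<psi>"
  shows "graded_mat s u (\<phi> * \<psi>)"
  unfolding graded_mat_cols_iff
proof (intro conjI allI impI)
  note c = graded_mat_carrier[OF \<phi>] graded_mat_carrier[OF \<psi>]
  show "\<phi> * \<psi> \<in> carrier_mat (length s) (length u)" using c by simp
  fix i assume i: "i < length u"
  have "comp_vec t (u ! i) (col \<psi> i) = col \<psi> i"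
    using \<psi> i c by (intro comp_vec_homog) (auto simp: graded_mat_cols_iff)
  then have "col (\<phi> * \<psi>) i = comp_vec s (u ! i) (\<phi> *\<^sub>v col \<psi> i)"
    using comp_vec_mult[OF \<phi>, of "col \<psi> i" "u ! i"] c i unfolding col_mult2[OF c i] by simp
  then show "homog_vec s (u ! i) (col (\<phi> * \<psi>) i)" by simp
qed

lemma lookup_mult_zero:
  fixes p q :: "('n, 'k::field) mpoly"
  shows "lookup (p * q) 0 = lookup p 0 * lookup q 0"
proof -
  have sum0: "a + b = 0 \<longleftrightarrow> a = 0 \<and> b = 0" for a b :: "'n expo"
    by (auto simp: poly_mapping_eq_iff fun_eq_iff lookup_add)
  define p0 p1 where "p0 = restrict_keys (\<lambda>a. a = 0) p" and "p1 = restrict_keys (\<lambda>a. a \<noteq> 0) p"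
  define q0 q1 where "q0 = restrict_keys (\<lambda>a. a = 0) q" and "q1 = restrict_keys (\<lambda>a. a \<noteq> 0) q"
  have "p = p0 + p1" "q = q0 + q1" by (simp_all add: p0_def p1_def q0_def q1_def restrict_keys_split)
  then have "p * q = p0 * q0 + (p0 * q1 + p1 * q)" by (simp add: algebra_simps)
  moreover have "0 \<notin> keys (p0 * q1)" "0 \<notin> keys (p1 * q)"
    by (auto elim!: keys_multE simp: p1_def q1_def sum0 eq_commute[of 0])
  moreover have "p0 = Poly_Mapping.single 0 (lookup p 0)" "q0 = Poly_Mapping.single 0 (lookup q 0)"
    by (rule poly_mapping_eqI; auto simp: p0_def q0_def lookup_restrict_keys lookup_single when_def)+
  ultimately show ?thesis by (simp add: lookup_add in_keys_iff mult_single)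
qed

lemma const_free_mult:
  assumes "\<phi> \<in> carrier_mat l m" "\<psi> \<in> carrier_mat m n" "const_free_mat \<phi> \<or> const_free_mat \<psi>"
  shows "const_free_mat (\<phi> * \<psi>)"
  unfolding const_free_mat_def
proof (intro allI impI)
  fix r c assume rc: "r < dim_row (\<phi> * \<psi>)" "c < dim_col (\<phi> * \<psi>)"
  have "(\<phi> * \<psi>) $$ (r, c) = (\<Sum>i<m. \<phi> $$ (r, i) * \<psi> $$ (i, c))"
    using assms rc by (auto simp: scalar_prod_def atLeast0LessThan intro!: sum.cong)
  then show "lookup ((\<phi> * \<psi>) $$ (r, c)) 0 = 0"
    using assms rc by (auto simp: lookup_sum lookup_mult_zero const_free_mat_def intro!: sum.neutral)
qed


section \<open>Comparison of resolutions\<close>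

text \<open>Minimality is split off, so that a Taylor resolution can be compared with a minimal
  one.\<close>

definition graded_resolution ::
    "('n::finite, 'k::field) mpoly set \<Rightarrow> ('n, 'k) mpoly set \<Rightarrow>
     (nat \<Rightarrow> nat list) \<Rightarrow> ('n, 'k) mpoly vec \<Rightarrow> (nat \<Rightarrow> ('n, 'k) mpoly mat) \<Rightarrow> bool" where
  "graded_resolution A B s \<epsilon> \<phi> \<longleftrightarrow>
     \<epsilon> \<in> carrier_vec (length (s 0)) \<and>
     (\<forall>c<length (s 0). \<epsilon> $ c \<in> A \<and> homogeneous (s 0 ! c) (\<epsilon> $ c)) \<and>
     (\<forall>i. graded_mat (s i) (s (Suc i)) (\<phi> i)) \<and>
     A = {scalar_prod \<epsilon> f + b |f b. f \<in> carrier_vec (length (s 0)) \<and> b \<in> B} \<and>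
     {f \<in> carrier_vec (length (s 0)). scalar_prod \<epsilon> f \<in> B} = mat_image (\<phi> 0) \<and>
     (\<forall>i. mat_kernel (\<phi> i) = mat_image (\<phi> (Suc i)))"

lemma minimal_graded_resolution_iff:
  "minimal_graded_resolution A B s \<epsilon> \<phi> \<longleftrightarrow>
    graded_resolution A B s \<epsilon> \<phi> \<and> (\<forall>i. const_free_mat (\<phi> i))"
proof -
  define C where "C \<longleftrightarrow> (\<forall>i. \<phi> i \<in> carrier_mat (length (s i)) (length (s (Suc i))))"
  have gr: "(\<forall>i. graded_mat (s i) (s (Suc i)) (\<phi> i)) \<longleftrightarrow> C \<and>
      (\<forall>i. \<forall>r<length (s i). \<forall>c<length (s (Suc i)).
        \<forall>a\<in>keys (\<phi> i $$ (r, c)). expo_deg a + s i ! r = s (Suc i) ! c)"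
    unfolding graded_mat_def C_def by blast
  show ?thesis
  proof (cases C)
    case True
    have im: "(\<lambda>g. \<phi> i *\<^sub>v g) ` carrier_vec (length (s (Suc i))) = mat_image (\<phi> i)"
      and cf: "(\<forall>r<length (s i). \<forall>c<length (s (Suc i)). lookup (\<phi> i $$ (r, c)) 0 = 0) \<longleftrightarrow>
        const_free_mat (\<phi> i)" for i
      using carrier_matD[OF True[unfolded C_def, rule_format, of i]]
      by (simp_all add: mat_image_def const_free_mat_def)
    show ?thesis
      unfolding minimal_graded_resolution_def graded_resolution_def gr C_def[symmetric] cf im
        One_nat_def by (simp only: conj_assoc True simp_thms)
  next
    case False
    then show ?thesis
      unfolding minimal_graded_resolution_def graded_resolution_def gr C_def[symmetric] by simp
  qed
qed

definition homogeneous_ideal :: "('n::finite, 'k::field) mpoly set \<Rightarrow> bool" where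
  "homogeneous_ideal B \<longleftrightarrow> is_ideal B \<and> (\<forall>p\<in>B. \<forall>e. restrict_keys (\<lambda>a. expo_deg a = e) p \<in> B)"

text \<open>Exactness at the first free module is relative to \<open>B\<close>, later it concerns a
  kernel; a common name lets one recursion handle both cases.\<close>

definition aug_kernel :: "('n::finite, 'k::field) mpoly set \<Rightarrow> ('n, 'k) mpoly vec \<Rightarrow>
    (nat \<Rightarrow> ('n, 'k) mpoly mat) \<Rightarrow> nat \<Rightarrow> ('n, 'k) mpoly vec set" where
  "aug_kernel B \<epsilon> \<phi> i = (case i of
     0 \<Rightarrow> {f \<in> carrier_vec (dim_vec \<epsilon>). scalar_prod \<epsilon> f \<in> B} | Suc j \<Rightarrow> mat_kernel (\<phi> j))"

lemma graded_resolution_image: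
  assumes "graded_resolution A B s \<epsilon> \<phi>"
  shows "mat_image (\<phi> i) = aug_kernel B \<epsilon> \<phi> i"
  using assms by (auto simp: graded_resolution_def aug_kernel_def split: nat.split)

lemma graded_resolution_mat:
  assumes "graded_resolution A B s \<epsilon> \<phi>"
  shows "graded_mat (s i) (s (Suc i)) (\<phi> i)" "\<phi> i \<in> carrier_mat (length (s i)) (length (s (Suc i)))"
  using assms by (auto simp: graded_resolution_def graded_mat_carrier)

lemma is_idealD:
  assumes "is_ideal J"
  shows "0 \<in> J" "p \<in> J \<Longrightarrow> q \<in> J \<Longrightarrow> p + q \<in> J" "p \<in> J \<Longrightarrow> c * p \<in> J" "p \<in> J \<Longrightarrow> q \<in> J \<Longrightarrow> p - q \<in> J"
  using assms ideals.subspace_diff by (auto simp: ideals.subspace_def)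

lemma scalar_prod_mult_mat_vec:
  fixes \<eta> :: "'a::comm_ring_1 vec"
  assumes "\<eta> \<in> carrier_vec m" "\<alpha> \<in> carrier_mat m n" "f \<in> carrier_vec n"
  shows "\<eta> \<bullet> (\<alpha> *\<^sub>v f) = (\<Sum>c<n. f $ c * (\<eta> \<bullet> col \<alpha> c))"
proof -
  have "\<eta> \<bullet> (\<alpha> *\<^sub>v f) = (\<Sum>r<m. \<Sum>c<n. f $ c * (\<eta> $ r * \<alpha> $$ (r, c)))"
    using assms by (simp add: scalar_prod_def[of \<eta>] atLeast0LessThan mult_mat_vec_index[OF assms(2,3)]
        sum_distrib_left mult.left_commute mult.commute[of _ "f $ _"] del: index_mult_mat_vec)
  also have "\<dots> = (\<Sum>c<n. f $ c * (\<eta> \<bullet> col \<alpha> c))"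
    using assms by (subst sum.swap) (simp add: scalar_prod_def atLeast0LessThan sum_distrib_left)
  finally show ?thesis .
qed

text \<open>The identity of \<open>A/B\<close> lifts step by step to a chain map of graded free
  modules. At the first module the lift is compatible with the augmentations only modulo
  \<open>B\<close>. The recursion keeps the fact that augmented kernels are mapped into augmented
  kernels, which is what the next lift requires.\<close>

lemma comparison_maps:
  fixes A B :: "('n::finite, 'k::field) mpoly set"
  assumes F: "graded_resolution A B s \<epsilon> \<phi>" and G: "graded_resolution A B t \<eta> \<psi>"
    and B: "homogeneous_ideal B"
  shows "\<exists>\<alpha>. (\<forall>i. graded_mat (t i) (s i) (\<alpha> i)) \<and>
    (\<forall>f\<in>carrier_vec (length (s 0)). \<epsilon> \<bullet> f - \<eta> \<bullet> (\<alpha> 0 *\<^sub>v f) \<in> B) \<and>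
    (\<forall>i. \<psi> i * \<alpha> (Suc i) = \<alpha> i * \<phi> i)"
proof -
  have B': "is_ideal B" using B by (simp add: homogeneous_ideal_def)
  define P where "P i \<alpha> \<longleftrightarrow> graded_mat (t i) (s i) \<alpha> \<and>
      (\<forall>f\<in>aug_kernel B \<epsilon> \<phi> i. \<alpha> *\<^sub>v f \<in> aug_kernel B \<eta> \<psi> i) \<and>
      (i = 0 \<longrightarrow> (\<forall>f\<in>carrier_vec (length (s 0)). \<epsilon> \<bullet> f - \<eta> \<bullet> (\<alpha> *\<^sub>v f) \<in> B))" for i \<alpha>
  have \<epsilon>: "\<epsilon> \<in> carrier_vec (length (s 0))"
    and \<epsilon>': "\<And>c. c < length (s 0) \<Longrightarrow> \<epsilon> $ c \<in> A \<and> homogeneous (s 0 ! c) (\<epsilon> $ c)"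
    using F by (auto simp: graded_resolution_def)
  have \<eta>: "\<eta> \<in> carrier_vec (length (t 0))"
    and \<eta>': "\<And>c. c < length (t 0) \<Longrightarrow> homogeneous (t 0 ! c) (\<eta> $ c)"
    and A: "A = {\<eta> \<bullet> f + b |f b. f \<in> carrier_vec (length (t 0)) \<and> b \<in> B}"
    using G by (auto simp: graded_resolution_def)
  have "\<exists>\<alpha>. P 0 \<alpha>"
  proof -
    have "\<exists>g\<in>carrier_vec (length (t 0)). homog_vec (t 0) (s 0 ! c) g \<and> \<epsilon> $ c - \<eta> \<bullet> g \<in> B"
      if c: "c < length (s 0)" for c
    proof -
      define e where "e = s 0 ! c"
      obtain g b where g: "\<epsilon> $ c = \<eta> \<bullet> g + b" "g \<in> carrier_vec (length (t 0))" "b \<in> B"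
        using \<epsilon>'[OF c] unfolding A by blast
      \<comment> \<open>The representative \<open>g\<close> is cut down to the degree of the
        generator; the error is a component of \<open>b\<close> and stays in the homogeneous ideal
        \<open>B\<close>.\<close>
      have "\<eta> \<bullet> comp_vec (t 0) e g = restrict_keys (\<lambda>a. expo_deg a = e) (\<eta> \<bullet> g)"
        using g(2) \<eta>' \<eta> by (auto simp: scalar_prod_def comp_vec_def restrict_keys_sum homogeneous_def
            intro!: sum.cong restrict_keys_mult[symmetric])
      moreover have "\<epsilon> $ c = restrict_keys (\<lambda>a. expo_deg a = e) (\<epsilon> $ c)"
        using \<epsilon>'[OF c] by (subst restrict_keys_id) (auto simp: homogeneous_def e_def)
      ultimately have "\<epsilon> $ c - \<eta> \<bullet> comp_vec (t 0) e g = restrict_keys (\<lambda>a. expo_deg a = e) b"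
        by (simp add: g(1) restrict_keys_add)
      then show ?thesis using B g(3)
        by (intro bexI[of _ "comp_vec (t 0) e g"]) (auto simp: homogeneous_ideal_def e_def)
    qed
    then obtain g where g: "\<And>c. c < length (s 0) \<Longrightarrow> g c \<in> carrier_vec (length (t 0)) \<and>
        homog_vec (t 0) (s 0 ! c) (g c) \<and> \<epsilon> $ c - \<eta> \<bullet> g c \<in> B" by metis
    define \<alpha> where "\<alpha> = mat (length (t 0)) (length (s 0)) (\<lambda>(r, c). g c $ r)"
    have \<alpha>: "\<alpha> \<in> carrier_mat (length (t 0)) (length (s 0))" by (simp add: \<alpha>_def)
    have col: "col \<alpha> c = g c" if "c < length (s 0)" for c
      using that g[OF that] by (intro eq_vecI) (auto simp: \<alpha>_def)
    have "graded_mat (t 0) (s 0) \<alpha>" using g \<alpha> col by (simp add: graded_mat_cols_iff)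
    moreover have in_B: "\<epsilon> \<bullet> f - \<eta> \<bullet> (\<alpha> *\<^sub>v f) \<in> B" if f: "f \<in> carrier_vec (length (s 0))" for f
    proof -
      have "\<epsilon> \<bullet> f - \<eta> \<bullet> (\<alpha> *\<^sub>v f) = (\<Sum>c<length (s 0). f $ c * (\<epsilon> $ c - \<eta> \<bullet> g c))"
        using f by (simp add: scalar_prod_mult_mat_vec[OF \<eta> \<alpha> f] col scalar_prod_def[of \<epsilon>]
            atLeast0LessThan sum_subtractf right_diff_distrib mult.commute)
      also have "\<dots> \<in> B" using g by (intro is_ideal_sum B' is_idealD(3)) auto
      finally show ?thesis .
    qed
    moreover have "\<alpha> *\<^sub>v f \<in> aug_kernel B \<eta> \<psi> 0" if "f \<in> aug_kernel B \<epsilon> \<phi> 0" for f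
    proof -
      have f: "f \<in> carrier_vec (length (s 0))" "\<epsilon> \<bullet> f \<in> B"
        using that \<epsilon> by (auto simp: aug_kernel_def)
      have "\<eta> \<bullet> (\<alpha> *\<^sub>v f) = \<epsilon> \<bullet> f - (\<epsilon> \<bullet> f - \<eta> \<bullet> (\<alpha> *\<^sub>v f))" by simp
      also have "\<dots> \<in> B" using in_B[OF f(1)] f(2) is_idealD(4)[OF B'] by blast
      finally show ?thesis using \<alpha> \<eta> f by (auto simp: aug_kernel_def)
    qed
    ultimately show ?thesis unfolding P_def by blast
  qed
  moreover have "\<exists>\<alpha>'. P (Suc i) \<alpha>' \<and> \<psi> i * \<alpha>' = \<alpha> * \<phi> i" if \<alpha>: "P i \<alpha>" for i \<alpha>
  proof -
    note \<phi> = graded_resolution_mat[OF F, of i] and \<psi> = graded_resolution_mat[OF G, of i]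
    have \<alpha>_gr: "graded_mat (t i) (s i) \<alpha>" using \<alpha> by (simp add: P_def)
    note \<alpha>c = graded_mat_carrier[OF \<alpha>_gr]
    have gr: "graded_mat (t i) (s (Suc i)) (\<alpha> * \<phi> i)" by (rule graded_mat_mult[OF \<alpha>_gr \<phi>(1)])
    have "mat_image (\<alpha> * \<phi> i) \<subseteq> mat_image (\<psi> i)"
    proof -
      have "\<alpha> *\<^sub>v (\<phi> i *\<^sub>v g) \<in> mat_image (\<psi> i)" if "g \<in> carrier_vec (length (s (Suc i)))" for g
      proof -
        have "\<phi> i *\<^sub>v g \<in> aug_kernel B \<epsilon> \<phi> i"
          using that \<phi> unfolding graded_resolution_image[OF F, symmetric] by (auto simp: mat_image_def)
        then show ?thesis using \<alpha> unfolding graded_resolution_image[OF G] P_def by blast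
      qed
      then show ?thesis using \<phi> \<alpha>c by (auto simp: mat_image_def)
    qed
    then obtain \<alpha>' where \<alpha>': "graded_mat (t (Suc i)) (s (Suc i)) \<alpha>'" "\<psi> i * \<alpha>' = \<alpha> * \<phi> i"
      using exists_graded_lift[OF \<psi>(1) gr] by blast
    have "\<alpha>' *\<^sub>v f \<in> mat_kernel (\<psi> i)" if "f \<in> mat_kernel (\<phi> i)" for f
    proof -
      have f: "f \<in> carrier_vec (length (s (Suc i)))" "\<phi> i *\<^sub>v f = 0\<^sub>v (length (s i))"
        using that mat_kernelD[OF \<phi>(2)] by auto
      note \<alpha>'c = graded_mat_carrier[OF \<alpha>'(1)]
      have "\<psi> i *\<^sub>v (\<alpha>' *\<^sub>v f) = (\<alpha> * \<phi> i) *\<^sub>v f"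
        using \<psi>(2) \<alpha>'c f by (simp flip: \<alpha>'(2))
      also have "\<dots> = 0\<^sub>v (length (t i))"
        using \<phi>(2) \<alpha>c f by (simp add: mult_mat_vec_zero[OF \<alpha>c])
      finally show ?thesis using \<alpha>'c f by (intro mat_kernelI[OF \<psi>(2)]) auto
    qed
    then have "P (Suc i) \<alpha>'" using \<alpha>' by (auto simp: P_def aug_kernel_def)
    then show ?thesis using \<alpha>'(2) by blast
  qed
  ultimately have "\<exists>\<alpha>. \<forall>i. P i (\<alpha> i) \<and> \<psi> i * \<alpha> (Suc i) = \<alpha> i * \<phi> i"
    by (rule dependent_nat_choice)
  then show ?thesis unfolding P_def by blast
qed

text \<open>
  An endomorphism \<open>\<gamma>\<close> of a minimal resolution lifting the identity is homotopic to the identity, and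
  by minimality the homotopy \<open>\<gamma> - 1 = \<phi> h + h \<phi>\<close> vanishes modulo the variables.
\<close>

lemma lift_of_identity_const_free:
  fixes A B :: "('n::finite, 'k::field) mpoly set"
  assumes F: "minimal_graded_resolution A B s \<epsilon> \<phi>"
    and \<gamma>: "\<And>i. \<gamma> i \<in> carrier_mat (length (s i)) (length (s i))"
    and lift: "\<And>f. f \<in> carrier_vec (length (s 0)) \<Longrightarrow> \<epsilon> \<bullet> (\<gamma> 0 *\<^sub>v f) - \<epsilon> \<bullet> f \<in> B"
    and chain: "\<And>i. \<phi> i * \<gamma> (Suc i) = \<gamma> i * \<phi> i"
  shows "const_free_mat (\<gamma> i - 1\<^sub>m (length (s i)))"
proof -
  define n where "n i = length (s i)" for i
  define \<delta> where "\<delta> i = \<gamma> i - 1\<^sub>m (n i)" for i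
  have F': "graded_resolution A B s \<epsilon> \<phi>" and cf: "\<And>i. const_free_mat (\<phi> i)"
    using F by (auto simp: minimal_graded_resolution_iff)
  have \<phi>: "\<phi> i \<in> carrier_mat (n i) (n (Suc i))" for i
    using graded_resolution_mat[OF F'] by (simp add: n_def)
  have \<delta>: "\<delta> i \<in> carrier_mat (n i) (n i)" for i unfolding \<delta>_def by (rule minus_carrier_mat) simp
  have chain': "\<phi> i * \<delta> (Suc i) = \<delta> i * \<phi> i" for i
    using \<phi>[of i] \<gamma>[of i] \<gamma>[of "Suc i"] chain[of i]
    by (simp add: \<delta>_def n_def[symmetric] mult_minus_distrib_mat[OF \<phi>] minus_mult_distrib_mat[OF _ _ \<phi>])
  have \<epsilon>: "\<epsilon> \<in> carrier_vec (n 0)" using F' by (auto simp: graded_resolution_def n_def)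
  \<comment> \<open>This is the homotopy identity multiplied by \<open>\<phi> i\<close> on the
    right. The term with the previous homotopy vanishes there, so the invariant involves a single
    \<open>h\<close>.\<close>
  have "\<exists>h\<in>carrier_mat (n (Suc i)) (n i). \<phi> i * h * \<phi> i = \<delta> i * \<phi> i \<and> const_free_mat (\<delta> i)" for i
  proof (induction i)
    case 0
    have "\<exists>g\<in>carrier_vec (n 1). True \<and> \<phi> 0 *\<^sub>v g = col (\<delta> 0) c" if c: "c < n 0" for c
    proof -
      have "col (\<delta> 0) c = \<gamma> 0 *\<^sub>v unit_vec (n 0) c - unit_vec (n 0) c"
        using c \<gamma>[of 0] by (intro eq_vecI) (auto simp: \<delta>_def n_def)
      then have "\<epsilon> \<bullet> col (\<delta> 0) c = \<epsilon> \<bullet> (\<gamma> 0 *\<^sub>v unit_vec (n 0) c) - \<epsilon> \<bullet> unit_vec (n 0) c"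
        using \<epsilon> \<gamma>[of 0] by (simp add: scalar_prod_minus_distrib[of _ "n 0"] n_def)
      then have "col (\<delta> 0) c \<in> aug_kernel B \<epsilon> \<phi> 0"
        using lift[of "unit_vec (n 0) c"] \<epsilon> \<delta>[of 0] c by (auto simp: aug_kernel_def n_def)
      then show ?thesis unfolding graded_resolution_image[OF F', symmetric]
        using \<phi>[of 0] by (auto simp: mat_image_def)
    qed
    from exists_lift[OF \<phi>[of 0] \<delta>[of 0], of "\<lambda>_ _. True"] this
    obtain h where h: "h \<in> carrier_mat (n 1) (n 0)" "\<phi> 0 * h = \<delta> 0" by auto
    then have "const_free_mat (\<delta> 0)" using const_free_mult[OF \<phi>[of 0]] cf by (metis One_nat_def)
    with h show ?case by (intro bexI[of _ h]) auto
  next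
    case (Suc i)
    then obtain h where h: "h \<in> carrier_mat (n (Suc i)) (n i)" "\<phi> i * h * \<phi> i = \<delta> i * \<phi> i" by blast
    \<comment> \<open>\<open>\<phi> i\<close> kills \<open>E\<close>, because \<open>\<phi> i *
      \<delta> (Suc i) = \<delta> i * \<phi> i = \<phi> i * h * \<phi> i\<close>. By exactness
      \<open>E\<close> factors through \<open>\<phi> (Suc i)\<close>, and the factor is the next
      homotopy.\<close>
    define E where "E = \<delta> (Suc i) - h * \<phi> i"
    have E: "E \<in> carrier_mat (n (Suc i)) (n (Suc i))" unfolding E_def by (rule minus_carrier_mat[OF mult_carrier_mat[OF h(1) \<phi>]])
    have "\<phi> i * E = 0\<^sub>m (n i) (n (Suc i))"
      using h(2) chain'[of i] \<delta>[of i] \<phi>[of i] h(1)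
      by (simp add: E_def mult_minus_distrib_mat[OF \<phi> \<delta> mult_carrier_mat[OF h(1) \<phi>]])
    then have "\<phi> i *\<^sub>v col E c = 0\<^sub>v (n i)" if "c < n (Suc i)" for c
      using that by (metis col_mult2[OF \<phi> E] col_zero)
    then have ker: "col E c \<in> mat_kernel (\<phi> i)" if "c < n (Suc i)" for c
      using that E by (intro mat_kernelI[OF \<phi>]) auto
    have im: "mat_kernel (\<phi> i) = mat_image (\<phi> (Suc i))" using F' by (simp add: graded_resolution_def)
    have "\<exists>g\<in>carrier_vec (n (Suc (Suc i))). True \<and> \<phi> (Suc i) *\<^sub>v g = col E c" if "c < n (Suc i)" for c
      using ker[OF that] \<phi>[of "Suc i"] unfolding im by (auto simp: mat_image_def)
    from exists_lift[OF \<phi>[of "Suc i"] E, of "\<lambda>_ _. True"] this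
    obtain h' where h': "h' \<in> carrier_mat (n (Suc (Suc i))) (n (Suc i))" "\<phi> (Suc i) * h' = E" by auto
    have \<delta>_eq: "\<delta> (Suc i) = E + h * \<phi> i"
      using \<delta>[of "Suc i"] h(1) \<phi>[of i] by (intro eq_matI) (auto simp: E_def)
    have "const_free_mat E" "const_free_mat (h * \<phi> i)"
      using const_free_mult[OF \<phi> h'(1)] const_free_mult[OF h(1) \<phi>] cf h'(2) by auto
    then have "const_free_mat (\<delta> (Suc i))"
      unfolding \<delta>_eq using E h(1) \<phi>[of i] by (auto simp: const_free_mat_def lookup_add)
    moreover have "\<phi> (Suc i) * h' * \<phi> (Suc i) = \<delta> (Suc i) * \<phi> (Suc i)"
    proof -
      have "\<phi> i * \<phi> (Suc i) = 0\<^sub>m (n i) (n (Suc (Suc i)))"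
      proof (rule mat_col_eqI)
        fix c assume c: "c < dim_col (0\<^sub>m (n i) (n (Suc (Suc i))) :: ('n, 'k) mpoly mat)"
        then have "col (\<phi> (Suc i)) c \<in> mat_kernel (\<phi> i)"
          unfolding im using mat_image_colsD[OF \<phi>] by simp
        then show "col (\<phi> i * \<phi> (Suc i)) c = col (0\<^sub>m (n i) (n (Suc (Suc i)))) c"
          using c mat_kernelD[OF \<phi>] by (simp add: col_mult2[OF \<phi> \<phi>])
      qed (use \<phi>[of i] \<phi>[of "Suc i"] in auto)
      then have "h * \<phi> i * \<phi> (Suc i) = 0\<^sub>m (n (Suc i)) (n (Suc (Suc i)))"
        using h(1) \<phi>[of i] \<phi>[of "Suc i"] by (simp add: assoc_mult_mat[OF h(1) \<phi> \<phi>])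
      then show ?thesis
        unfolding h'(2) \<delta>_eq using E \<phi>[of "Suc i"]
        by (simp add: add_mult_distrib_mat[OF E mult_carrier_mat[OF h(1) \<phi>] \<phi>])
    qed
    ultimately show ?case using h'(1) by blast
  qed
  then show ?thesis by (auto simp: \<delta>_def n_def)
qed

text \<open>The composite of the two comparison maps on the minimal side is the identity modulo the
  variables, so each diagonal entry has constant term 1. Hence some entry of
  \<open>\<alpha> i\<close> has a nonzero constant term, which for a graded map happens only between
  equal degrees.\<close>

theorem resolution_degrees_subset:
  fixes A B :: "('n::finite, 'k::field) mpoly set"
  assumes F: "minimal_graded_resolution A B s \<epsilon> \<phi>" and G: "graded_resolution A B t \<eta> \<psi>"
    and B: "homogeneous_ideal B"
  shows "set (s i) \<subseteq> set (t i)"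
proof
  have F': "graded_resolution A B s \<epsilon> \<phi>" using F by (simp add: minimal_graded_resolution_iff)
  obtain \<alpha> where \<alpha>: "\<And>i. graded_mat (t i) (s i) (\<alpha> i)"
    "\<And>f. f \<in> carrier_vec (length (s 0)) \<Longrightarrow> \<epsilon> \<bullet> f - \<eta> \<bullet> (\<alpha> 0 *\<^sub>v f) \<in> B"
    "\<And>i. \<psi> i * \<alpha> (Suc i) = \<alpha> i * \<phi> i"
    using comparison_maps[OF F' G B] by blast
  obtain \<beta> where \<beta>: "\<And>i. graded_mat (s i) (t i) (\<beta> i)"
    "\<And>f. f \<in> carrier_vec (length (t 0)) \<Longrightarrow> \<eta> \<bullet> f - \<epsilon> \<bullet> (\<beta> 0 *\<^sub>v f) \<in> B"
    "\<And>i. \<phi> i * \<beta> (Suc i) = \<beta> i * \<psi> i"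
    using comparison_maps[OF G F' B] by blast
  note \<alpha>c = graded_mat_carrier[OF \<alpha>(1)] and \<beta>c = graded_mat_carrier[OF \<beta>(1)]
  note \<phi>c = graded_resolution_mat(2)[OF F'] and \<psi>c = graded_resolution_mat(2)[OF G]
  have B': "is_ideal B" using B by (simp add: homogeneous_ideal_def)
  have "const_free_mat (\<beta> i * \<alpha> i - 1\<^sub>m (length (s i)))"
  proof (rule lift_of_identity_const_free[OF F])
    show "\<beta> i * \<alpha> i \<in> carrier_mat (length (s i)) (length (s i))" for i
      using \<alpha>c \<beta>c by (rule mult_carrier_mat[rotated])
    show "\<epsilon> \<bullet> (\<beta> 0 * \<alpha> 0 *\<^sub>v f) - \<epsilon> \<bullet> f \<in> B" if f: "f \<in> carrier_vec (length (s 0))" for f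
    proof -
      have \<alpha>f: "\<alpha> 0 *\<^sub>v f \<in> carrier_vec (length (t 0))" using \<alpha>c[of 0] f by simp
      have "\<epsilon> \<bullet> (\<beta> 0 * \<alpha> 0 *\<^sub>v f) - \<epsilon> \<bullet> f =
          0 - ((\<epsilon> \<bullet> f - \<eta> \<bullet> (\<alpha> 0 *\<^sub>v f)) + (\<eta> \<bullet> (\<alpha> 0 *\<^sub>v f) - \<epsilon> \<bullet> (\<beta> 0 *\<^sub>v (\<alpha> 0 *\<^sub>v f))))"
        using assoc_mult_mat_vec[OF \<beta>c \<alpha>c f] by simp
      also have "\<dots> \<in> B"
        using \<alpha>(2)[OF f] \<beta>(2)[OF \<alpha>f] is_idealD[OF B'] by blast
      finally show ?thesis .
    qed
    show "\<phi> i * (\<beta> (Suc i) * \<alpha> (Suc i)) = \<beta> i * \<alpha> i * \<phi> i" for i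
    proof -
      have "\<phi> i * (\<beta> (Suc i) * \<alpha> (Suc i)) = \<beta> i * \<psi> i * \<alpha> (Suc i)"
        using assoc_mult_mat[OF \<phi>c \<beta>c \<alpha>c] by (simp add: \<beta>(3))
      also have "\<dots> = \<beta> i * (\<alpha> i * \<phi> i)"
        using assoc_mult_mat[OF \<beta>c \<psi>c \<alpha>c] by (simp add: \<alpha>(3))
      also have "\<dots> = \<beta> i * \<alpha> i * \<phi> i" using assoc_mult_mat[OF \<beta>c \<alpha>c \<phi>c] by simp
      finally show ?thesis .
    qed
  qed
  moreover fix e assume "e \<in> set (s i)"
  then obtain r where r: "r < length (s i)" "e = s i ! r" by (auto simp: in_set_conv_nth)
  ultimately have "lookup ((\<beta> i * \<alpha> i) $$ (r, r)) 0 = 1"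
    using \<alpha>c[of i] \<beta>c[of i] by (auto simp: const_free_mat_def lookup_minus lookup_one)
  moreover have "(\<beta> i * \<alpha> i) $$ (r, r) = (\<Sum>c<length (t i). \<beta> i $$ (r, c) * \<alpha> i $$ (c, r))"
    using \<alpha>c[of i] \<beta>c[of i] r by (auto simp: scalar_prod_def atLeast0LessThan intro!: sum.cong)
  ultimately have "(\<Sum>c<length (t i). lookup (\<beta> i $$ (r, c)) 0 * lookup (\<alpha> i $$ (c, r)) 0) \<noteq> 0"
    by (simp add: lookup_sum lookup_mult_zero)
  then obtain c where c: "c < length (t i)" "lookup (\<beta> i $$ (r, c)) 0 * lookup (\<alpha> i $$ (c, r)) 0 \<noteq> 0"
    by (metis (no_types, lifting) lessThan_iff sum.not_neutral_contains_not_neutral)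
  then have "0 \<in> keys (\<alpha> i $$ (c, r))" by (auto simp: in_keys_iff)
  then have "t i ! c = s i ! r" using \<alpha>(1)[of i] c r unfolding graded_mat_def by fastforce
  then show "e \<in> set (t i)" using c r by (metis nth_mem)
qed


section \<open>Construction of resolutions\<close>

lemma const_free_mat_of_degrees:
  assumes "graded_mat s t \<phi>" "\<And>r c. r < length s \<Longrightarrow> c < length t \<Longrightarrow> s ! r < t ! c"
  shows "const_free_mat \<phi>"
  unfolding const_free_mat_def
proof (intro allI impI)
  fix r c assume "r < dim_row \<phi>" "c < dim_col \<phi>"
  then have rc: "r < length s" "c < length t" using graded_mat_carrier[OF assms(1)] by auto
  have "0 \<notin> keys (\<phi> $$ (r, c))" using assms rc unfolding graded_mat_def by fastforce
  then show "lookup (\<phi> $$ (r, c)) 0 = 0" by (simp add: in_keys_iff)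
qed

text \<open>Dependent choice: each step presents the current module of syzygies and passes on its
  kernel. \<open>Q\<close> is the invariant for degrees and module, \<open>C\<close> what is to be
  remembered about each map. The Taylor, linear and minimal resolutions all arise from this.\<close>

lemma iterate_resolution:
  assumes init: "Q 0 s0 N0"
    and step: "\<And>i s N. Q i s N \<Longrightarrow>
      \<exists>t \<phi>. graded_mat s t \<phi> \<and> mat_image \<phi> = N \<and> C i s t \<phi> \<and> Q (Suc i) t (mat_kernel \<phi>)"
  shows "\<exists>s \<phi>. s 0 = s0 \<and> mat_image (\<phi> 0) = N0 \<and>
    (\<forall>i. graded_mat (s i) (s (Suc i)) (\<phi> i) \<and> C i (s i) (s (Suc i)) (\<phi> i) \<and>
      mat_kernel (\<phi> i) = mat_image (\<phi> (Suc i)))"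
proof -
  define P where "P i x \<longleftrightarrow> Q i (fst x) (snd x) \<and> (i = 0 \<longrightarrow> x = (s0, N0))" for i x
  define S where "S i x y \<longleftrightarrow> (\<exists>\<phi>. graded_mat (fst x) (fst y) \<phi> \<and> mat_image \<phi> = snd x \<and>
      C i (fst x) (fst y) \<phi> \<and> snd y = mat_kernel \<phi>)" for i x y
  have "\<exists>f. \<forall>i. P i (f i) \<and> S i (f i) (f (Suc i))"
  proof (rule dependent_nat_choice)
    show "\<exists>x. P 0 x" using init by (auto simp: P_def)
    fix x i assume "P i x"
    then obtain t \<phi> where "graded_mat (fst x) t \<phi>" "mat_image \<phi> = snd x" "C i (fst x) t \<phi>"
      "Q (Suc i) t (mat_kernel \<phi>)"
      using step[of i "fst x" "snd x"] by (auto simp: P_def)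
    then show "\<exists>y. P (Suc i) y \<and> S i x y"
      by (intro exI[of _ "(t, mat_kernel \<phi>)"]) (auto simp: P_def S_def)
  qed
  then obtain f where f: "\<And>i. P i (f i)" "\<And>i. S i (f i) (f (Suc i))" by blast
  have "\<exists>\<phi>. \<forall>i. graded_mat (fst (f i)) (fst (f (Suc i))) (\<phi> i) \<and> mat_image (\<phi> i) = snd (f i) \<and>
      C i (fst (f i)) (fst (f (Suc i))) (\<phi> i) \<and> snd (f (Suc i)) = mat_kernel (\<phi> i)"
    using f(2) unfolding S_def by (intro choice) blast
  then obtain \<phi> where \<phi>: "\<And>i. graded_mat (fst (f i)) (fst (f (Suc i))) (\<phi> i)"
    "\<And>i. mat_image (\<phi> i) = snd (f i)" "\<And>i. C i (fst (f i)) (fst (f (Suc i))) (\<phi> i)"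
    "\<And>i. snd (f (Suc i)) = mat_kernel (\<phi> i)" by blast
  have f0: "f 0 = (s0, N0)" using f(1)[of 0] by (simp add: P_def)
  show ?thesis
  proof (rule exI[of _ "\<lambda>i. fst (f i)"], rule exI[of _ \<phi>], intro conjI allI)
    show "mat_kernel (\<phi> i) = mat_image (\<phi> (Suc i))" for i using \<phi>(2)[of "Suc i"] \<phi>(4)[of i] by simp
  qed (use \<phi> f0 in auto)
qed

definition ideal_vecs :: "('n::finite, 'k::field) mpoly set \<Rightarrow> ('n, 'k) mpoly vec set" where
  "ideal_vecs J = {v \<in> carrier_vec 1. v $ 0 \<in> J}"

definition one_vec1 :: "'a::one vec" where
  "one_vec1 = vec 1 (\<lambda>_. 1)"

lemma scalar_prod_one_vec1: "v \<in> carrier_vec (Suc 0) \<Longrightarrow> one_vec1 \<bullet> v = (v $ 0 :: 'a::comm_ring_1)"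
  by (simp add: one_vec1_def scalar_prod_def)

lemma graded_resolution_quotientI:
  assumes J: "is_ideal J" and s: "s 0 = [0]" and im: "mat_image (\<phi> 0) = ideal_vecs J"
    and "\<And>i. graded_mat (s i) (s (Suc i)) (\<phi> i)"
    and "\<And>i. mat_kernel (\<phi> i) = mat_image (\<phi> (Suc i))"
  shows "graded_resolution UNIV J s one_vec1 \<phi>"
proof -
  have "p \<in> {one_vec1 \<bullet> f + b |f b. f \<in> carrier_vec (Suc 0) \<and> b \<in> J}" for p
    using is_idealD(1)[OF J]
    by (intro CollectI exI[of _ "vec 1 (\<lambda>_. p)"] exI[of _ 0]) (simp add: scalar_prod_one_vec1)
  then have "UNIV = {one_vec1 \<bullet> f + b |f b. f \<in> carrier_vec (Suc 0) \<and> b \<in> J}" by blast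
  moreover have "ideal_vecs J = {f \<in> carrier_vec (Suc 0). one_vec1 \<bullet> f \<in> J}"
    by (auto simp: ideal_vecs_def scalar_prod_one_vec1)
  ultimately show ?thesis
    unfolding graded_resolution_def using assms
    by (simp add: homogeneous_def one_vec1_def)
qed

lemma homogeneous_ideal_MI: "homogeneous_ideal (MI A)"
  unfolding homogeneous_ideal_def using is_ideal_MI by (auto simp: MI_def)

lemma graded_submod_ideal_vecs:
  assumes "homogeneous_ideal J"
  shows "graded_submod [0] (ideal_vecs J)"
proof -
  have J: "is_ideal J" using assms by (simp add: homogeneous_ideal_def)
  have "submod 1 (ideal_vecs J)"
    unfolding submod_def ideal_vecs_def using is_idealD[OF J] by auto
  moreover have "comp_vec [0] e v \<in> ideal_vecs J" if "v \<in> ideal_vecs J" for v e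
    using that assms by (auto simp: ideal_vecs_def comp_vec_def homogeneous_ideal_def)
  ultimately show ?thesis by (simp add: graded_submod_def)
qed


subsection \<open>Lead frames\<close>

text \<open>
  A Schreyer-type step without monomial orders: a submodule of \<open>R\<^sup>m\<close> is filtered by the
  position of the last nonzero entry, and the possible last entries at position \<open>c\<close> form an ideal. If these
  ideals are monomial, with generators \<open>u\<close> for \<open>(c, u) \<in> set ps\<close>, then the elements of the submodule
  with last entries \<open>u\<close> generate it, and the last entries of their syzygies form colon ideals, which are
  again monomial.
\<close>

definition lead_ideal :: "nat \<Rightarrow> 'a::comm_ring_1 vec set \<Rightarrow> nat \<Rightarrow> 'a set" where
  "lead_ideal m N c = {f $ c |f. f \<in> N \<and> (\<forall>c'. c < c' \<and> c' < m \<longrightarrow> f $ c' = 0)}"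

text \<open>Because the list is sorted by position, generators before the \<open>l\<close>-th have
  their last entry at the same or a smaller position. The last entry of a syzygy at \<open>l\<close>
  is then constrained only by earlier generators at the same position.\<close>

definition lead_frame :: "nat list \<Rightarrow> ('n::finite, 'k::field) mpoly vec set \<Rightarrow> (nat \<times> 'n expo) list \<Rightarrow> bool" where
  "lead_frame s N ps \<longleftrightarrow> graded_submod s N \<and> sorted (map fst ps) \<and>
     (\<forall>x\<in>set ps. fst x < length s) \<and>
     (\<forall>c<length s. lead_ideal (length s) N c = MI {u. (c, u) \<in> set ps})"

definition frame_degrees :: "nat list \<Rightarrow> (nat \<times> 'n::finite expo) list \<Rightarrow> nat list" where
  "frame_degrees s ps = map (\<lambda>x. s ! fst x + expo_deg (snd x)) ps"

definition pair_up :: "nat \<Rightarrow> (nat \<Rightarrow> 'b list) \<Rightarrow> (nat \<times> 'b) list" where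
  "pair_up n W = concat (map (\<lambda>l. map (Pair l) (W l)) [0..<n])"

lemma pair_up_Suc: "pair_up (Suc n) W = pair_up n W @ map (Pair n) (W n)"
  by (simp add: pair_up_def)

lemma set_pair_up: "set (pair_up n W) = {(l, w). l < n \<and> w \<in> set (W l)}"
  by (auto simp: pair_up_def)

lemma sorted_pair_up: "sorted (map fst (pair_up n W))"
proof (induction n)
  case (Suc n)
  then show ?case by (auto simp: pair_up_Suc sorted_append set_pair_up comp_def map_replicate_const)
qed (simp add: pair_up_def)

lemma length_filter_pair_up:
  "length (filter (\<lambda>x. fst x = l) (pair_up n W)) = (if l < n then length (W l) else 0)"
proof (induction n)
  case (Suc n)
  have "filter (\<lambda>x. fst x = l) (map (Pair n) (W n)) = (if l = n then map (Pair n) (W n) else [])"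
    by (auto simp: filter_empty_conv)
  with Suc show ?case by (cases "l = n") (auto simp: pair_up_Suc)
qed (simp add: pair_up_def)

lemma distinct_pair_up: "(\<And>l. l < n \<Longrightarrow> distinct (W l)) \<Longrightarrow> distinct (pair_up n W)"
proof (induction n)
  case (Suc n)
  then show ?case by (auto simp: pair_up_Suc set_pair_up distinct_map inj_on_def)
qed (simp add: pair_up_def)

text \<open>\<open>W l\<close> may be any list generating the colon ideal of the earlier monomials
  at the same position by the \<open>l\<close>-th one: all quotients for the Taylor resolution,
  variables for linear quotients.\<close>

lemma lead_frame_step:
  fixes N :: "('n::finite, 'k::field) mpoly vec set"
  assumes frame: "lead_frame s N ps"
    and W: "\<And>l b. l < length ps \<Longrightarrow> (\<exists>w\<in>set (W l). w \<preceq> b) \<longleftrightarrow>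
      (\<exists>l'<l. fst (ps ! l') = fst (ps ! l) \<and> snd (ps ! l') \<preceq> b + snd (ps ! l))"
  shows "\<exists>\<phi>. graded_mat s (frame_degrees s ps) \<phi> \<and> mat_image \<phi> = N \<and>
    lead_frame (frame_degrees s ps) (mat_kernel \<phi>) (pair_up (length ps) W)"
proof -
  define m p where "m = length s" and "p = length ps"
  define c u where "c l = fst (ps ! l)" and "u l = snd (ps ! l)" for l
  define t where "t = frame_degrees s ps"
  have t: "length t = p" "\<And>l. l < p \<Longrightarrow> t ! l = s ! c l + expo_deg (u l)"
    by (auto simp: t_def frame_degrees_def p_def c_def u_def)
  have N_gr: "graded_submod s N" and N: "submod m N"
    using frame by (auto simp: lead_frame_def graded_submod_def m_def)
  have c_less: "c l < m" if "l < p" for l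
    using frame that by (auto simp: lead_frame_def c_def m_def p_def)
  have c_mono: "c l' \<le> c l" if "l' \<le> l" "l < p" for l l'
    using frame that sorted_nth_mono[of "map fst ps" l' l] by (auto simp: lead_frame_def c_def p_def)
  define S where "S i = {l. l < p \<and> c l = i}" for i
  have S_fin: "finite (S i)" for i by (simp add: S_def)
  have "{v. (i, v) \<in> set ps} = u ` S i" for i
    by (auto simp: S_def u_def c_def p_def in_set_conv_nth image_iff) (metis fst_conv snd_conv)
  then have lead: "lead_ideal m N i = MI (u ` S i)" if "i < m" for i
    using frame that by (simp add: lead_frame_def m_def)
  have "\<exists>g. g \<in> N \<and> homog_vec s (t ! l) g \<and> g $ c l = monomial (u l) \<and> (\<forall>i. c l < i \<and> i < m \<longrightarrow> g $ i = 0)"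
    if l: "l < p" for l
  proof -
    have "monomial (u l) \<in> lead_ideal m N (c l)"
      unfolding lead[OF c_less[OF l]] by (rule monomial_in_MI) (use l in \<open>auto simp: S_def\<close>)
    then obtain f where f: "f \<in> N" "monomial (u l) = f $ c l" "\<forall>i. c l < i \<and> i < m \<longrightarrow> f $ i = 0"
      by (auto simp: lead_ideal_def)
    have "comp_vec s (t ! l) f $ c l = monomial (u l)"
      using c_less[OF l] f(2)[symmetric] t(2)[OF l]
      by (auto simp: comp_vec_def m_def intro!: restrict_keys_id)
    moreover have "comp_vec s (t ! l) f $ i = 0" if "c l < i" "i < m" for i
      using that f(3) by (auto simp: comp_vec_def m_def)
    ultimately show ?thesis using N_gr f(1) by (intro exI[of _ "comp_vec s (t ! l) f"]) (auto simp: graded_submod_def)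
  qed
  then obtain g where g: "\<And>l. l < p \<Longrightarrow> g l \<in> N" "\<And>l. l < p \<Longrightarrow> homog_vec s (t ! l) (g l)"
    "\<And>l. l < p \<Longrightarrow> g l $ c l = monomial (u l)" "\<And>l i. l < p \<Longrightarrow> c l < i \<Longrightarrow> i < m \<Longrightarrow> g l $ i = 0"
    by metis
  define \<phi> where "\<phi> = mat m p (\<lambda>(r, l). g l $ r)"
  have \<phi>: "\<phi> \<in> carrier_mat m p" by (simp add: \<phi>_def)
  have col: "col \<phi> l = g l" if "l < p" for l
    using that submodD(1)[OF N g(1)[OF that]] by (intro eq_vecI) (auto simp: \<phi>_def)
  have \<phi>_index: "\<phi> $$ (r, l) = g l $ r" if "r < m" "l < p" for r l using that by (simp add: \<phi>_def)
  have gr: "graded_mat s t \<phi>" using \<phi> g(2) col t(1) by (auto simp: graded_mat_cols_iff m_def)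
  have \<phi>_in_N: "\<phi> *\<^sub>v a \<in> N" if "a \<in> carrier_vec p" for a
    by (rule mult_mat_vec_in_submod[OF N \<phi> that]) (use col g in auto)
  \<comment> \<open>Division from the last entry downwards. The clause that only generators with
    position below \<open>i\<close> are used keeps a later correction from disturbing the last entry
    of a syzygy.\<close>
  have lift: "\<exists>a\<in>carrier_vec p. \<phi> *\<^sub>v a = f \<and> (\<forall>l<p. i \<le> c l \<longrightarrow> a $ l = 0)"
    if "f \<in> N" "i \<le> m" "\<And>r. i \<le> r \<Longrightarrow> r < m \<Longrightarrow> f $ r = 0" for f i
    using that
  proof (induction i arbitrary: f)
    case 0
    then have "f = 0\<^sub>v m" using submodD(1)[OF N] by (intro eq_vecI) auto
    then show ?case using mult_mat_vec_zero[OF \<phi>] by (intro bexI[of _ "0\<^sub>v p"]) auto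
  next
    case (Suc i)
    have "f $ i \<in> lead_ideal m N i" using Suc.prems by (auto simp: lead_ideal_def)
    then have "f $ i \<in> MI (u ` S i)" using lead Suc.prems by simp
    then obtain q where q: "f $ i = (\<Sum>l\<in>S i. q l * monomial (u l))"
      using MI_finite_combination[OF S_fin] by blast
    define a' where "a' = vec p (\<lambda>l. if c l = i then q l else 0)"
    have a': "a' \<in> carrier_vec p" by (simp add: a'_def)
    have \<phi>a': "(\<phi> *\<^sub>v a') $ r = (\<Sum>l\<in>S i. g l $ r * q l)" if "r < m" for r
      unfolding mult_mat_vec_index[OF \<phi> a' that]
      by (rule sum.mono_neutral_cong_right) (use that in \<open>auto simp: S_def a'_def \<phi>_index\<close>)
    define f' where "f' = f - \<phi> *\<^sub>v a'"
    have "f' \<in> N" unfolding f'_def using Suc.prems \<phi>_in_N[OF a'] submod_diff[OF N] by blast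
    moreover have "f' $ r = 0" if "i \<le> r" "r < m" for r
    proof -
      have "(\<phi> *\<^sub>v a') $ r = f $ r"
      proof (cases "r = i")
        case True
        have "(\<phi> *\<^sub>v a') $ i = (\<Sum>l\<in>S i. q l * monomial (u l))"
          unfolding \<phi>a'[OF that(2)[unfolded True]]
          by (rule sum.cong) (use g(3) in \<open>auto simp: S_def mult.commute\<close>)
        then show ?thesis using q True by simp
      next
        case False
        then have "(\<phi> *\<^sub>v a') $ r = 0"
          unfolding \<phi>a'[OF that(2)] using that g(4) by (intro sum.neutral) (auto simp: S_def)
        then show ?thesis using Suc.prems(3)[of r] that False by simp
      qed
      then show ?thesis using that \<phi> unfolding f'_def by simp
    qed
    ultimately obtain a'' where a'': "a'' \<in> carrier_vec p" "\<phi> *\<^sub>v a'' = f'" "\<forall>l<p. i \<le> c l \<longrightarrow> a'' $ l = 0"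
      using Suc.IH[of f'] Suc.prems(2) by auto
    have f: "f \<in> carrier_vec m" using submodD(1)[OF N Suc.prems(1)] .
    have "\<phi> *\<^sub>v (a' + a'') = f"
      unfolding mult_mat_vec_add[OF \<phi> a' a''(1)] a''(2) f'_def
      using \<phi> f by (intro eq_vecI) auto
    moreover have "\<forall>l<p. Suc i \<le> c l \<longrightarrow> (a' + a'') $ l = 0" using a'' by (auto simp: a'_def)
    ultimately show ?case using a' a'' by (intro bexI[of _ "a' + a''"]) auto
  qed
  have im: "mat_image \<phi> = N"
  proof
    show "mat_image \<phi> \<subseteq> N" using \<phi>_in_N \<phi> by (auto simp: mat_image_def)
    show "N \<subseteq> mat_image \<phi>"
    proof
      fix f assume "f \<in> N"
      from lift[OF this, of m] show "f \<in> mat_image \<phi>" using \<phi> by (auto simp: mat_image_def)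
    qed
  qed
  have "lead_ideal p (mat_kernel \<phi>) l = MI {w. (l, w) \<in> set (pair_up p W)}" if l: "l < p" for l
  proof -
    have colon: "(\<exists>w\<in>set (W l). w \<preceq> b) \<longleftrightarrow> (\<exists>v\<in>u ` {l'. l' < l \<and> c l' = c l}. v \<preceq> b + u l)" for b
      using W[of l b] l by (auto simp: p_def u_def c_def)
    have "lead_ideal p (mat_kernel \<phi>) l = MI (set (W l))"
    proof (intro equalityI subsetI)
      fix q assume "q \<in> lead_ideal p (mat_kernel \<phi>) l"
      then obtain a where a: "q = a $ l" "a \<in> carrier_vec p" "\<phi> *\<^sub>v a = 0\<^sub>v m"
        "\<And>i. l < i \<Longrightarrow> i < p \<Longrightarrow> a $ i = 0"
        using mat_kernelD[OF \<phi>] by (auto simp: lead_ideal_def)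
      \<comment> \<open>Row \<open>c l\<close> of the syzygy: generators after \<open>l\<close> have
        coefficient 0, and earlier ones at smaller positions have entry 0 in this row. What remains
        puts \<open>q * monomial (u l)\<close> into the ideal of the earlier monomials.\<close>
      have "0 = (\<Sum>i<p. \<phi> $$ (c l, i) * a $ i)"
        using mult_mat_vec_index[OF \<phi> a(2) c_less[OF l]] a(3) c_less[OF l] by simp
      also have "\<dots> = (\<Sum>i\<in>insert l {i. i < l \<and> c i = c l}. \<phi> $$ (c l, i) * a $ i)"
      proof (rule sum.mono_neutral_right)
        show "\<forall>i\<in>{..<p} - insert l {i. i < l \<and> c i = c l}. \<phi> $$ (c l, i) * a $ i = 0"
        proof
          fix i assume i: "i \<in> {..<p} - insert l {i. i < l \<and> c i = c l}"
          show "\<phi> $$ (c l, i) * a $ i = 0"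
          proof (cases "l < i")
            case False
            then have "c i < c l" using i c_mono[of i l] l by (auto simp: less_le)
            then show ?thesis using g(4)[of i "c l"] i c_less[OF l] by (simp add: \<phi>_index)
          qed (use a(4) i in auto)
        qed
      qed (use l in auto)
      also have "\<dots> = monomial (u l) * q + (\<Sum>i\<in>{i. i < l \<and> c i = c l}. \<phi> $$ (c l, i) * a $ i)"
        using g(3)[OF l] l a(1) c_less[OF l] by (simp add: \<phi>_index)
      finally have "q * monomial (u l) = 0 - (\<Sum>i\<in>{i. i < l \<and> c i = c l}. \<phi> $$ (c l, i) * a $ i)"
        by (simp add: mult.commute eq_neg_iff_add_eq_0)
      also have "\<dots> \<in> MI (u ` {i. i < l \<and> c i = c l})"
      proof (rule is_idealD(4)[OF is_ideal_MI is_idealD(1)[OF is_ideal_MI] is_ideal_sum[OF is_ideal_MI]])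
        fix i assume i: "i \<in> {i. i < l \<and> c i = c l}"
        then have "\<phi> $$ (c l, i) = monomial (u i)"
          using g(3)[of i] l c_less[OF l] by (simp add: \<phi>_index)
        then have "\<phi> $$ (c l, i) * a $ i = a $ i * monomial (u i)" by (simp add: mult.commute)
        moreover have "\<dots> \<in> MI (u ` {i. i < l \<and> c i = c l})"
          using i by (intro is_idealD(3)[OF is_ideal_MI] monomial_in_MI) auto
        ultimately show "\<phi> $$ (c l, i) * a $ i \<in> MI (u ` {i. i < l \<and> c i = c l})" by simp
      qed
      finally have "\<forall>b\<in>keys q. \<exists>v\<in>u ` {i. i < l \<and> c i = c l}. v \<preceq> b + u l"
        by (simp only: mult_monomial_in_MI_iff)
      then show "q \<in> MI (set (W l))" unfolding MI_def using colon by blast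
    next
      fix q :: "('n, 'k) mpoly" assume q: "q \<in> MI (set (W l))"
      have "q * monomial (u l) \<in> MI (u ` {i. i < l \<and> c i = c l})"
        using q colon unfolding mult_monomial_in_MI_iff unfolding MI_def by blast
      then obtain h where h: "q * monomial (u l) = (\<Sum>i\<in>{i. i < l \<and> c i = c l}. h i * monomial (u i))"
        using MI_finite_combination[of "{i. i < l \<and> c i = c l}"] by auto
      \<comment> \<open>This cancels entry \<open>c l\<close> and everything above it. The rest lies
        in \<open>N\<close> below that position, so it lifts to some \<open>a\<close> vanishing from
        \<open>l\<close> onwards, and \<open>v - a\<close> is a syzygy with last entry
        \<open>q\<close>.\<close>
      define v where "v = vec p (\<lambda>i. if i = l then q else if i < l \<and> c i = c l then - h i else 0)"
      have v: "v \<in> carrier_vec p" by (simp add: v_def)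
      have \<phi>v: "(\<phi> *\<^sub>v v) $ r = g l $ r * q - (\<Sum>i\<in>{i. i < l \<and> c i = c l}. g i $ r * h i)" if "r < m" for r
      proof -
        have "(\<phi> *\<^sub>v v) $ r = (\<Sum>i\<in>insert l {i. i < l \<and> c i = c l}. g i $ r * v $ i)"
          unfolding mult_mat_vec_index[OF \<phi> v that]
          by (rule sum.mono_neutral_cong_right) (use that l in \<open>auto simp: v_def \<phi>_index\<close>)
        also have "\<dots> = g l $ r * q + (\<Sum>i\<in>{i. i < l \<and> c i = c l}. g i $ r * v $ i)"
          using l by (simp add: v_def)
        also have "(\<Sum>i\<in>{i. i < l \<and> c i = c l}. g i $ r * v $ i) =
            (\<Sum>i\<in>{i. i < l \<and> c i = c l}. - (g i $ r * h i))"
          using l by (intro sum.cong) (auto simp: v_def)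
        finally show ?thesis by (simp add: sum_negf)
      qed
      have "(\<phi> *\<^sub>v v) $ r = 0" if r: "c l \<le> r" "r < m" for r
      proof (cases "r = c l")
        case True
        have "(\<Sum>i\<in>{i. i < l \<and> c i = c l}. g i $ r * h i) = q * monomial (u l)"
          unfolding h
        proof (intro sum.cong refl)
          fix i assume "i \<in> {i. i < l \<and> c i = c l}"
          then have "g i $ r = monomial (u i)" using g(3)[of i] l True by simp
          then show "g i $ r * h i = h i * monomial (u i)" by (simp add: mult.commute)
        qed
        then show ?thesis unfolding \<phi>v[OF r(2)] using g(3)[OF l] True by (simp add: mult.commute)
      next
        case False
        then have "(\<Sum>i\<in>{i. i < l \<and> c i = c l}. g i $ r * h i) = 0"
          using r l g(4) by (intro sum.neutral) auto
        then show ?thesis unfolding \<phi>v[OF r(2)] using g(4)[OF l] r False by simp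
      qed
      then obtain a where a: "a \<in> carrier_vec p" "\<phi> *\<^sub>v a = \<phi> *\<^sub>v v" "\<And>i. i < p \<Longrightarrow> c l \<le> c i \<Longrightarrow> a $ i = 0"
        using lift[OF \<phi>_in_N[OF v], of "c l"] c_less[OF l] by auto
      have a0: "a $ i = 0" if "l \<le> i" "i < p" for i using a(3)[of i] c_mono[of l i] that by auto
      have "\<phi> *\<^sub>v (v - a) = 0\<^sub>v m"
        unfolding mult_minus_distrib_mat_vec[OF \<phi> v a(1)] a(2) using \<phi> by (intro eq_vecI) auto
      then have "v - a \<in> mat_kernel \<phi>" using v a(1) by (intro mat_kernelI[OF \<phi>]) auto
      moreover have "(v - a) $ l = q" "\<forall>i. l < i \<and> i < p \<longrightarrow> (v - a) $ i = 0"
        using v a(1) a0 l by (auto simp: v_def)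
      ultimately show "q \<in> lead_ideal p (mat_kernel \<phi>) l" unfolding lead_ideal_def by blast
    qed
    then show ?thesis using l by (simp add: set_pair_up)
  qed
  then have "lead_frame t (mat_kernel \<phi>) (pair_up p W)"
    unfolding lead_frame_def using graded_submod_kernel[OF gr] t(1)
    by (auto simp: sorted_pair_up set_pair_up)
  then show ?thesis using gr im unfolding t_def p_def by blast
qed

lemma lead_frame_monomial_ideal:
  "lead_frame [0] (ideal_vecs (MI (set us)) :: ('n::finite, 'k::field) mpoly vec set) (map (Pair 0) us)"
proof -
  have "lead_ideal 1 (ideal_vecs (MI (set us))) 0 = (MI (set us) :: ('n, 'k) mpoly set)"
  proof (intro equalityI subsetI)
    fix p :: "('n, 'k) mpoly" assume "p \<in> MI (set us)"
    then show "p \<in> lead_ideal 1 (ideal_vecs (MI (set us))) 0"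
      unfolding lead_ideal_def ideal_vecs_def by (intro CollectI exI[of _ "vec 1 (\<lambda>_. p)"]) auto
  qed (auto simp: lead_ideal_def ideal_vecs_def)
  moreover have "{u. (0, u) \<in> set (map (Pair (0::nat)) us)} = set us" by auto
  moreover have "sorted (map fst (map (Pair (0::nat)) us))" by (simp add: comp_def map_replicate_const)
  ultimately show ?thesis
    by (auto simp: lead_frame_def graded_submod_ideal_vecs homogeneous_ideal_MI)
qed

text \<open>Truncated subtraction of exponents is division of the earlier monomial by its greatest
  common divisor with the \<open>l\<close>-th one.\<close>

definition colon_gens :: "(nat \<times> 'n expo) list \<Rightarrow> nat \<Rightarrow> 'n expo list" where
  "colon_gens ps l =
     map (\<lambda>l'. snd (ps ! l') - snd (ps ! l)) (filter (\<lambda>l'. fst (ps ! l') = fst (ps ! l)) [0..<l])"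

lemma colon_gens_colon:
  "(\<exists>w\<in>set (colon_gens ps l). w \<preceq> b) \<longleftrightarrow>
    (\<exists>l'<l. fst (ps ! l') = fst (ps ! l) \<and> snd (ps ! l') \<preceq> b + snd (ps ! l))"
  by (auto simp: colon_gens_def expo_diff_le_iff)

text \<open>Iterating the step with all the generators of the colon ideals gives the Taylor resolution.\<close>

lemma finite_resolution_MI:
  fixes T :: "'n::finite expo set"
  assumes "finite T"
  shows "\<exists>s \<phi> K. graded_resolution UNIV (MI T :: ('n, 'k::field) mpoly set) s one_vec1 \<phi> \<and>
    (\<forall>i\<ge>K. s (Suc i) = [])"
proof -
  obtain us where us: "T = set us" using assms finite_list by blast
  define K where "K = length us"
  \<comment> \<open>Termination: the largest number of frame elements at one position drops at each
    step, since \<open>colon_gens ps l\<close> draws only on elements listed before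
    \<open>l\<close>.\<close>
  define Q where "Q i s (N :: ('n, 'k) mpoly vec set) \<longleftrightarrow>
      (\<exists>ps. lead_frame s N ps \<and> (\<forall>c. length (filter (\<lambda>x. fst x = c) ps) \<le> K - i))" for i s N
  have "Q 0 [0] (ideal_vecs (MI (set us)))"
    unfolding Q_def using lead_frame_monomial_ideal[of us] length_filter_le[of _ "map (Pair 0) us"]
    by (intro exI[of _ "map (Pair 0) us"]) (simp add: K_def)
  moreover have "\<exists>t \<phi>. graded_mat s t \<phi> \<and> mat_image \<phi> = N \<and> (K \<le> i \<longrightarrow> t = []) \<and> Q (Suc i) t (mat_kernel \<phi>)"
    if "Q i s N" for i s N
  proof -
    obtain ps where ps: "lead_frame s N ps" "\<And>c. length (filter (\<lambda>x. fst x = c) ps) \<le> K - i"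
      using \<open>Q i s N\<close> unfolding Q_def by blast
    obtain \<phi> where \<phi>: "graded_mat s (frame_degrees s ps) \<phi>" "mat_image \<phi> = N"
      "lead_frame (frame_degrees s ps) (mat_kernel \<phi>) (pair_up (length ps) (colon_gens ps))"
      using lead_frame_step[OF ps(1) colon_gens_colon] by blast
    have "length (colon_gens ps l) \<le> K - Suc i" if l: "l < length ps" for l
    proof -
      have "length (colon_gens ps l) = card {l'. l' < l \<and> fst (ps ! l') = fst (ps ! l)}"
        unfolding colon_gens_def length_map length_filter_conv_card by (rule arg_cong[of _ _ card]) auto
      also have "\<dots> < card {l'. l' < length ps \<and> fst (ps ! l') = fst (ps ! l)}"
        using l by (intro psubset_card_mono) auto
      also have "\<dots> = length (filter (\<lambda>x. fst x = fst (ps ! l)) ps)"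
        by (simp add: length_filter_conv_card)
      also have "\<dots> \<le> K - i" by (rule ps(2))
      finally show ?thesis by simp
    qed
    then have "Q (Suc i) (frame_degrees s ps) (mat_kernel \<phi>)"
      unfolding Q_def using \<phi>(3)
      by (intro exI[of _ "pair_up (length ps) (colon_gens ps)"]) (auto simp: length_filter_pair_up)
    moreover have "frame_degrees s ps = []" if "K \<le> i"
    proof (rule ccontr)
      assume "frame_degrees s ps \<noteq> []"
      then obtain x where "x \<in> set ps" by (cases ps) (auto simp: frame_degrees_def)
      then have "filter (\<lambda>y. fst y = fst x) ps \<noteq> []" by (auto simp: filter_empty_conv)
      then show False using ps(2)[of "fst x"] that by simp
    qed
    ultimately show ?thesis using \<phi> by blast
  qed
  ultimately have "\<exists>s \<phi>. s 0 = [0] \<and> mat_image (\<phi> 0) = ideal_vecs (MI (set us) :: ('n, 'k) mpoly set) \<and>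
      (\<forall>i. graded_mat (s i) (s (Suc i)) (\<phi> i) \<and> (K \<le> i \<longrightarrow> s (Suc i) = []) \<and>
        mat_kernel (\<phi> i) = mat_image (\<phi> (Suc i)))"
    by (rule iterate_resolution[where C = "\<lambda>i s t \<phi>. K \<le> i \<longrightarrow> t = []"])
  then obtain s \<phi> where *: "s 0 = [0]" "mat_image (\<phi> 0) = ideal_vecs (MI T :: ('n, 'k) mpoly set)"
    "\<And>i. graded_mat (s i) (s (Suc i)) (\<phi> i)" "\<And>i. K \<le> i \<Longrightarrow> s (Suc i) = []"
    "\<And>i. mat_kernel (\<phi> i) = mat_image (\<phi> (Suc i))" unfolding us by blast
  then show ?thesis using graded_resolution_quotientI[OF is_ideal_MI, of s \<phi> T] by blast
qed

text \<open>Hypothesis \<open>lq\<close> makes every colon ideal of the first step generated by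
  variables. From then on the leading monomials at one position are distinct variables, whose colon
  ideals are again generated by variables. So the degree rises by exactly one from each step to the
  next, and strictly increasing degrees force minimality.\<close>

lemma linear_quotients_resolution:
  fixes us :: "'n::{finite,linorder} expo list"
  assumes deg: "\<And>u. u \<in> set us \<Longrightarrow> expo_deg u = q" and "q > 0"
    and lq: "\<And>l l'. l < length us \<Longrightarrow> l' < l \<Longrightarrow>
      \<exists>j. lookup (us ! l) j < lookup (us ! l') j \<and> (\<exists>l''<l. us ! l'' \<preceq> unit_expo j + us ! l)"
  shows "\<exists>s \<phi>. minimal_graded_resolution UNIV (MI (set us) :: ('n, 'k::field) mpoly set) s one_vec1 \<phi> \<and>
    s 0 = [0] \<and> (\<forall>i. set (s (Suc i)) \<subseteq> {q + i}) \<and> length (s 1) = length us"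
proof -
  define Q where "Q i s (N :: ('n, 'k) mpoly vec set) \<longleftrightarrow>
      (if i = 0 then s = [0] \<and> N = ideal_vecs (MI (set us))
       else set s \<subseteq> {q + i - 1} \<and>
        (\<exists>ps. lead_frame s N ps \<and> distinct ps \<and> (\<forall>x\<in>set ps. \<exists>j. snd x = unit_expo j)))" for i s N
  define C where "C i (s :: nat list) t (\<phi> :: ('n, 'k) mpoly mat) \<longleftrightarrow> set t \<subseteq> {q + i} \<and> const_free_mat \<phi> \<and>
      (i = 0 \<longrightarrow> length t = length us)" for i s t \<phi>
  have "Q 0 [0] (ideal_vecs (MI (set us)))" by (simp add: Q_def)
  moreover have "\<exists>t \<phi>. graded_mat s t \<phi> \<and> mat_image \<phi> = N \<and> C i s t \<phi> \<and> Q (Suc i) t (mat_kernel \<phi>)"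
    if Q: "Q i s N" for i s N
  proof (cases "i = 0")
    case True
    then have sN: "s = [0]" "N = ideal_vecs (MI (set us))" using Q by (auto simp: Q_def)
    \<comment> \<open>The variables whose product with the \<open>l\<close>-th generator is a
      multiple of an earlier generator.\<close>
    define V where "V l = {j. \<exists>l''<l. us ! l'' \<preceq> unit_expo j + us ! l}" for l
    define W where "W l = map unit_expo (sorted_list_of_set (V l))" for l
    define ps where "ps = map (Pair (0::nat)) us"
    have set_W: "set (W l) = unit_expo ` V l" for l by (simp add: W_def)
    have W: "(\<exists>w\<in>set (W l). w \<preceq> b) \<longleftrightarrow>
        (\<exists>l'<l. fst (ps ! l') = fst (ps ! l) \<and> snd (ps ! l') \<preceq> b + snd (ps ! l))" if "l < length ps" for l b
    proof
      assume "\<exists>w\<in>set (W l). w \<preceq> b"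
      then obtain j l'' where "unit_expo j \<preceq> b" "l'' < l" "us ! l'' \<preceq> unit_expo j + us ! l"
        unfolding set_W by (auto simp: V_def)
      then have "us ! l'' \<preceq> b + us ! l" by (meson expo_add_mono expo_le_refl expo_le_trans)
      then show "\<exists>l'<l. fst (ps ! l') = fst (ps ! l) \<and> snd (ps ! l') \<preceq> b + snd (ps ! l)"
        using \<open>l'' < l\<close> that by (intro exI[of _ l'']) (auto simp: ps_def)
    next
      assume "\<exists>l'<l. fst (ps ! l') = fst (ps ! l) \<and> snd (ps ! l') \<preceq> b + snd (ps ! l)"
      then obtain l' where l': "l' < l" "snd (ps ! l') \<preceq> b + snd (ps ! l)" by blast
      have l: "l < length us" "l' < length us" using that l'(1) by (auto simp: ps_def)
      with l' have le: "us ! l' \<preceq> b + us ! l" by (simp add: ps_def)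
      obtain j where j: "lookup (us ! l) j < lookup (us ! l') j" "j \<in> V l"
        using lq[OF l(1) l'(1)] by (auto simp: V_def)
      have "lookup (us ! l') j \<le> lookup b j + lookup (us ! l) j"
        using le by (simp add: expo_le_def lookup_add)
      then have "unit_expo j \<preceq> b" using j(1) by (simp add: unit_expo_le_iff)
      then show "\<exists>w\<in>set (W l). w \<preceq> b" using j(2) by (auto simp: set_W)
    qed
    have "lead_frame s N ps" unfolding sN ps_def by (rule lead_frame_monomial_ideal)
    from lead_frame_step[OF this W] obtain \<phi> where \<phi>: "graded_mat s (frame_degrees s ps) \<phi>"
      "mat_image \<phi> = N" "lead_frame (frame_degrees s ps) (mat_kernel \<phi>) (pair_up (length ps) W)"
      by blast
    have t: "set (frame_degrees s ps) \<subseteq> {q}" using deg by (auto simp: frame_degrees_def ps_def sN)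
    then have "frame_degrees s ps ! c = q" if "c < length (frame_degrees s ps)" for c
      using nth_mem[OF that] by blast
    then have "const_free_mat \<phi>"
      using const_free_mat_of_degrees[OF \<phi>(1)] \<open>q > 0\<close> by (simp add: sN)
    then have "C i s (frame_degrees s ps) \<phi>"
      using t True by (simp add: C_def frame_degrees_def ps_def)
    moreover have "inj (unit_expo :: 'n \<Rightarrow> _)"
    proof (rule injI)
      fix i j :: 'n assume "unit_expo i = unit_expo j"
      then have "lookup (unit_expo i) i = lookup (unit_expo j) i" by simp
      then show "i = j" by (simp add: lookup_single when_def split: if_splits)
    qed
    then have "distinct (pair_up (length ps) W)"
      by (intro distinct_pair_up) (auto simp: W_def distinct_map intro: inj_on_subset)
    then have "Q (Suc i) (frame_degrees s ps) (mat_kernel \<phi>)"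
      unfolding Q_def using \<phi>(3) t True
      by (auto simp: set_pair_up set_W intro!: exI[of _ "pair_up (length ps) W"])
    ultimately show ?thesis using \<phi> by blast
  next
    case False
    then have s: "set s \<subseteq> {q + i - 1}" using Q by (simp add: Q_def)
    obtain ps where ps: "lead_frame s N ps" "distinct ps" "\<And>x. x \<in> set ps \<Longrightarrow> \<exists>j. snd x = unit_expo j"
      using Q False by (auto simp: Q_def)
    obtain \<phi> where \<phi>: "graded_mat s (frame_degrees s ps) \<phi>" "mat_image \<phi> = N"
      "lead_frame (frame_degrees s ps) (mat_kernel \<phi>) (pair_up (length ps) (colon_gens ps))"
      using lead_frame_step[OF ps(1) colon_gens_colon] by blast
    have s_nth: "s ! r = q + i - 1" if "r < length s" for r using s nth_mem[OF that] by blast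
    have t: "set (frame_degrees s ps) \<subseteq> {q + i}"
    proof
      fix e assume "e \<in> set (frame_degrees s ps)"
      then obtain x where x: "x \<in> set ps" "e = s ! fst x + expo_deg (snd x)" by (auto simp: frame_degrees_def)
      then have "fst x < length s" using ps(1) by (auto simp: lead_frame_def)
      then show "e \<in> {q + i}" using s_nth ps(3)[OF x(1)] x(2) False by auto
    qed
    then have "frame_degrees s ps ! c = q + i" if "c < length (frame_degrees s ps)" for c
      using nth_mem[OF that] by blast
    then have "const_free_mat \<phi>"
      using const_free_mat_of_degrees[OF \<phi>(1)] s_nth False by simp
    then have "C i s (frame_degrees s ps) \<phi>" using t False by (simp add: C_def)
    \<comment> \<open>Distinct variables are coprime, so the truncated subtraction changes nothing
      and the next leading monomials are variables again.\<close>
    moreover have gens: "snd (ps ! l') - snd (ps ! l) = snd (ps ! l')"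
      if l: "l' < l" "l < length ps" "fst (ps ! l') = fst (ps ! l)" for l l'
    proof -
      obtain j j' where j: "snd (ps ! l) = unit_expo j" "snd (ps ! l') = unit_expo j'"
        using ps(3)[OF nth_mem[of l ps]] ps(3)[OF nth_mem[of l' ps]] l by auto
      have "ps ! l' \<noteq> ps ! l" using l ps(2) by (simp add: nth_eq_iff_index_eq)
      then have "j \<noteq> j'" using j l(3) by (auto simp: prod_eq_iff)
      then show ?thesis
        unfolding j by (intro poly_mapping_eqI) (auto simp: lookup_minus lookup_single when_def)
    qed
    have colon_eq: "colon_gens ps l = map (\<lambda>l'. snd (ps ! l')) (filter (\<lambda>l'. fst (ps ! l') = fst (ps ! l)) [0..<l])"
      if "l < length ps" for l
      unfolding colon_gens_def using gens that by (intro map_cong) auto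
    have "distinct (colon_gens ps l)" if "l < length ps" for l
      unfolding colon_eq[OF that] distinct_map
      using ps(2) that by (auto simp: inj_on_def nth_eq_iff_index_eq[symmetric] prod_eq_iff)
    then have "distinct (pair_up (length ps) (colon_gens ps))" by (rule distinct_pair_up)
    moreover have "\<exists>j. snd x = unit_expo j" if "x \<in> set (pair_up (length ps) (colon_gens ps))" for x
    proof -
      obtain l where l: "l < length ps" "snd x \<in> set (colon_gens ps l)"
        using \<open>x \<in> _\<close> by (auto simp: set_pair_up)
      then obtain l' where "l' < l" "snd x = snd (ps ! l')" by (auto simp: colon_eq)
      then show ?thesis using ps(3)[OF nth_mem[of l' ps]] l(1) by simp
    qed
    ultimately have "Q (Suc i) (frame_degrees s ps) (mat_kernel \<phi>)"
      unfolding Q_def using \<phi>(3) t False by auto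
    then show ?thesis using \<phi> \<open>C i s (frame_degrees s ps) \<phi>\<close> by blast
  qed
  ultimately have "\<exists>s \<phi>. s 0 = [0] \<and> mat_image (\<phi> 0) = ideal_vecs (MI (set us)) \<and>
      (\<forall>i. graded_mat (s i) (s (Suc i)) (\<phi> i) \<and> C i (s i) (s (Suc i)) (\<phi> i) \<and>
        mat_kernel (\<phi> i) = mat_image (\<phi> (Suc i)))"
    by (rule iterate_resolution)
  then obtain s \<phi> where *: "s 0 = [0]" "mat_image (\<phi> 0) = ideal_vecs (MI (set us) :: ('n, 'k) mpoly set)"
    "\<And>i. graded_mat (s i) (s (Suc i)) (\<phi> i)" "\<And>i. C i (s i) (s (Suc i)) (\<phi> i)"
    "\<And>i. mat_kernel (\<phi> i) = mat_image (\<phi> (Suc i))" by blast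
  then have "minimal_graded_resolution UNIV (MI (set us)) s one_vec1 \<phi>"
    using graded_resolution_quotientI[OF is_ideal_MI, of s \<phi> "set us"]
    by (simp add: minimal_graded_resolution_iff C_def)
  then show ?thesis using * by (intro exI[of _ s] exI[of _ \<phi>]) (simp add: C_def)
qed


subsection \<open>Existence of minimal resolutions\<close>

text \<open>A vector is the sum of its finitely many nonzero components; the induction removes one
  occurring degree at a time.\<close>

lemma comp_vecs_in_submod:
  assumes "submod (length s) M" "f \<in> carrier_vec (length s)" "\<And>e. comp_vec s e f \<in> M"
  shows "f \<in> M"
proof -
  define D where "D f = (\<Union>r<length s. (\<lambda>a. expo_deg a + s ! r) ` keys (f $ r))" for f :: "('a, 'b) mpoly vec"
  have "finite (D f)" for f by (simp add: D_def)
  then show ?thesis using assms(2,3)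
  proof (induction "card (D f)" arbitrary: f rule: less_induct)
    case less
    show ?case
    proof (cases "D f = {}")
      case True
      then have "f = 0\<^sub>v (length s)" using less.prems by (intro eq_vecI) (auto simp: D_def)
      then show ?thesis using submodD(2)[OF assms(1)] by simp
    next
      case False
      then obtain e where e: "e \<in> D f" by blast
      define g where "g = f - comp_vec s e f"
      have g: "g \<in> carrier_vec (length s)" using less.prems by (simp add: g_def)
      have g_index: "lookup (g $ r) a = (lookup (f $ r) a when expo_deg a + s ! r \<noteq> e)"
        if "r < length s" for r a
        using that less.prems by (simp add: g_def comp_vec_def lookup_minus lookup_restrict_keys when_def)
      have "D g \<subseteq> D f - {e}"
        by (auto simp: D_def in_keys_iff g_index when_def split: if_splits)
      then have "card (D g) < card (D f)"
        using e less.prems(1)[of f] by (intro psubset_card_mono) auto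
      moreover have "comp_vec s e' g \<in> M" for e'
      proof (cases "e' = e")
        case True
        have "comp_vec s e' g = 0\<^sub>v (length s)"
          using True by (intro eq_vecI poly_mapping_eqI)
            (auto simp: comp_vec_def lookup_restrict_keys g_index when_def)
        then show ?thesis using submodD(2)[OF assms(1)] by simp
      next
        case False
        have "comp_vec s e' g = comp_vec s e' f"
          using False by (intro eq_vecI poly_mapping_eqI)
            (auto simp: comp_vec_def lookup_restrict_keys g_index when_def)
        then show ?thesis using less.prems by simp
      qed
      ultimately have "g \<in> M" using less.hyps less.prems(1) g by blast
      then have "g + comp_vec s e f \<in> M" using less.prems submodD(3)[OF assms(1)] by blast
      moreover have "g + comp_vec s e f = f"
        using less.prems unfolding g_def by (intro eq_vecI) (auto simp: comp_vec_def)
      ultimately show ?thesis by simp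
    qed
  qed
qed

text \<open>
  Hilbert's basis theorem for graded submodules, by division with respect to the lexicographic order
  on exponents; homogeneity makes the division terminate.
\<close>

lemma graded_submod_finitely_generated:
  fixes N :: "('n::{finite,linorder}, 'k::field) mpoly vec set"
  assumes N_gr: "graded_submod s N"
  shows "\<exists>S. finite S \<and> S \<subseteq> N \<and> (\<forall>g\<in>S. \<exists>e. homog_vec s e g) \<and>
    (\<forall>M. submod (length s) M \<and> S \<subseteq> M \<longrightarrow> N \<subseteq> M)"
proof -
  define m where "m = length s"
  have N: "submod m N" using N_gr by (simp add: graded_submod_def m_def)
  \<comment> \<open>\<open>a\<close> is the lexicographically largest exponent in the last nonzero
    entry of \<open>f\<close>, which stands at \<open>c\<close>. Dickson's lemma selects finitely
    many such exponents for each \<open>c\<close>.\<close>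
  define lead where "lead c f a \<longleftrightarrow> f \<in> N \<and> (\<exists>e. homog_vec s e f) \<and> f $ c \<noteq> 0 \<and>
      (\<forall>i. c < i \<and> i < m \<longrightarrow> f $ i = 0) \<and> a = Max (keys (f $ c))" for c f a
  have "\<exists>T. \<forall>c. finite (T c) \<and> T c \<subseteq> {a. \<exists>f. lead c f a} \<and>
      (\<forall>a\<in>{a. \<exists>f. lead c f a}. \<exists>b\<in>T c. b \<preceq> a)"
    by (intro choice allI dickson)
  then obtain T where T0: "\<forall>c. finite (T c) \<and> T c \<subseteq> {a. \<exists>f. lead c f a} \<and>
      (\<forall>a\<in>{a. \<exists>f. lead c f a}. \<exists>b\<in>T c. b \<preceq> a)"
    by (rule exE)
  have T1: "finite (T c)" for c using spec[OF T0, of c] by (rule conjunct1)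
  have T2: "T c \<subseteq> {a. \<exists>f. lead c f a}" for c using spec[OF T0, of c] by (elim conjE)
  have T3: "\<forall>a\<in>{a. \<exists>f. lead c f a}. \<exists>b\<in>T c. b \<preceq> a" for c using spec[OF T0, of c] by (elim conjE)
  have "\<forall>c b. \<exists>f. b \<in> T c \<longrightarrow> lead c f b" using T2 by blast
  then obtain h where h: "\<And>c b. b \<in> T c \<Longrightarrow> lead c (h c b) b" by metis
  define S where "S = (\<Union>c<m. h c ` T c)"
  have "f \<in> M" if M: "submod m M" "S \<subseteq> M" and f: "f \<in> N" for M f
  proof -
    have homog: "f \<in> M" if "i \<le> m" "f \<in> N" "homog_vec s e f" "\<And>r. i \<le> r \<Longrightarrow> r < m \<Longrightarrow> f $ r = 0" for i e f
      using that
    proof (induction i arbitrary: f)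
      case 0
      then have "f = 0\<^sub>v m" using submodD(1)[OF N] by (intro eq_vecI) auto
      then show ?case using submodD(2)[OF M(1)] by simp
    next
      case (Suc c)
      \<comment> \<open>Only finitely many exponents have the degree prescribed for entry
        \<open>c\<close>. The number of those up to the leading one is the measure that division
        decreases.\<close>
      define X where "X k = {x :: 'n expo. expo_deg x + s ! c = e \<and> x \<le> k}" for k
      have X: "finite (X k)" for k
        by (rule finite_subset[OF _ finite_expo_deg[of "e - s ! c"]]) (auto simp: X_def)
      from Suc.prems show ?case
      proof (induction "card (X (Max (keys (f $ c))))" arbitrary: f rule: less_induct)
        case less
        have f: "f \<in> carrier_vec m" using submodD(1)[OF N less.prems(2)] .
        show ?case
        proof (cases "f $ c = 0")
          case True
          show ?thesis
          proof (rule Suc.IH)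
            show "f $ r = 0" if "c \<le> r" "r < m" for r
              using True less.prems(4)[of r] that by (cases "r = c") auto
          qed (use less.prems in auto)
        next
          case False
          define a where "a = Max (keys (f $ c))"
          have "lead c f a"
            unfolding lead_def using False less.prems by (auto simp: a_def)
          then obtain b where b: "b \<in> T c" "b \<preceq> a" using T3 by blast
          define g where "g = h c b"
          have g: "g \<in> N" "g $ c \<noteq> 0" "\<And>i. c < i \<Longrightarrow> i < m \<Longrightarrow> g $ i = 0" "b = Max (keys (g $ c))"
            using h[OF b(1)] by (auto simp: lead_def g_def)
          obtain e' where e': "homog_vec s e' g" using h[OF b(1)] by (auto simp: lead_def g_def)
          have c: "c < m" using less.prems by simp
          have g_car: "g \<in> carrier_vec m" using submodD(1)[OF N g(1)] .
          have a_key: "a \<in> keys (f $ c)" using False by (simp add: a_def)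
          have b_key: "b \<in> keys (g $ c)" using g(2,4) by simp
          have ab: "(a - b) + b = a" using b(2) by (rule expo_diff_add)
          have "expo_deg a + s ! c = e" "expo_deg b + s ! c = e'"
            using a_key b_key less.prems(3) e' c by (auto simp: homog_vec_def m_def)
          then have deg: "expo_deg (a - b) + e' = e"
            using ab expo_deg_add[of "a - b" b] by simp
          \<comment> \<open>Chosen so that \<open>q * g $ c\<close> has the same leading term as
            \<open>f $ c\<close>; by homogeneity the multiple of \<open>g\<close> also has the
            degree of \<open>f\<close>.\<close>
          define \<kappa> where "\<kappa> = lookup (f $ c) a / lookup (g $ c) b"
          define q where "q = Poly_Mapping.single (a - b) \<kappa>"
          have q: "q = Poly_Mapping.single 0 \<kappa> * monomial (a - b)" by (simp add: q_def monomial_def mult_single)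
          have \<kappa>: "\<kappa> \<noteq> 0" using a_key b_key by (auto simp: \<kappa>_def in_keys_iff)
          have q_keys: "keys q = {a - b}" using \<kappa> by (simp add: q_def)
          define f' where "f' = f - q \<cdot>\<^sub>v g"
          have f'_index: "f' $ r = f $ r - q * g $ r" if "r < m" for r
            using that f g_car by (simp add: f'_def)
          have f'_N: "f' \<in> N"
            unfolding f'_def using less.prems(2) g(1) submod_diff[OF N] submodD(4)[OF N] by blast
          have f'_homog: "homog_vec s e f'"
            unfolding homog_vec_def
          proof (intro allI impI ballI)
            fix r x assume r: "r < length s" and x: "x \<in> keys (f' $ r)"
            then have "x \<in> keys (f $ r) \<or> x \<in> keys (q * g $ r)"
              using f'_index[of r] keys_diff[of "f $ r" "q * g $ r"] by (auto simp: m_def)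
            then show "expo_deg x + s ! r = e"
            proof
              assume "x \<in> keys (q * g $ r)"
              then obtain y where "x = (a - b) + y" "y \<in> keys (g $ r)"
                using q_keys by (auto elim!: keys_multE)
              then show ?thesis using e' r deg by (auto simp: homog_vec_def)
            qed (use less.prems(3) r in \<open>auto simp: homog_vec_def\<close>)
          qed
          have f'_zero: "f' $ r = 0" if "Suc c \<le> r" "r < m" for r
            using that less.prems(4)[of r] g(3)[of r] by (simp add: f'_index)
          have "f' \<in> M"
          proof (cases "f' $ c = 0")
            case True
            show ?thesis
            proof (rule Suc.IH)
              show "f' $ r = 0" if "c \<le> r" "r < m" for r
                using True f'_zero[of r] that by (cases "r = c") auto
            qed (use less.prems f'_N f'_homog in auto)
          next
            case False
            have qg: "q * g $ c = (Poly_Mapping.single 0 \<kappa> * g $ c) * monomial (a - b)"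
              unfolding q by (simp only: mult.assoc mult.commute[of "monomial (a - b)"])
            have "lookup (q * g $ c) a = lookup (Poly_Mapping.single 0 \<kappa> * g $ c) b"
              unfolding qg by (metis ab add.commute lookup_mult_monomial)
            also have "\<dots> = \<kappa> * lookup (g $ c) b"
            proof -
              have "Poly_Mapping.single 0 \<kappa> * g $ c = Poly_Mapping.map ((*) \<kappa>) (g $ c)"
                by (simp add: mult_map_scale_conv_mult)
              then show ?thesis by (simp add: map.rep_eq when_def)
            qed
            also have "\<dots> = lookup (f $ c) a" using b_key by (simp add: \<kappa>_def in_keys_iff)
            finally have "a \<notin> keys (f' $ c)" by (simp add: f'_index[OF c] in_keys_iff lookup_minus)
            moreover have "x \<le> a" if "x \<in> keys (f' $ c)" for x
            proof -
              have "x \<in> keys (f $ c) \<or> x \<in> keys (q * g $ c)"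
                using that f'_index[OF c] keys_diff[of "f $ c" "q * g $ c"] by auto
              then show ?thesis
              proof
                assume "x \<in> keys (q * g $ c)"
                then obtain y where y: "x = (a - b) + y" "y \<in> keys (g $ c)"
                  using q_keys by (auto elim!: keys_multE)
                then have "y \<le> b" unfolding g(4) by (intro Max_ge) auto
                then have "(a - b) + y \<le> (a - b) + b" by (rule add_left_mono)
                then show ?thesis using y(1) ab by simp
              qed (simp add: a_def)
            qed
            ultimately have less_a: "Max (keys (f' $ c)) < a"
              using False by (metis Max_in finite_keys keys_eq_empty order_le_less)
            have "a \<in> X a" using \<open>expo_deg a + s ! c = e\<close> by (simp add: X_def)
            moreover have "a \<notin> X (Max (keys (f' $ c)))" using less_a by (auto simp: X_def)
            moreover have "X (Max (keys (f' $ c))) \<subseteq> X a" using less_a by (auto simp: X_def)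
            ultimately have "card (X (Max (keys (f' $ c)))) < card (X a)"
              using X by (intro psubset_card_mono) auto
            then show ?thesis
              using less.hyps[of f'] f'_N f'_homog f'_zero less.prems(1) by (simp add: a_def)
          qed
          moreover have "g \<in> M" using M(2) b(1) c by (auto simp: S_def g_def)
          ultimately have "f' + q \<cdot>\<^sub>v g \<in> M" using submodD[OF M(1)] by blast
          moreover have "f' + q \<cdot>\<^sub>v g = f" using f g_car by (intro eq_vecI) (auto simp: f'_def)
          ultimately show ?thesis by simp
        qed
      qed
    qed
    have "comp_vec s e f \<in> M" for e
      using homog[of m "comp_vec s e f" e] f N_gr by (simp add: graded_submod_def)
    then show ?thesis using comp_vecs_in_submod[of s M f] M(1) submodD(1)[OF N f] by (simp add: m_def)
  qed
  moreover have "finite S" "S \<subseteq> N" "\<forall>g\<in>S. \<exists>e. homog_vec s e g"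
    using T1 h by (auto simp: S_def lead_def)
  ultimately show ?thesis by (intro exI[of _ S]) (auto simp: m_def)
qed

text \<open>Graded Nakayama: in a presentation with the fewest columns, a relation with a nonzero
  constant coefficient would express one column through the others, and that column could be
  deleted.\<close>

lemma exists_minimal_generators:
  fixes N :: "('n::{finite,linorder}, 'k::field) mpoly vec set"
  assumes N_gr: "graded_submod s N"
  shows "\<exists>t \<phi>. graded_mat s t \<phi> \<and> mat_image \<phi> = N \<and>
    (\<forall>v\<in>mat_kernel \<phi>. \<forall>c<length t. lookup (v $ c) 0 = 0)"
proof -
  have N: "submod (length s) N" using N_gr by (simp add: graded_submod_def)
  define gen where "gen t \<phi> \<longleftrightarrow> graded_mat s t \<phi> \<and> mat_image \<phi> = N" for t \<phi>
  have "\<exists>t \<phi>. gen t \<phi>"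
  proof -
    obtain S where S: "finite S" "S \<subseteq> N" "\<forall>g\<in>S. \<exists>e. homog_vec s e g"
      "\<forall>M. submod (length s) M \<and> S \<subseteq> M \<longrightarrow> N \<subseteq> M"
      using graded_submod_finitely_generated[OF N_gr] by blast
    obtain gs where gs: "set gs = S" using S(1) finite_list by blast
    obtain e where e: "\<And>g. g \<in> S \<Longrightarrow> homog_vec s (e g) g" using S(3) by metis
    define \<phi> where "\<phi> = mat_of_cols (length s) gs"
    have \<phi>: "\<phi> \<in> carrier_mat (length s) (length gs)" by (simp add: \<phi>_def)
    have col: "col \<phi> c = gs ! c" "gs ! c \<in> S" if "c < length gs" for c
    proof -
      show "gs ! c \<in> S" using that gs by auto
      then show "col \<phi> c = gs ! c" unfolding \<phi>_def using that S(2) submodD(1)[OF N] by (intro col_mat_of_cols) auto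
    qed
    have "graded_mat s (map e gs) \<phi>" using \<phi> e col by (auto simp: graded_mat_cols_iff)
    moreover have "mat_image \<phi> \<subseteq> N"
      unfolding mat_image_subset_iff[OF N \<phi>] using col S(2) by auto
    moreover have "S \<subseteq> mat_image \<phi>"
      using mat_image_colsD[OF \<phi>] col(1) by (metis gs in_set_conv_nth subsetI)
    then have "N \<subseteq> mat_image \<phi>" using S(4) submod_mat_image[OF \<phi>] by blast
    ultimately show ?thesis unfolding gen_def by blast
  qed
  then obtain t0 \<phi>0 where "gen t0 \<phi>0" by blast
  then obtain x where x: "gen (fst x) (snd x)" "\<forall>y. gen (fst y) (snd y) \<longrightarrow> length (fst x) \<le> length (fst y)"
    using ex_has_least_nat[of "\<lambda>x. gen (fst x) (snd x)" "(t0, \<phi>0)" "\<lambda>x. length (fst x)"] by auto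
  define t \<phi> where "t = fst x" and "\<phi> = snd x"
  have t: "gen t \<phi>" and least: "\<And>t' \<phi>'. gen t' \<phi>' \<Longrightarrow> length t \<le> length t'"
    using x by (auto simp: t_def \<phi>_def)
  have gr: "graded_mat s t \<phi>" and im: "mat_image \<phi> = N" using t by (auto simp: gen_def)
  note \<phi> = graded_mat_carrier[OF gr]
  have "lookup (v $ l) 0 = 0" if v: "v \<in> mat_kernel \<phi>" and l: "l < length t" for v l
  proof (rule ccontr)
    assume \<kappa>: "lookup (v $ l) 0 \<noteq> 0"
    define \<kappa> where "\<kappa> = lookup (v $ l) 0"
    \<comment> \<open>In the component of degree \<open>t ! l\<close> the entry at \<open>l\<close>
      is the constant \<open>\<kappa>\<close> alone, so it can be inverted.\<close>
    define v' where "v' = comp_vec t (t ! l) v"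
    have "v' \<in> mat_kernel \<phi>" using graded_submod_kernel[OF gr] v by (auto simp: graded_submod_def v'_def)
    then have v': "v' \<in> carrier_vec (length t)" "\<phi> *\<^sub>v v' = 0\<^sub>v (length s)" using mat_kernelD[OF \<phi>] by auto
    have v'_l: "v' $ l = Poly_Mapping.single 0 \<kappa>"
      using l by (intro poly_mapping_eqI)
        (auto simp: v'_def comp_vec_def lookup_restrict_keys lookup_single when_def \<kappa>_def expo_deg_eq_0_iff)
    define t' where "t' = take l t @ drop (Suc l) t"
    have t': "length t' = length t - 1" using l by (simp add: t'_def)
    define ix where "ix c = (if c < l then c else Suc c)" for c
    have t'_nth: "t' ! c = t ! ix c" "ix c < length t" if "c < length t'" for c
      using that l by (auto simp: t'_def ix_def nth_append min_def)
    define \<phi>' where "\<phi>' = mat (length s) (length t') (\<lambda>(r, c). \<phi> $$ (r, ix c))"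
    have \<phi>': "\<phi>' \<in> carrier_mat (length s) (length t')" by (simp add: \<phi>'_def)
    have col: "col \<phi>' c = col \<phi> (ix c)" if "c < length t'" for c
      using that t'_nth[OF that] \<phi> by (intro eq_vecI) (auto simp: \<phi>'_def)
    have "graded_mat s t' \<phi>'"
      using gr \<phi>' col t'_nth by (auto simp: graded_mat_cols_iff)
    moreover have sub: "submod (length s) (mat_image \<phi>')" by (rule submod_mat_image[OF \<phi>'])
    have other: "col \<phi> c \<in> mat_image \<phi>'" if "c < length t" "c \<noteq> l" for c
    proof -
      define c' where "c' = (if c < l then c else c - 1)"
      have "c' < length t'" "ix c' = c" using that l t' by (auto simp: c'_def ix_def)
      then show ?thesis using mat_image_colsD[OF \<phi>', of c'] col by simp
    qed
    have "col \<phi> l \<in> mat_image \<phi>'"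
    proof -
      define w where "w = vec (length t) (\<lambda>c. if c = l then 0 else v' $ c)"
      have w: "w \<in> carrier_vec (length t)" by (simp add: w_def)
      have "\<phi> *\<^sub>v w \<in> mat_image \<phi>'"
        by (rule mult_mat_vec_in_submod[OF sub \<phi> w]) (use other in \<open>auto simp: w_def\<close>)
      then have "Poly_Mapping.single 0 (- 1 / \<kappa>) \<cdot>\<^sub>v (\<phi> *\<^sub>v w) \<in> mat_image \<phi>'" by (rule submodD(4)[OF sub])
      moreover have "Poly_Mapping.single 0 (- 1 / \<kappa>) \<cdot>\<^sub>v (\<phi> *\<^sub>v w) = col \<phi> l"
      proof (rule eq_vecI)
        fix r assume "r < dim_vec (col \<phi> l)"
        then have r: "r < length s" using \<phi> by simp
        have "0 = (\<Sum>c<length t. \<phi> $$ (r, c) * v' $ c)"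
          using v'(2) r by (simp flip: mult_mat_vec_index[OF \<phi> v'(1)])
        also have "\<dots> = (\<Sum>c<length t. \<phi> $$ (r, c) * w $ c + (if c = l then \<phi> $$ (r, c) * v' $ c else 0))"
          by (rule sum.cong) (auto simp: w_def)
        also have "\<dots> = (\<phi> *\<^sub>v w) $ r + \<phi> $$ (r, l) * Poly_Mapping.single 0 \<kappa>"
          using l by (simp add: sum.distrib mult_mat_vec_index[OF \<phi> w r] v'_l del: index_mult_mat_vec)
        finally have "(\<phi> *\<^sub>v w) $ r = - (\<phi> $$ (r, l) * Poly_Mapping.single 0 \<kappa>)"
          by (simp add: eq_neg_iff_add_eq_0 del: index_mult_mat_vec)
        then have "Poly_Mapping.single 0 (- 1 / \<kappa>) * (\<phi> *\<^sub>v w) $ r =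
            \<phi> $$ (r, l) * (Poly_Mapping.single 0 (- 1 / \<kappa>) * - Poly_Mapping.single 0 \<kappa>)"
          by (simp only: mult_minus_right mult.left_commute[of "Poly_Mapping.single 0 (- 1 / \<kappa>)" "\<phi> $$ (r, l)"])
        also have "Poly_Mapping.single 0 (- 1 / \<kappa>) * - Poly_Mapping.single 0 \<kappa> = (1 :: ('n, 'k) mpoly)"
          using \<kappa> by (simp add: mult_single \<kappa>_def flip: single_uminus)
        finally show "(Poly_Mapping.single 0 (- 1 / \<kappa>) \<cdot>\<^sub>v (\<phi> *\<^sub>v w)) $ r = col \<phi> l $ r"
          using r l \<phi> by (simp del: index_mult_mat_vec)
      qed (use \<phi> in auto)
      ultimately show ?thesis by simp
    qed
    then have "mat_image \<phi> \<subseteq> mat_image \<phi>'"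
      unfolding mat_image_subset_iff[OF sub \<phi>] using other by blast
    moreover have "mat_image \<phi>' \<subseteq> N"
      unfolding mat_image_subset_iff[OF N \<phi>'] using col t'_nth mat_image_colsD[OF \<phi>] im by auto
    ultimately have "gen t' \<phi>'" unfolding gen_def im by blast
    then show False using least[of t' \<phi>'] t' l by simp
  qed
  then show ?thesis using gr im by blast
qed

lemma homogeneous_ideal_unit:
  assumes J: "homogeneous_ideal J" "p \<in> J" and p: "lookup p 0 \<noteq> 0"
  shows "J = (UNIV :: ('n::finite, 'k::field) mpoly set)"
proof -
  have id: "is_ideal J" using J by (simp add: homogeneous_ideal_def)
  have "restrict_keys (\<lambda>a. expo_deg a = 0) p = Poly_Mapping.single 0 (lookup p 0)"
    by (rule poly_mapping_eqI) (auto simp: lookup_restrict_keys lookup_single when_def expo_deg_eq_0_iff)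
  then have "Poly_Mapping.single 0 (lookup p 0) \<in> J" using J by (metis homogeneous_ideal_def)
  then have "Poly_Mapping.single 0 (inverse (lookup p 0)) * Poly_Mapping.single 0 (lookup p 0) \<in> J"
    using is_idealD(3)[OF id] by blast
  then have "1 \<in> J" using p by (simp add: mult_single)
  then have "q * 1 \<in> J" for q using is_idealD(3)[OF id] by blast
  then show ?thesis by auto
qed

text \<open>The invariant says that all vectors of the module to be presented have zero constant
  terms. It holds at the start because the ideal is proper, passes to syzygies of minimal
  generators, and makes each matrix free of constants, as its columns lie in that module.\<close>

lemma minimal_resolution_exists:
  fixes J :: "('n::{finite,linorder}, 'k::field) mpoly set"
  assumes J: "homogeneous_ideal J" and "J \<noteq> UNIV"
  shows "\<exists>s \<phi>. minimal_graded_resolution UNIV J s one_vec1 \<phi> \<and> s 0 = [0]"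
proof -
  have id: "is_ideal J" using J by (simp add: homogeneous_ideal_def)
  define Q where "Q i s N \<longleftrightarrow> (i = 0 \<longrightarrow> s = [0] \<and> N = ideal_vecs J) \<and> graded_submod s N \<and>
      (\<forall>v\<in>N. \<forall>c<length s. lookup (v $ c) 0 = 0)" for i :: nat and s and N :: "('n, 'k) mpoly vec set"
  have "Q 0 [0] (ideal_vecs J)"
    unfolding Q_def using graded_submod_ideal_vecs[OF J] homogeneous_ideal_unit[OF J] \<open>J \<noteq> UNIV\<close>
    by (auto simp: ideal_vecs_def)
  moreover have "\<exists>t \<phi>. graded_mat s t \<phi> \<and> mat_image \<phi> = N \<and> const_free_mat \<phi> \<and> Q (Suc i) t (mat_kernel \<phi>)"
    if Q: "Q i s N" for i s N
  proof -
    have "graded_submod s N" using Q by (simp add: Q_def)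
    from exists_minimal_generators[OF this] obtain t \<phi> where \<phi>: "graded_mat s t \<phi>" "mat_image \<phi> = N"
      "\<forall>v\<in>mat_kernel \<phi>. \<forall>c<length t. lookup (v $ c) 0 = 0" by blast
    note c = graded_mat_carrier[OF \<phi>(1)]
    have "const_free_mat \<phi>"
      unfolding const_free_mat_def
    proof (intro allI impI)
      fix r l assume rl: "r < dim_row \<phi>" "l < dim_col \<phi>"
      then have "col \<phi> l \<in> N" using mat_image_colsD[OF c, of l] \<phi>(2) c by simp
      then have "lookup (col \<phi> l $ r) 0 = 0" using Q rl c by (auto simp: Q_def)
      then show "lookup (\<phi> $$ (r, l)) 0 = 0" using rl by simp
    qed
    then show ?thesis using \<phi> graded_submod_kernel[OF \<phi>(1)] by (auto simp: Q_def)
  qed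
  ultimately have "\<exists>s \<phi>. s 0 = [0] \<and> mat_image (\<phi> 0) = ideal_vecs J \<and>
      (\<forall>i. graded_mat (s i) (s (Suc i)) (\<phi> i) \<and> const_free_mat (\<phi> i) \<and>
        mat_kernel (\<phi> i) = mat_image (\<phi> (Suc i)))"
    by (rule iterate_resolution[where C = "\<lambda>_ _ _ \<phi>. const_free_mat \<phi>"])
  then show ?thesis using graded_resolution_quotientI[OF id] by (metis minimal_graded_resolution_iff)
qed


section \<open>Betti degrees\<close>

definition betti_degrees ::
    "('n::finite, 'k::field) mpoly set \<Rightarrow> ('n, 'k) mpoly set \<Rightarrow> nat \<Rightarrow> nat set" where
  "betti_degrees A B i = {j. graded_betti A B i j \<noteq> 0}"

text \<open>Any minimal resolution may replace the one picked by \<open>SOME\<close>, as the degree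
  sets of the two contain each other.\<close>

lemma betti_degrees_eq:
  assumes F: "minimal_graded_resolution A B s \<epsilon> \<phi>" and B: "homogeneous_ideal B"
  shows "betti_degrees A B i = set (s i)"
proof -
  define s' where "s' = (SOME s. \<exists>\<epsilon> \<phi>. minimal_graded_resolution A B s \<epsilon> \<phi>)"
  have "\<exists>\<epsilon> \<phi>. minimal_graded_resolution A B s' \<epsilon> \<phi>"
    unfolding s'_def using F by (intro someI[of "\<lambda>s. \<exists>\<epsilon> \<phi>. minimal_graded_resolution A B s \<epsilon> \<phi>"]) blast
  then obtain \<epsilon>' \<phi>' where F': "minimal_graded_resolution A B s' \<epsilon>' \<phi>'" by blast
  have "set (s' i) = set (s i)"
    using resolution_degrees_subset[OF F _ B] resolution_degrees_subset[OF F' _ B] F F'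
    unfolding minimal_graded_resolution_iff by blast
  moreover have "betti_degrees A B i = set (s' i)"
    by (simp add: betti_degrees_def graded_betti_def s'_def[symmetric] count_list_0_iff)
  ultimately show ?thesis by simp
qed

lemma betti_degrees_subset:
  assumes F: "minimal_graded_resolution A B s \<epsilon> \<phi>" and G: "graded_resolution A B t \<eta> \<psi>"
    and B: "homogeneous_ideal B"
  shows "betti_degrees A B i \<subseteq> set (t i)"
  using betti_degrees_eq[OF F B] resolution_degrees_subset[OF F G B] by simp

lemma reg_quot_eq: "reg_quot J = Max (\<Union>i. (\<lambda>j. int j - int i) ` betti_degrees UNIV J i)"
  unfolding reg_quot_def betti_degrees_def by (rule arg_cong[of _ _ Max]) auto

lemma graded_resolution_first_map:
  assumes F: "graded_resolution UNIV J s one_vec1 \<phi>" and s: "s 0 = [0]"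
  shows "graded_mat [0] (s 1) (\<phi> 0)" "mat_image (\<phi> 0) = ideal_vecs J"
proof -
  show "graded_mat [0] (s 1) (\<phi> 0)" using graded_resolution_mat(1)[OF F, of 0] s by simp
  have "{f \<in> carrier_vec (length (s 0)). one_vec1 \<bullet> f \<in> J} = ideal_vecs J"
    using s by (auto simp: ideal_vecs_def scalar_prod_one_vec1)
  then show "mat_image (\<phi> 0) = ideal_vecs J" using F by (simp add: graded_resolution_def)
qed

lemma keys_image_first_map:
  assumes gr: "graded_mat [0] t \<phi>" and im: "mat_image \<phi> = ideal_vecs J" and p: "p \<in> J" and a: "a \<in> keys p"
  shows "\<exists>c<length t. \<exists>b. \<phi> $$ (0, c) \<in> J \<and> b \<in> keys (\<phi> $$ (0, c)) \<and> b \<preceq> a \<and> expo_deg b = t ! c"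
proof -
  note c = graded_mat_carrier[OF gr]
  have "vec 1 (\<lambda>_. p) \<in> mat_image \<phi>" unfolding im ideal_vecs_def using p by simp
  then obtain g where g: "g \<in> carrier_vec (length t)" "vec 1 (\<lambda>_. p) = \<phi> *\<^sub>v g"
    using c by (auto simp: mat_image_def)
  have "p = (\<phi> *\<^sub>v g) $ 0" by (simp flip: g(2))
  also have "\<dots> = (\<Sum>c<length t. \<phi> $$ (0, c) * g $ c)"
    by (rule mult_mat_vec_index) (use c g in auto)
  finally obtain l where l: "l < length t" "a \<in> keys (\<phi> $$ (0, l) * g $ l)"
    using a keys_sum[of "\<lambda>c. \<phi> $$ (0, c) * g $ c" "{..<length t}"] by auto
  obtain b b' where b: "a = b + b'" "b \<in> keys (\<phi> $$ (0, l))" using l(2) by (auto elim!: keys_multE)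
  have "col \<phi> l \<in> ideal_vecs J" using mat_image_colsD[OF c l(1)] im by simp
  then have "\<phi> $$ (0, l) \<in> J" using c l(1) by (simp add: ideal_vecs_def)
  moreover have "expo_deg b = t ! l" using gr b(2) l(1) by (auto simp: graded_mat_def)
  moreover have "b \<preceq> a" using b(1) by simp
  ultimately show ?thesis using l(1) b(2) by blast
qed

text \<open>The monomial \<open>a\<close> is divisible by a term \<open>b\<close> of an entry of the
  first matrix. This entry lies in the monomial ideal, hence so does \<open>b\<close>, and
  minimality of \<open>a\<close> leaves only \<open>b = a\<close>.\<close>

lemma first_betti_degree:
  fixes A :: "'n::{finite,linorder} expo set"
  assumes a: "\<exists>u\<in>A. u \<preceq> a" "\<And>b. \<exists>u\<in>A. u \<preceq> b \<Longrightarrow> b \<preceq> a \<Longrightarrow> b = a"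
    and "(MI A :: ('n, 'k::field) mpoly set) \<noteq> UNIV"
  shows "expo_deg a \<in> betti_degrees UNIV (MI A :: ('n, 'k) mpoly set) 1"
proof -
  define J where "J = (MI A :: ('n, 'k) mpoly set)"
  have J: "homogeneous_ideal J" by (simp add: J_def homogeneous_ideal_MI)
  obtain s \<phi> where F: "minimal_graded_resolution UNIV J s one_vec1 \<phi>" "s 0 = [0]"
    using minimal_resolution_exists[OF J] assms(3) by (auto simp: J_def)
  have F': "graded_resolution UNIV J s one_vec1 \<phi>" using F by (simp add: minimal_graded_resolution_iff)
  note gr = graded_resolution_first_map(1)[OF F' F(2)] and im = graded_resolution_first_map(2)[OF F' F(2)]
  obtain c b where cb: "c < length (s 1)" "\<phi> 0 $$ (0, c) \<in> J" "b \<in> keys (\<phi> 0 $$ (0, c))" "b \<preceq> a"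
    "expo_deg b = s 1 ! c"
    using keys_image_first_map[OF gr im, of "monomial a" a] a(1) by (auto simp: J_def)
  have "\<exists>u\<in>A. u \<preceq> b" using cb(2,3) by (simp add: J_def MI_def)
  then have "b = a" using a(2) cb(4) by blast
  then show ?thesis using cb betti_degrees_eq[OF F(1) J, of 1] by (auto simp: J_def)
qed

text \<open>Linearity is stated for the ideal as a module, regularity for the quotient. Dropping the
  module in position 0 from a minimal resolution of the quotient gives one of the ideal, with the
  row of the first matrix as augmentation.\<close>

lemma linear_resolution_generator_degree:
  fixes J :: "('n::{finite,linorder}, 'k::field) mpoly set"
  assumes J: "homogeneous_ideal J" "J \<noteq> UNIV" and lin: "has_linear_resolution J"
  shows "\<exists>q. betti_degrees UNIV J 1 \<subseteq> {q} \<and> (\<forall>p\<in>J. \<forall>a\<in>keys p. expo_deg a \<ge> q)"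
proof -
  obtain s \<phi> where F: "minimal_graded_resolution UNIV J s one_vec1 \<phi>" "s 0 = [0]"
    using minimal_resolution_exists[OF J] by blast
  have F': "graded_resolution UNIV J s one_vec1 \<phi>" and cf: "\<And>i. const_free_mat (\<phi> i)"
    using F by (auto simp: minimal_graded_resolution_iff)
  note gr = graded_resolution_first_map(1)[OF F' F(2)] and im = graded_resolution_first_map(2)[OF F' F(2)]
  note c = graded_mat_carrier[OF gr]
  define \<epsilon> where "\<epsilon> = row (\<phi> 0) 0"
  have \<epsilon>: "\<epsilon> \<in> carrier_vec (length (s 1))" using carrier_matD[OF c] by (intro carrier_vecI) (simp add: \<epsilon>_def)
  have \<epsilon>f: "(\<phi> 0 *\<^sub>v f) $ 0 = \<epsilon> \<bullet> f" "\<phi> 0 *\<^sub>v f \<in> carrier_vec (Suc 0)" for f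
    using carrier_matD[OF c] by (auto simp: \<epsilon>_def intro: carrier_vecI)
  have "graded_resolution J {0} (\<lambda>i. s (Suc i)) \<epsilon> (\<lambda>i. \<phi> (Suc i))"
    unfolding graded_resolution_def
  proof (intro conjI allI impI)
    fix l assume l: "l < length (s (Suc 0))"
    have "col (\<phi> 0) l \<in> ideal_vecs J" using mat_image_colsD[OF c] l im by simp
    then show "\<epsilon> $ l \<in> J" using c l by (simp add: ideal_vecs_def \<epsilon>_def)
    show "homogeneous (s (Suc 0) ! l) (\<epsilon> $ l)"
      using gr c l by (auto simp: graded_mat_def homogeneous_def \<epsilon>_def)
  next
    show "J = {\<epsilon> \<bullet> f + b |f b. f \<in> carrier_vec (length (s (Suc 0))) \<and> b \<in> {0}}"
    proof (intro equalityI subsetI)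
      fix p assume "p \<in> J"
      then have "vec 1 (\<lambda>_. p) \<in> mat_image (\<phi> 0)" unfolding im ideal_vecs_def by simp
      then obtain g where g: "g \<in> carrier_vec (length (s 1))" "vec 1 (\<lambda>_. p) = \<phi> 0 *\<^sub>v g"
        using c by (auto simp: mat_image_def)
      have "p = \<epsilon> \<bullet> g" unfolding \<epsilon>f(1)[symmetric] g(2)[symmetric] by simp
      then show "p \<in> {\<epsilon> \<bullet> f + b |f b. f \<in> carrier_vec (length (s (Suc 0))) \<and> b \<in> {0}}" using g(1) by auto
    next
      fix p assume "p \<in> {\<epsilon> \<bullet> f + b |f b. f \<in> carrier_vec (length (s (Suc 0))) \<and> b \<in> {0}}"
      then obtain f where f: "f \<in> carrier_vec (length (s 1))" "p = \<epsilon> \<bullet> f" by auto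
      then have "\<phi> 0 *\<^sub>v f \<in> ideal_vecs J" using im c by (auto simp: mat_image_def)
      then show "p \<in> J" using f \<epsilon>f by (simp add: ideal_vecs_def)
    qed
    have "{f \<in> carrier_vec (length (s (Suc 0))). \<epsilon> \<bullet> f \<in> {0}} = mat_kernel (\<phi> 0)"
    proof -
      have "\<epsilon> \<bullet> f = 0 \<longleftrightarrow> \<phi> 0 *\<^sub>v f = 0\<^sub>v (length [0::nat])" for f
      proof
        assume "\<epsilon> \<bullet> f = 0"
        then show "\<phi> 0 *\<^sub>v f = 0\<^sub>v (length [0::nat])" using \<epsilon>f[of f] c by (intro eq_vecI) auto
      qed (simp flip: \<epsilon>f(1))
      then show ?thesis by (auto simp: mat_kernel[OF c])
    qed
    then show "{f \<in> carrier_vec (length (s (Suc 0))). \<epsilon> \<bullet> f \<in> {0}} = mat_image (\<phi> (Suc 0))"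
      using F' by (simp add: graded_resolution_def)
  qed (use F' \<epsilon> in \<open>auto simp: graded_resolution_def\<close>)
  then have "minimal_graded_resolution J {0} (\<lambda>i. s (Suc i)) \<epsilon> (\<lambda>i. \<phi> (Suc i))"
    using cf by (simp add: minimal_graded_resolution_iff)
  moreover have "homogeneous_ideal ({0} :: ('n, 'k) mpoly set)"
    by (auto simp: homogeneous_ideal_def intro: is_idealI)
  ultimately have eq: "betti_degrees J {0} 0 = set (s 1)" by (simp add: betti_degrees_eq)
  obtain q where "\<And>i j. graded_betti J {0} i j \<noteq> 0 \<Longrightarrow> j = i + q"
    using lin by (auto simp: has_linear_resolution_def)
  then have sq: "set (s 1) \<subseteq> {q}" unfolding eq[symmetric] by (fastforce simp: betti_degrees_def)
  have "expo_deg a \<ge> q" if "p \<in> J" "a \<in> keys p" for p a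
    using keys_image_first_map[OF gr im that] sq expo_deg_mono by (metis nth_mem singletonD subsetD)
  then show ?thesis using sq betti_degrees_eq[OF F(1) J(1), of 1] by blast
qed

text \<open>Dickson's lemma leaves finitely many generators, and their Taylor resolution has finite
  length; its degrees contain those of a minimal resolution. \<open>Max\<close> in
  \<open>reg_quot\<close> depends on this.\<close>

lemma finite_betti_differences:
  fixes A :: "'n::{finite,linorder} expo set"
  assumes "(MI A :: ('n, 'k::field) mpoly set) \<noteq> UNIV"
  shows "finite (\<Union>i. (\<lambda>j. int j - int i) ` betti_degrees UNIV (MI A :: ('n, 'k) mpoly set) i)"
proof -
  obtain T where T: "finite T" "T \<subseteq> A" "\<forall>a\<in>A. \<exists>b\<in>T. b \<preceq> a" using dickson[of A] by (elim exE conjE)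
  have "(MI A :: ('n, 'k) mpoly set) = MI T"
    by (rule MI_cong) (use T expo_le_trans in blast)
  moreover obtain s \<phi> where F: "minimal_graded_resolution UNIV (MI A :: ('n, 'k) mpoly set) s one_vec1 \<phi>"
    using minimal_resolution_exists[OF homogeneous_ideal_MI assms] by blast
  ultimately obtain t \<psi> K where G: "graded_resolution UNIV (MI A :: ('n, 'k) mpoly set) t one_vec1 \<psi>"
    "\<And>i. i \<ge> K \<Longrightarrow> t (Suc i) = []"
    using finite_resolution_MI[OF T(1)] by metis
  have sub: "betti_degrees UNIV (MI A :: ('n, 'k) mpoly set) i \<subseteq> set (t i)" for i
    by (rule betti_degrees_subset[OF F G(1) homogeneous_ideal_MI])
  have "set (t i) = {}" if "i \<notin> {..K}" for i using G(2)[of "i - 1"] that by (cases i) auto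
  then have "(\<lambda>j. int j - int i) ` betti_degrees UNIV (MI A :: ('n, 'k) mpoly set) i \<subseteq>
      (\<Union>i\<in>{..K}. (\<lambda>j. int j - int i) ` set (t i))" for i
    using sub[of i] by (cases "i \<in> {..K}") auto
  then have "(\<Union>i. (\<lambda>j. int j - int i) ` betti_degrees UNIV (MI A :: ('n, 'k) mpoly set) i) \<subseteq>
      (\<Union>i\<in>{..K}. (\<lambda>j. int j - int i) ` set (t i))" by (rule UN_least)
  then show ?thesis by (rule finite_subset) simp
qed


section \<open>Bases of matroids\<close>

text \<open>The exponent of \<open>x\<close> in the product of the square-free monomials with
  supports \<open>U 0\<close>, ..., \<open>U (k - 1)\<close>.\<close>

definition cnt :: "nat \<Rightarrow> (nat \<Rightarrow> 'n set) \<Rightarrow> 'n \<Rightarrow> nat" where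
  "cnt k U x = (\<Sum>l<k. of_bool (x \<in> U l))"

lemma cnt_le: "cnt k U x \<le> k"
proof -
  have "cnt k U x \<le> (\<Sum>l<k. 1)" unfolding cnt_def by (rule sum_mono) simp
  then show ?thesis by simp
qed

lemma cnt_Suc: "cnt (Suc k) U x = cnt k U x + of_bool (x \<in> U k)"
  by (simp add: cnt_def)

lemma cnt_update:
  assumes "l < k"
  shows "cnt k (U(l := X)) x + of_bool (x \<in> U l) = cnt k U x + of_bool (x \<in> X)"
proof -
  have split: "cnt k W x = of_bool (x \<in> W l) + (\<Sum>l\<in>{..<k} - {l}. of_bool (x \<in> W l))" for W
    unfolding cnt_def using assms by (intro sum.remove) auto
  have "(\<Sum>l'\<in>{..<k} - {l}. of_bool (x \<in> (U(l := X)) l')) = (\<Sum>l'\<in>{..<k} - {l}. of_bool (x \<in> U l') :: nat)"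
    by (rule sum.cong) auto
  then show ?thesis unfolding split[of U] split[of "U(l := X)"] by simp
qed

lemma sum_cnt:
  fixes Z :: "'n::finite set"
  shows "(\<Sum>x\<in>Z. cnt k U x) = (\<Sum>l<k. card (U l \<inter> Z))"
proof -
  have "(\<Sum>x\<in>Z. cnt k U x) = (\<Sum>l<k. \<Sum>x\<in>Z. of_bool (x \<in> U l))"
    unfolding cnt_def by (rule sum.swap)
  also have "\<dots> = (\<Sum>l<k. card (U l \<inter> Z))"
    by (simp add: sum.If_cases of_bool_def Int_commute)
  finally show ?thesis .
qed

text \<open>A monomial of weight at least \<open>k\<close> on \<open>C\<close> is divisible by a
  product of \<open>k\<close> variables from \<open>C\<close>. They are picked greedily: while fewer
  than \<open>k\<close> are chosen, some multiplicity is not exhausted.\<close>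

lemma select_with_multiplicity:
  fixes C :: "'n::finite set" and a :: "'n \<Rightarrow> nat"
  assumes "k \<le> (\<Sum>x\<in>C. a x)"
  shows "\<exists>i. (\<forall>l<k. i l \<in> C) \<and> (\<forall>x. cnt k (\<lambda>l. {i l}) x \<le> a x)"
  using assms
proof (induction k)
  case 0
  show ?case by (simp add: cnt_def)
next
  case (Suc k)
  then obtain i where i: "\<forall>l<k. i l \<in> C" "\<And>x. cnt k (\<lambda>l. {i l}) x \<le> a x" by auto
  have "(\<Sum>x\<in>C. cnt k (\<lambda>l. {i l}) x) = k"
    using i(1) by (simp add: sum_cnt)
  then have "(\<Sum>x\<in>C. cnt k (\<lambda>l. {i l}) x) < (\<Sum>x\<in>C. a x)" using Suc.prems by simp
  then obtain y where y: "y \<in> C" "cnt k (\<lambda>l. {i l}) y < a y"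
    by (meson not_less sum_mono)
  have eq: "cnt (Suc k) (\<lambda>l. {(i(k := y)) l}) x = cnt k (\<lambda>l. {i l}) x + of_bool (x = y)" for x
  proof -
    have "cnt k (\<lambda>l. {(i(k := y)) l}) x = cnt k (\<lambda>l. {i l}) x"
      unfolding cnt_def by (rule sum.cong) auto
    then show ?thesis by (simp add: cnt_Suc)
  qed
  show ?case
  proof (intro exI[of _ "i(k := y)"] conjI allI impI)
    show "(i(k := y)) l \<in> C" if "l < Suc k" for l using that i(1) y(1) by (auto simp: less_Suc_eq)
    show "cnt (Suc k) (\<lambda>l. {(i(k := y)) l}) x \<le> a x" for x
      unfolding eq using i(2)[of x] y(2) by (cases "x = y") auto
  qed
qed

locale basis_system =
  fixes \<B> :: "'n::finite set set" and d :: nat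
  assumes nonempty: "\<B> \<noteq> {}"
    and card_basis: "X \<in> \<B> \<Longrightarrow> card X = d"
    and exchange: "X \<in> \<B> \<Longrightarrow> Y \<in> \<B> \<Longrightarrow> i \<in> X - Y \<Longrightarrow> \<exists>j\<in>Y - X. insert j (X - {i}) \<in> \<B>"
begin

text \<open>Elements of \<open>W\<close> outside \<open>A \<union> U\<close> are exchanged one by
  one for elements of \<open>U\<close>. This stands in for the augmentation of independent
  sets.\<close>

lemma extend_within:
  assumes "A \<subseteq> W" "W \<in> \<B>" "U \<in> \<B>"
  shows "\<exists>W'\<in>\<B>. A \<subseteq> W' \<and> W' \<subseteq> A \<union> U"
  using assms(1,2)
proof (induction "card (W - (A \<union> U))" arbitrary: W rule: less_induct)
  case less
  show ?case
  proof (cases "W \<subseteq> A \<union> U")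
    case True
    with less.prems show ?thesis by blast
  next
    case False
    then obtain w where w: "w \<in> W" "w \<notin> A" "w \<notin> U" by blast
    then obtain y where y: "y \<in> U - W" "insert y (W - {w}) \<in> \<B>"
      using exchange[OF less.prems(2) assms(3), of w] by blast
    have "insert y (W - {w}) - (A \<union> U) = (W - (A \<union> U)) - {w}" using y by blast
    then have "insert y (W - {w}) - (A \<union> U) \<subset> W - (A \<union> U)" using w by auto
    then have "card (insert y (W - {w}) - (A \<union> U)) < card (W - (A \<union> U))"
      by (intro psubset_card_mono) auto
    moreover have "A \<subseteq> insert y (W - {w})" using w less.prems by blast
    ultimately show ?thesis using less.hyps y(2) by blast
  qed
qed

lemma basis_within_insert:
  assumes "W \<in> \<B>" "U \<in> \<B>" "i \<in> W" "i \<notin> U" "W \<subseteq> insert i U"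
  shows "\<exists>j\<in>U. W = insert i (U - {j})"
proof -
  have "card (insert i U - W) = Suc d - d"
    using assms card_basis by (subst card_Diff_subset) auto
  then obtain j where j: "insert i U - W = {j}" by (auto simp: card_Suc_eq)
  then have "j \<in> U" "W = insert i (U - {j})" using assms by auto
  then show ?thesis by blast
qed

text \<open>Here the inserted element is prescribed. Extending
  \<open>insert i (U \<inter> V)\<close>, a subset of \<open>V\<close>, within \<open>U\<close>
  keeps the intersection, so the element that \<open>U\<close> loses lies outside
  \<open>V\<close>.\<close>

lemma dual_exchange:
  assumes "U \<in> \<B>" "V \<in> \<B>" "i \<in> V - U"
  shows "\<exists>j\<in>U - V. insert i (U - {j}) \<in> \<B>"
proof -
  obtain W where W: "W \<in> \<B>" "insert i (U \<inter> V) \<subseteq> W" "W \<subseteq> insert i (U \<inter> V) \<union> U"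
    using extend_within[of "insert i (U \<inter> V)" V U] assms by blast
  then have "W \<subseteq> insert i U" by blast
  then obtain j where j: "j \<in> U" "W = insert i (U - {j})"
    using basis_within_insert[OF W(1) assms(1)] W(2) assms(3) by blast
  then have "j \<notin> V" using W(2) assms(3) by blast
  then show ?thesis using j W(1) by blast
qed

text \<open>A rank argument: if \<open>V\<close> met \<open>Z\<close> in more elements, some
  \<open>z\<close> in \<open>Z\<close> outside \<open>U\<close> could be added to
  \<open>U \<inter> Z\<close> inside a basis. Completing this within \<open>U\<close> removes an
  element of \<open>U\<close> outside \<open>Z\<close>, against closedness.\<close>

lemma closed_card_le:
  assumes U: "U \<in> \<B>" and V: "V \<in> \<B>"
    and closed: "\<And>z j. z \<in> Z \<Longrightarrow> z \<notin> U \<Longrightarrow> j \<in> U \<Longrightarrow> insert z (U - {j}) \<in> \<B> \<Longrightarrow> j \<in> Z"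
  shows "card (V \<inter> Z) \<le> card (U \<inter> Z)"
proof (rule ccontr)
  assume neg: "\<not> ?thesis"
  obtain W where W: "W \<in> \<B>" "U \<inter> Z \<subseteq> W" "W \<subseteq> (U \<inter> Z) \<union> V"
    using extend_within[OF Int_lower1 U V] by blast
  have "\<exists>z\<in>(V \<inter> Z) - U. z \<in> W"
  proof (rule ccontr)
    assume "\<not> ?thesis"
    then have "W \<subseteq> (U \<inter> Z) \<union> (V - Z)" using W(3) by blast
    then have "card W \<le> card ((U \<inter> Z) \<union> (V - Z))" by (intro card_mono) auto
    also have "\<dots> \<le> card (U \<inter> Z) + card (V - Z)" by (rule card_Un_le)
    also have "\<dots> < card (V \<inter> Z) + card (V - Z)" using neg by simp
    also have "\<dots> = card V" by (metis Int_Diff_disjoint Int_Diff_Un card_Un_disjoint finite)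
    finally show False using card_basis W(1) V by simp
  qed
  then obtain z where z: "z \<in> V \<inter> Z" "z \<notin> U" "z \<in> W" by blast
  obtain W' where W': "W' \<in> \<B>" "insert z (U \<inter> Z) \<subseteq> W'" "W' \<subseteq> insert z (U \<inter> Z) \<union> U"
    using extend_within[of "insert z (U \<inter> Z)" W U] W z U by blast
  then have "W' \<subseteq> insert z U" by blast
  then obtain j where j: "j \<in> U" "W' = insert z (U - {j})"
    using basis_within_insert[OF W'(1) U] W'(2) z by blast
  then have "j \<in> Z" using closed[of z j] z W'(1) by blast
  then show False using W'(2) j z(2) by blast
qed

text \<open>Exchanging \<open>j\<close> out of \<open>insert a (U - {b})\<close> can bring in only
  \<open>i\<close> or \<open>b\<close>, and \<open>b\<close> would give the basis excluded by
  assumption. Two arcs of a path using the same summand are compatible for this reason.\<close>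

lemma double_exchange:
  assumes "insert i (U - {j}) \<in> \<B>" "insert a (U - {b}) \<in> \<B>" "insert a (U - {j}) \<notin> \<B>"
    and "a \<notin> U" "i \<notin> U" "a \<noteq> i" "b \<in> U" "j \<in> U" "b \<noteq> j"
  shows "insert a (insert i (U - {j}) - {b}) \<in> \<B>"
proof -
  obtain y where y: "y \<in> insert i (U - {j}) - insert a (U - {b})"
    "insert y (insert a (U - {b}) - {j}) \<in> \<B>"
    using exchange[OF assms(2,1), of j] assms by blast
  then have "y = i \<or> y = b" by blast
  then show ?thesis
  proof
    assume "y = i"
    moreover have "insert i (insert a (U - {b}) - {j}) = insert a (insert i (U - {j}) - {b})"
      using assms by auto
    ultimately show ?thesis using y by simp
  next
    assume "y = b"
    moreover have "insert b (insert a (U - {b}) - {j}) = insert a (U - {j})" using assms by auto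
    ultimately show ?thesis using y assms(3) by simp
  qed
qed


subsection \<open>Sums of bases\<close>

text \<open>The exchange graph of matroid partition: some summand can give up \<open>y\<close> for
  \<open>x\<close>.\<close>

definition arc :: "nat \<Rightarrow> (nat \<Rightarrow> 'n set) \<Rightarrow> 'n \<Rightarrow> 'n \<Rightarrow> bool" where
  "arc k U x y \<longleftrightarrow> (\<exists>l<k. y \<in> U l \<and> x \<notin> U l \<and> insert x (U l - {y}) \<in> \<B>)"

text \<open>
  Performing the exchanges along a chordless path from its end preserves the remaining arcs and
  creates no chords.
\<close>

lemma exchange_along_path:
  assumes "\<forall>l<k. U l \<in> \<B>" and "inj_on p {..m}"
    and "\<forall>a<m. arc k U (p a) (p (Suc a))"
    and "\<forall>b\<le>m. \<forall>a. Suc a < b \<longrightarrow> \<not> arc k U (p a) (p b)"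
  shows "\<exists>U'. (\<forall>l<k. U' l \<in> \<B>) \<and>
    (\<forall>x. cnt k U' x + of_bool (x = p m) = cnt k U x + of_bool (x = p 0))"
  using assms
proof (induction m arbitrary: U)
  case 0
  then show ?case by blast
next
  case (Suc m)
  have distinct: "p a \<noteq> p b" if "a \<le> Suc m" "b \<le> Suc m" "a \<noteq> b" for a b
    using Suc.prems(2) that by (auto simp: inj_on_def)
  obtain l where l: "l < k" "p (Suc m) \<in> U l" "p m \<notin> U l" "insert (p m) (U l - {p (Suc m)}) \<in> \<B>"
    using Suc.prems(3) by (auto simp: arc_def)
  define X where "X = insert (p m) (U l - {p (Suc m)})"
  define U2 where "U2 = U(l := X)"
  have no_last: "insert (p a) (U l - {p (Suc m)}) \<notin> \<B>" if "a < m" "p a \<notin> U l" for a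
    using Suc.prems(4) that l(1,2) by (auto simp: arc_def)
  have "\<forall>l<k. U2 l \<in> \<B>" using Suc.prems(1) l(4) by (simp add: U2_def X_def)
  moreover have "inj_on p {..m}" using Suc.prems(2) by (rule inj_on_subset) auto
  moreover have "arc k U2 (p a) (p (Suc a))" if a: "a < m" for a
  proof -
    obtain l' where l': "l' < k" "p (Suc a) \<in> U l'" "p a \<notin> U l'" "insert (p a) (U l' - {p (Suc a)}) \<in> \<B>"
      using Suc.prems(3)[rule_format, of a] a by (auto simp: arc_def)
    show ?thesis
    proof (cases "l' = l")
      case False
      then show ?thesis using l' by (auto simp: arc_def U2_def)
    next
      case True
      have "insert (p a) (X - {p (Suc a)}) \<in> \<B>"
        unfolding X_def using l l' True a no_last[OF a] distinct
        by (intro double_exchange) auto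
      moreover have "p (Suc a) \<in> X" "p a \<notin> X"
        using l' True a distinct[of "Suc a" "Suc m"] distinct[of a m] by (auto simp: X_def)
      ultimately show ?thesis unfolding arc_def using l(1) by (intro exI[of _ l]) (simp add: U2_def)
    qed
  qed
  moreover have "\<not> arc k U2 (p a) (p b)" if ab: "b \<le> m" "Suc a < b" for a b
  proof
    assume "arc k U2 (p a) (p b)"
    then obtain l' where l': "l' < k" "p b \<in> U2 l'" "p a \<notin> U2 l'" "insert (p a) (U2 l' - {p b}) \<in> \<B>"
      by (auto simp: arc_def)
    have no_arc: "\<not> arc k U (p a) (p b)" using Suc.prems(4) ab by simp
    then have "l' = l" using l' by (cases "l' = l") (auto simp: arc_def U2_def)
    then have X: "p b \<in> X" "p a \<notin> X" "insert (p a) (X - {p b}) \<in> \<B>" using l' by (auto simp: U2_def)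
    have pa: "p a \<notin> U l" using X(2) distinct[of a "Suc m"] ab by (auto simp: X_def)
    show False
    proof (cases "b = m")
      case True
      have "insert (p a) (X - {p b}) = insert (p a) (U l - {p (Suc m)})"
        using True l(3) by (auto simp: X_def)
      then show False using X(3) no_last[of a] pa ab by simp
    next
      case False
      then have pb: "p b \<in> U l" "p b \<noteq> p (Suc m)"
        using X(1) distinct[of b m] distinct[of b "Suc m"] ab by (auto simp: X_def)
      \<comment> \<open>Dual exchange leads from the new basis back to the old one; either possible
        \<open>j\<close> is the end of a chord of the original path.\<close>
      obtain j where j: "j \<in> U l - insert (p a) (X - {p b})" "insert (p a) (U l - {j}) \<in> \<B>"
        using dual_exchange[OF _ X(3), of "U l" "p a"] Suc.prems(1) l(1) pa by blast
      then have "j = p (Suc m) \<or> j = p b" by (auto simp: X_def)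
      then show False
        using j(2) no_last[of a] pa ab no_arc pb(1) l(1) by (auto simp: arc_def)
    qed
  qed
  ultimately obtain U' where U': "\<forall>l<k. U' l \<in> \<B>"
    "\<And>x. cnt k U' x + of_bool (x = p m) = cnt k U2 x + of_bool (x = p 0)"
    using Suc.IH[of U2] by blast
  have "cnt k U' x + of_bool (x = p (Suc m)) = cnt k U x + of_bool (x = p 0)" for x
    using U'(2)[of x] cnt_update[OF l(1), of U X x] l(2,3) distinct[of m "Suc m"]
    by (cases "x = p m"; cases "x = p (Suc m)"; cases "x \<in> U l") (auto simp: U2_def X_def)
  then show ?case using U'(1) by blast
qed

text \<open>Let \<open>Z\<close> be reachable from \<open>i\<close> in the exchange graph. Without a
  surplus of \<open>U\<close> somewhere in \<open>Z\<close>, the deficit at \<open>i\<close> makes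
  the total count of \<open>U\<close> on \<open>Z\<close> smaller than that of \<open>V\<close>; but
  \<open>Z\<close> is closed under exchange in every summand, so \<open>closed_card_le\<close> gives
  the opposite inequality.\<close>

lemma sum_exchange:
  assumes U: "\<forall>l<k. U l \<in> \<B>" and V: "\<forall>l<k. V l \<in> \<B>" and i: "cnt k U i < cnt k V i"
  shows "\<exists>j U'. cnt k V j < cnt k U j \<and> (\<forall>l<k. U' l \<in> \<B>) \<and>
    (\<forall>x. cnt k U' x + of_bool (x = j) = cnt k U x + of_bool (x = i))"
proof -
  define R where "R = {(x, y). arc k U x y}"
  define Z where "Z = {y. (i, y) \<in> R\<^sup>*}"
  have "\<exists>j\<in>Z. cnt k V j < cnt k U j"
  proof (rule ccontr)
    assume "\<not> ?thesis"
    then have le: "cnt k U j \<le> cnt k V j" if "j \<in> Z" for j using that by (meson not_less)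
    have "(\<Sum>x\<in>Z. cnt k U x) < (\<Sum>x\<in>Z. cnt k V x)"
      using le i by (intro sum_strict_mono_ex1) (auto simp: Z_def)
    moreover have "card (V l \<inter> Z) \<le> card (U l \<inter> Z)" if l: "l < k" for l
    proof (rule closed_card_le)
      fix z j assume z: "z \<in> Z" "z \<notin> U l" "j \<in> U l" "insert z (U l - {j}) \<in> \<B>"
      then have "(z, j) \<in> R" using l by (auto simp: R_def arc_def)
      then show "j \<in> Z" using z(1) by (auto simp: Z_def intro: rtrancl_into_rtrancl)
    qed (use U V l in auto)
    ultimately show False unfolding sum_cnt by (meson leD lessThan_iff sum_mono)
  qed
  then obtain j where j: "(i, j) \<in> R\<^sup>*" "cnt k V j < cnt k U j" by (auto simp: Z_def)
  \<comment> \<open>A path of least length has neither repetitions nor chords, as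
    \<open>exchange_along_path\<close> demands.\<close>
  define m where "m = (LEAST n. (i, j) \<in> R ^^ n)"
  have m: "(i, j) \<in> R ^^ m"
    unfolding m_def using rtrancl_imp_relpow[OF j(1)] by (metis LeastI)
  have m_least: "m \<le> n" if "(i, j) \<in> R ^^ n" for n unfolding m_def using that by (rule Least_le)
  obtain p where p: "p 0 = i" "p m = j" "\<And>a. a < m \<Longrightarrow> (p a, p (Suc a)) \<in> R"
    using m by (auto simp: relpow_fun_conv)
  have seg: "(p a, p b) \<in> R ^^ (b - a)" if "a \<le> b" "b \<le> m" for a b
    unfolding relpow_fun_conv by (rule exI[of _ "\<lambda>n. p (a + n)"]) (use that p(3) in auto)
  have "\<exists>U'. (\<forall>l<k. U' l \<in> \<B>) \<and>
      (\<forall>x. cnt k U' x + of_bool (x = p m) = cnt k U x + of_bool (x = p 0))"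
  proof (rule exchange_along_path[OF U])
    have "p a \<noteq> p b" if "a < b" "b \<le> m" for a b
    proof
      assume eq: "p a = p b"
      have "(i, p a) \<in> R ^^ a" "(p b, j) \<in> R ^^ (m - b)" using seg[of 0 a] seg[of b m] that p by auto
      then have "(i, j) \<in> R ^^ (a + (m - b))" unfolding relpow_add using eq by auto
      then show False using m_least that by fastforce
    qed
    then show "inj_on p {..m}" by (auto simp: inj_on_def) (metis linorder_neq_iff)
    show "\<forall>a<m. arc k U (p a) (p (Suc a))" using p(3) by (auto simp: R_def)
    have "(p a, p b) \<notin> R" if "Suc a < b" "b \<le> m" for a b
    proof
      assume R: "(p a, p b) \<in> R"
      have "(i, p a) \<in> R ^^ a" "(p b, j) \<in> R ^^ (m - b)" using seg[of 0 a] seg[of b m] that p by auto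
      then have "(i, j) \<in> R ^^ (Suc a + (m - b))" unfolding relpow_add using R by auto
      then show False using m_least that by fastforce
    qed
    then show "\<forall>b\<le>m. \<forall>a. Suc a < b \<longrightarrow> \<not> arc k U (p a) (p b)" by (auto simp: R_def)
  qed
  then show ?thesis using j(2) p(1,2) by blast
qed


subsection \<open>Covers\<close>

definition cover :: "'n set \<Rightarrow> bool" where
  "cover C \<longleftrightarrow> (\<forall>X\<in>\<B>. X \<inter> C \<noteq> {})"

definition min_cover :: "'n set \<Rightarrow> bool" where
  "min_cover C \<longleftrightarrow> cover C \<and> (\<forall>C'. C' \<subset> C \<longrightarrow> \<not> cover C')"

definition cocircuit :: "'n set \<Rightarrow> 'n \<Rightarrow> 'n set" where
  "cocircuit X i = {j. insert j (X - {i}) \<in> \<B>}"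

lemma min_cover_basis:
  assumes "min_cover C" "i \<in> C"
  shows "\<exists>X\<in>\<B>. X \<inter> C = {i}"
proof -
  have "\<not> cover (C - {i})" using assms by (auto simp: min_cover_def)
  then obtain X where "X \<in> \<B>" "X \<inter> (C - {i}) = {}" by (auto simp: cover_def)
  moreover have "X \<inter> C \<noteq> {}" using assms(1) \<open>X \<in> \<B>\<close> by (auto simp: min_cover_def cover_def)
  ultimately show ?thesis by (intro bexI[of _ X]) auto
qed

lemma cocircuit_inter_basis:
  assumes "X \<in> \<B>" "i \<in> X"
  shows "cocircuit X i \<inter> X = {i}"
proof -
  have "insert i (X - {i}) = X" using assms(2) by blast
  moreover have "j = i" if "j \<in> X" "insert j (X - {i}) \<in> \<B>" for j
  proof (rule ccontr)
    assume "j \<noteq> i"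
    then have "insert j (X - {i}) = X - {i}" using that(1) by blast
    then show False using card_basis[OF that(2)] card_basis[OF assms(1)] card_Diff1_less[of X i] assms(2) by simp
  qed
  ultimately show ?thesis using assms by (auto simp: cocircuit_def)
qed

text \<open>The exchange property makes the set a cover. If \<open>j\<close> is omitted, the basis
  \<open>insert j (X - {i})\<close> is missed, because the cocircuit meets \<open>X\<close> only in
  \<open>i\<close>.\<close>

lemma min_cover_cocircuit:
  assumes X: "X \<in> \<B>" "i \<in> X"
  shows "min_cover (cocircuit X i)"
proof -
  have "Y \<inter> cocircuit X i \<noteq> {}" if Y: "Y \<in> \<B>" for Y
  proof (cases "i \<in> Y")
    case True
    then show ?thesis using cocircuit_inter_basis[OF X] by blast
  next
    case False
    then show ?thesis using exchange[OF X(1) Y, of i] X(2) by (auto simp: cocircuit_def)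
  qed
  moreover have "\<not> cover C'" if C': "C' \<subset> cocircuit X i" for C'
  proof -
    obtain j where j: "j \<in> cocircuit X i" "j \<notin> C'" using C' by blast
    then have "insert j (X - {i}) \<in> \<B>" by (simp add: cocircuit_def)
    moreover have "insert j (X - {i}) \<inter> C' = {}"
      using C' j(2) cocircuit_inter_basis[OF X] by blast
    ultimately show ?thesis unfolding cover_def by blast
  qed
  ultimately show ?thesis by (auto simp: min_cover_def cover_def)
qed

lemma cover_le_sum_cnt:
  assumes "\<forall>l<k. U l \<in> \<B>" "cover C"
  shows "k \<le> (\<Sum>x\<in>C. cnt k U x)"
proof -
  have "(\<Sum>l<k. 1) \<le> (\<Sum>l<k. card (U l \<inter> C))"
  proof (rule sum_mono)
    fix l assume "l \<in> {..<k}"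
    then have "U l \<inter> C \<noteq> {}" using assms by (auto simp: cover_def)
    then show "1 \<le> card (U l \<inter> C)" by (simp add: Suc_le_eq card_gt_0_iff)
  qed
  then show ?thesis by (simp add: sum_cnt)
qed

lemma sum_cnt_UNIV:
  assumes "\<forall>l<k. U l \<in> \<B>"
  shows "(\<Sum>x\<in>UNIV. cnt k U x) = d * k"
  using assms card_basis by (simp add: sum_cnt mult.commute)

text \<open>If all circuits have at most two elements, the matroid is a direct sum of matroids of rank one.\<close>

lemma unique_exchange_transversal:
  assumes unique: "\<And>X e b b'. X \<in> \<B> \<Longrightarrow> e \<notin> X \<Longrightarrow> b \<in> X \<Longrightarrow> b' \<in> X \<Longrightarrow>
      insert e (X - {b}) \<in> \<B> \<Longrightarrow> insert e (X - {b'}) \<in> \<B> \<Longrightarrow> b = b'"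
    and X: "X \<in> \<B>" and f: "\<And>b. b \<in> X \<Longrightarrow> f b \<in> cocircuit X b"
  shows "f ` X \<in> \<B>"
proof -
  have disjoint: "b = b'" if b: "b \<in> X" "b' \<in> X" "x \<in> cocircuit X b" "x \<in> cocircuit X b'" for b b' x
  proof (cases "x \<in> X")
    case True
    then have "x \<in> cocircuit X b \<inter> X" "x \<in> cocircuit X b' \<inter> X" using b by blast+
    then show ?thesis using cocircuit_inter_basis[OF X] b by simp
  next
    case False
    then show ?thesis using unique[OF X False b(1,2)] b by (simp add: cocircuit_def)
  qed
  have self: "b \<in> cocircuit X b" if "b \<in> X" for b using cocircuit_inter_basis[OF X that] by blast
  have "f ` Y \<union> (X - Y) \<in> \<B>" if "Y \<subseteq> X" for Y
    using finite[of Y] that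
  proof (induction Y)
    case empty
    then show ?case using X by simp
  next
    case (insert b Y)
    define W where "W = f ` Y \<union> (X - Y)"
    have W: "W \<in> \<B>" using insert by (simp add: W_def)
    have b: "b \<in> X" "b \<notin> Y" "b \<in> W" using insert by (auto simp: W_def)
    show ?case
    proof (cases "f b = b")
      case True
      then have "f ` insert b Y \<union> (X - insert b Y) = W" using b by (auto simp: W_def)
      then show ?thesis using W by simp
    next
      case False
      define V where "V = insert (f b) (X - {b})"
      have V: "V \<in> \<B>" using f[OF b(1)] by (simp add: V_def cocircuit_def)
      then obtain y where y: "y \<in> V - W" "insert y (W - {b}) \<in> \<B>"
        using exchange[OF W V, of b] b False by (auto simp: V_def)
      \<comment> \<open>Otherwise \<open>y\<close> is an element of \<open>X\<close> already
        replaced by \<open>f y\<close>, and a basis contains both. Completing the pair within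
        \<open>X\<close> gives \<open>insert (f y) (X - {j})\<close>; disjointness of the
        fundamental cocircuits forces \<open>j = y\<close>, so \<open>y\<close> is missing after
        all.\<close>
      have "y = f b"
      proof (rule ccontr)
        assume "y \<noteq> f b"
        then have y': "y \<in> X" "y \<in> Y" "y \<noteq> b" using y(1) by (auto simp: V_def W_def)
        then have fy: "f y \<in> W" by (auto simp: W_def)
        have "y \<notin> W" using y(1) by blast
        with fy have fy_neq: "f y \<noteq> y" by metis
        have "f y \<notin> X"
          using cocircuit_inter_basis[OF X y'(1)] f[OF y'(1)] fy_neq by blast
        then have "f y \<noteq> b" using b by blast
        then have sub: "{y, f y} \<subseteq> insert y (W - {b})" using fy by blast
        obtain W' where W': "W' \<in> \<B>" "{y, f y} \<subseteq> W'" "W' \<subseteq> {y, f y} \<union> X"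
          using extend_within[OF sub y(2) X] by blast
        then have "W' \<subseteq> insert (f y) X" using y'(1) by blast
        then obtain j where j: "j \<in> X" "W' = insert (f y) (X - {j})"
          using basis_within_insert[OF W'(1) X _ \<open>f y \<notin> X\<close>] W'(2) by blast
        then have "f y \<in> cocircuit X j" using W'(1) by (simp add: cocircuit_def)
        then have "j = y" by (rule disjoint[OF j(1) y'(1) _ f[OF y'(1)]])
        then have "y \<notin> W'" using j(2) fy_neq by simp
        then show False using W'(2) by blast
      qed
      moreover have "f ` insert b Y \<union> (X - insert b Y) = insert (f b) (W - {b})"
      proof -
        have "b \<notin> f ` Y"
        proof
          assume "b \<in> f ` Y"
          then obtain y where "y \<in> Y" "b = f y" by blast
          then have "y = b" using disjoint[of y b b] f self insert.prems b(1) by auto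
          then show False using \<open>y \<in> Y\<close> b(2) by blast
        qed
        then show ?thesis by (auto simp: W_def)
      qed
      ultimately show ?thesis using y(2) by simp
    qed
  qed
  from this[of X] show ?thesis by simp
qed

text \<open>For a fixed basis, \<open>k\<close> elements are selected from each fundamental
  cocircuit; the \<open>l\<close>-th selections together form the \<open>l\<close>-th basis.
  Disjointness of the cocircuits keeps the multiplicities from adding up.\<close>

lemma unique_exchange_sum:
  assumes unique: "\<And>X e b b'. X \<in> \<B> \<Longrightarrow> e \<notin> X \<Longrightarrow> b \<in> X \<Longrightarrow> b' \<in> X \<Longrightarrow>
      insert e (X - {b}) \<in> \<B> \<Longrightarrow> insert e (X - {b'}) \<in> \<B> \<Longrightarrow> b = b'"
    and a: "\<And>C. min_cover C \<Longrightarrow> k \<le> (\<Sum>x\<in>C. a x)"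
  shows "\<exists>U. (\<forall>l<k. U l \<in> \<B>) \<and> (\<forall>x. cnt k U x \<le> a x)"
proof -
  obtain X where X: "X \<in> \<B>" using nonempty by blast
  have "\<exists>i. (\<forall>l<k. i l \<in> cocircuit X b) \<and> (\<forall>x. cnt k (\<lambda>l. {i l}) x \<le> a x)" if "b \<in> X" for b
    by (rule select_with_multiplicity) (rule a[OF min_cover_cocircuit[OF X that]])
  then obtain i where i: "\<And>b l. b \<in> X \<Longrightarrow> l < k \<Longrightarrow> i b l \<in> cocircuit X b"
    "\<And>b x. b \<in> X \<Longrightarrow> cnt k (\<lambda>l. {i b l}) x \<le> a x" by metis
  define U where "U l = (\<lambda>b. i b l) ` X" for l
  have "U l \<in> \<B>" if "l < k" for l
    unfolding U_def by (rule unique_exchange_transversal[OF _ X]) (use unique i(1) that in blast)+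
  moreover have "cnt k U x \<le> a x" for x
  proof (cases "\<exists>b\<in>X. x \<in> cocircuit X b")
    case True
    then obtain b where b: "b \<in> X" "x \<in> cocircuit X b" by blast
    have "b' = b" if "b' \<in> X" "x \<in> cocircuit X b'" for b'
    proof (cases "x \<in> X")
      case True
      then have "x \<in> cocircuit X b \<inter> X" "x \<in> cocircuit X b' \<inter> X" using b that by blast+
      then show ?thesis using cocircuit_inter_basis[OF X] b that by simp
    next
      case False
      then show ?thesis using unique[OF X False that(1) b(1)] that b by (simp add: cocircuit_def)
    qed
    then have "cnt k U x \<le> cnt k (\<lambda>l. {i b l}) x"
      unfolding cnt_def using i(1) by (intro sum_mono) (auto simp: U_def)
    then show ?thesis using i(2)[OF b(1), of x] by simp
  next
    case False
    then have "cnt k U x = 0" unfolding cnt_def using i(1) by (auto simp: U_def)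
    then show ?thesis by simp
  qed
  ultimately show ?thesis by blast
qed

end


section \<open>Primes generated by variables\<close>

definition variable_ideal :: "'n set \<Rightarrow> ('n::finite, 'k::field) mpoly set" where
  "variable_ideal C = MI (unit_expo ` C)"

lemma variable_ideal_iff:
  fixes C :: "'n::finite set"
  shows "p \<in> variable_ideal C \<longleftrightarrow> (\<forall>a\<in>keys p. (\<Sum>x\<in>C. lookup a x) \<noteq> 0)"
  by (simp add: variable_ideal_def MI_def unit_expo_le_iff)

lemma unit_in_variable_ideal_iff [simp]:
  "(monomial (unit_expo i) :: ('n::finite, 'k::field) mpoly) \<in> variable_ideal C \<longleftrightarrow> i \<in> C"
  by (auto simp: variable_ideal_iff lookup_single when_def)

lemma is_ideal_variable_ideal: "is_ideal (variable_ideal C)"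
  by (simp add: variable_ideal_def is_ideal_MI)

lemma min_weight_notin_variable_ideal:
  fixes p :: "('n::finite, 'k::field) mpoly"
  assumes "p \<notin> variable_ideal C"
  shows "p \<noteq> 0" "Min ((\<lambda>a. \<Sum>x\<in>C. lookup a x) ` keys p) = 0"
proof -
  obtain a where a: "a \<in> keys p" "(\<Sum>x\<in>C. lookup a x) = 0" using assms by (auto simp: variable_ideal_iff)
  then show "p \<noteq> 0" by auto
  have "Min ((\<lambda>a. \<Sum>x\<in>C. lookup a x) ` keys p) \<le> (\<Sum>x\<in>C. lookup a x)"
    using a(1) by (intro Min_le) auto
  then show "Min ((\<lambda>a. \<Sum>x\<in>C. lookup a x) ` keys p) = 0" using a(2) by simp
qed

text \<open>Polynomials outside the ideal are those with least weight 0 on \<open>C\<close>, and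
  least weights add under multiplication.\<close>

lemma is_prime_variable_ideal:
  "is_prime_ideal (variable_ideal C :: ('n::{finite,linorder}, 'k::field) mpoly set)"
  unfolding is_prime_ideal_def
proof (intro conjI allI impI)
  have "(1 :: ('n, 'k) mpoly) \<notin> variable_ideal C" by (simp add: variable_ideal_iff)
  then show "(variable_ideal C :: ('n, 'k) mpoly set) \<noteq> UNIV" by blast
  fix p q :: "('n, 'k) mpoly" assume pq: "p * q \<in> variable_ideal C"
  show "p \<in> variable_ideal C \<or> q \<in> variable_ideal C"
  proof (rule ccontr)
    assume "\<not> ?thesis"
    then have p: "p \<notin> variable_ideal C" and q: "q \<notin> variable_ideal C" by auto
    have "\<exists>c\<in>keys (p * q). (\<Sum>x\<in>C. lookup c x) = 0 + 0"
      using keys_mult_weight_min[of "\<lambda>a. \<Sum>x\<in>C. lookup a x" p q]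
        min_weight_notin_variable_ideal[OF p] min_weight_notin_variable_ideal[OF q]
      by (simp add: lookup_add sum.distrib)
    then show False using pq by (auto simp: variable_ideal_iff)
  qed
qed (rule is_ideal_variable_ideal)

lemma prime_ideal_variable:
  fixes P :: "('n::{finite,linorder}, 'k::field) mpoly set"
  assumes P: "is_prime_ideal P" and "monomial a \<in> P"
  shows "\<exists>i. lookup a i > 0 \<and> monomial (unit_expo i) \<in> P"
  using assms(2)
proof (induction "expo_deg a" arbitrary: a rule: less_induct)
  case less
  have id: "is_ideal P" using P by (simp add: is_prime_ideal_def)
  show ?case
  proof (cases "a = 0")
    case True
    then have "1 \<in> P" using less.prems by simp
    then have "q * 1 \<in> P" for q using is_idealD(3)[OF id] by blast
    then show ?thesis using P by (auto simp: is_prime_ideal_def)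
  next
    case False
    then obtain i where i: "lookup a i > 0" by (metis gr0I lookup_zero poly_mapping_eqI)
    define b where "b = a - unit_expo i"
    have a: "a = unit_expo i + b"
      unfolding b_def using i by (simp add: expo_add_diff unit_expo_le_iff)
    then have "(monomial (unit_expo i) * monomial b :: ('n, 'k) mpoly) \<in> P" using less.prems by simp
    then have "monomial (unit_expo i) \<in> P \<or> monomial b \<in> P"
      using P unfolding is_prime_ideal_def by blast
    then consider "monomial (unit_expo i) \<in> P" | "monomial b \<in> P" by blast
    then show ?thesis
    proof cases
      case 1
      then show ?thesis using i by blast
    next
      case 2
      moreover have "expo_deg b < expo_deg a" using expo_deg_unit[of i] by (simp add: a)
      ultimately obtain j where "lookup b j > 0" "monomial (unit_expo j) \<in> P"
        using less.hyps by blast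
      then show ?thesis by (intro exI[of _ j]) (simp add: a lookup_add)
    qed
  qed
qed

section \<open>Colon ideals by monomials and the v-number\<close>

lemma ideal_colon_MI_monomial:
  assumes "\<And>b. \<exists>v\<in>A. v \<preceq> b + u \<Longrightarrow> \<exists>j\<in>V. lookup b j > 0"
    and "\<And>j. j \<in> V \<Longrightarrow> \<exists>v\<in>A. v \<preceq> unit_expo j + u"
  shows "ideal_colon (MI A) (monomial u) = (variable_ideal V :: ('n::finite, 'k::field) mpoly set)"
proof -
  have "(\<exists>v\<in>A. v \<preceq> b + u) \<longleftrightarrow> (\<exists>j\<in>V. unit_expo j \<preceq> b)" for b
  proof
    assume "\<exists>j\<in>V. unit_expo j \<preceq> b"
    then obtain j where j: "j \<in> V" "unit_expo j + u \<preceq> b + u"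
      using expo_add_mono expo_le_refl by blast
    then show "\<exists>v\<in>A. v \<preceq> b + u" using assms(2) expo_le_trans by blast
  qed (use assms(1) in \<open>auto simp: unit_expo_le_iff\<close>)
  then show ?thesis
    unfolding ideal_colon_def mult_monomial_in_MI_iff by (auto simp: variable_ideal_def MI_def)
qed

lemma v_number_le_monomial:
  assumes "ideal_colon J (monomial u) = (variable_ideal V :: ('n::{finite,linorder}, 'k::field) mpoly set)"
  shows "v_number J \<le> expo_deg u"
  unfolding v_number_def
proof (rule Least_le, intro exI conjI bexI)
  show "homogeneous (expo_deg u) (monomial u :: ('n, 'k) mpoly)" by (simp add: homogeneous_def)
  show "ideal_colon J (monomial u) \<in> Ass J"
    using assms is_prime_variable_ideal[of V] by (auto simp: Ass_def)
qed simp

text \<open>A variable \<open>x_i\<close> in the prime \<open>J : f\<close> puts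
  \<open>f x_i\<close> into \<open>J\<close>, so its degree, one more than that of \<open>f\<close>,
  is at least \<open>q\<close>. The hypothesis \<open>ex\<close> ensures that the
  \<open>LEAST\<close> in \<open>v_number\<close> is attained.\<close>

lemma v_number_ge:
  fixes A :: "'n::{finite,linorder} expo set"
  assumes "A \<noteq> {}" and deg: "\<And>u. u \<in> A \<Longrightarrow> expo_deg u \<ge> q"
    and ex: "ideal_colon (MI A) (monomial u) = (variable_ideal V :: ('n, 'k::field) mpoly set)"
  shows "v_number (MI A :: ('n, 'k) mpoly set) + 1 \<ge> q"
proof -
  define J where "J = (MI A :: ('n, 'k) mpoly set)"
  define Q where "Q e \<longleftrightarrow> (\<exists>f. homogeneous e f \<and> (\<exists>P\<in>Ass J. ideal_colon J f = P))" for e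
  have "Q (expo_deg u)"
    using ex is_prime_variable_ideal[of V] unfolding Q_def
    by (intro exI[of _ "monomial u"]) (auto simp: homogeneous_def Ass_def J_def)
  then have "Q (v_number J)" unfolding v_number_def Q_def by (rule LeastI)
  then obtain f where f: "homogeneous (v_number J) f" "is_prime_ideal (ideal_colon J f)"
    by (auto simp: Q_def Ass_def)
  have J: "is_ideal J" by (simp add: J_def is_ideal_MI)
  obtain w where "w \<in> A" using assms(1) by blast
  then have "monomial w \<in> J" unfolding J_def by (rule monomial_in_MI)
  then have "monomial w \<in> ideal_colon J f"
    using is_idealD(3)[OF J, of "monomial w" f] by (simp add: ideal_colon_def mult.commute)
  then obtain i where i: "f * monomial (unit_expo i) \<in> J"
    using prime_ideal_variable[OF f(2)] by (auto simp: ideal_colon_def mult.commute)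
  have "f \<noteq> 0"
  proof
    assume "f = 0"
    then have "ideal_colon J f = UNIV" using is_idealD(1)[OF J] by (simp add: ideal_colon_def)
    then show False using f(2) by (simp add: is_prime_ideal_def)
  qed
  then obtain a where a: "a \<in> keys f" by (metis all_not_in_conv keys_eq_empty)
  then obtain v where v: "v \<in> A" "v \<preceq> a + unit_expo i"
    using i by (auto simp: J_def mult_monomial_in_MI_iff)
  have "q \<le> expo_deg v" by (rule deg[OF v(1)])
  also have "\<dots> \<le> expo_deg (a + unit_expo i)" by (rule expo_deg_mono[OF v(2)])
  also have "\<dots> = v_number J + 1" using f(1) a expo_deg_unit[of i] by (simp add: homogeneous_def)
  finally show ?thesis by (simp add: J_def)
qed

text \<open>Clearing denominators replaces the localization by a multiplier outside
  \<open>P\<close>.\<close>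

lemma in_symbolic_component_iff:
  assumes "is_prime_ideal P"
  shows "Fract r 1 \<in> extend_local J P \<longleftrightarrow> (\<exists>s. s \<notin> P \<and> r * s \<in> J)"
proof -
  have nz: "s \<noteq> 0" if "s \<notin> P" for s
    using that assms by (auto simp: is_prime_ideal_def is_idealD(1))
  have eq: "Fract r 1 = Fract a s \<longleftrightarrow> r * s = a" if "s \<notin> P" for a s
    using nz[OF that] by (simp add: eq_fract)
  show ?thesis
  proof
    assume "Fract r 1 \<in> extend_local J P"
    then obtain a s where "Fract r 1 = Fract a s" "a \<in> J" "s \<notin> P" by (auto simp: extend_local_def)
    then show "\<exists>s. s \<notin> P \<and> r * s \<in> J" using eq by metis
  next
    assume "\<exists>s. s \<notin> P \<and> r * s \<in> J"
    then obtain s where s: "s \<notin> P" "r * s \<in> J" by blast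
    then have "Fract r 1 = Fract (r * s) s" using eq by simp
    then show "Fract r 1 \<in> extend_local J P" unfolding extend_local_def using s by blast
  qed
qed


section \<open>Powers and symbolic powers of matroidal ideals\<close>

definition expo_of :: "('n::finite \<Rightarrow> nat) \<Rightarrow> 'n expo" where
  "expo_of f = Abs_poly_mapping f"

lemma lookup_expo_of [simp]: "lookup (expo_of f) = f"
  by (simp add: expo_of_def lookup_Abs_poly_mapping)

lemma cnt_cong: "(\<And>l. l < k \<Longrightarrow> U l = V l) \<Longrightarrow> cnt k U = cnt k V"
  by (simp add: cnt_def fun_eq_iff)

context basis_system
begin

definition sum_expos :: "nat \<Rightarrow> 'n expo set" where
  "sum_expos k = {expo_of (cnt k U) |U. \<forall>l<k. U l \<in> \<B>}"

definition cover_expos :: "nat \<Rightarrow> 'n expo set" where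
  "cover_expos k = {a. \<forall>C. min_cover C \<longrightarrow> k \<le> (\<Sum>x\<in>C. lookup a x)}"

lemma expo_deg_sum_expos: "u \<in> sum_expos k \<Longrightarrow> expo_deg u = d * k"
  by (auto simp: sum_expos_def expo_deg_def sum_cnt_UNIV)

lemma finite_sum_expos: "finite (sum_expos k)"
  by (rule finite_subset[OF _ finite_expo_deg[of "d * k"]]) (auto simp: expo_deg_sum_expos)

lemma sum_expos_nonempty: "sum_expos k \<noteq> {}"
  using nonempty by (auto simp: sum_expos_def)

lemma sum_expos_add: "{a + b |a b. a \<in> sum_expos 1 \<and> b \<in> sum_expos k} = sum_expos (Suc k)"
proof (intro equalityI subsetI)
  fix c assume "c \<in> {a + b |a b. a \<in> sum_expos 1 \<and> b \<in> sum_expos k}"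
  then obtain U V where c: "c = expo_of (cnt 1 U) + expo_of (cnt k V)" "U 0 \<in> \<B>" "\<forall>l<k. V l \<in> \<B>"
    by (auto simp: sum_expos_def)
  have "cnt k (V(k := U 0)) = cnt k V" by (rule cnt_cong) simp
  then have "c = expo_of (cnt (Suc k) (V(k := U 0)))"
    unfolding c(1) by (intro poly_mapping_eqI) (simp add: lookup_add cnt_Suc, simp add: cnt_def)
  then show "c \<in> sum_expos (Suc k)" unfolding sum_expos_def using c by auto
next
  fix c assume "c \<in> sum_expos (Suc k)"
  then obtain U where U: "c = expo_of (cnt (Suc k) U)" "\<forall>l<Suc k. U l \<in> \<B>" by (auto simp: sum_expos_def)
  have "c = expo_of (cnt 1 (\<lambda>_. U k)) + expo_of (cnt k U)"
    unfolding U(1) by (intro poly_mapping_eqI) (simp add: lookup_add cnt_Suc, simp add: cnt_def)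
  moreover have "expo_of (cnt 1 (\<lambda>_. U k)) \<in> sum_expos 1" "expo_of (cnt k U) \<in> sum_expos k"
    using U(2) by (auto simp: sum_expos_def)
  ultimately show "c \<in> {a + b |a b. a \<in> sum_expos 1 \<and> b \<in> sum_expos k}" by blast
qed

lemma ideal_power_eq: "ideal_power (MI (sum_expos 1)) k = (MI (sum_expos k) :: ('n, 'k::field) mpoly set)"
proof (induction k)
  case 0
  have "0 \<in> sum_expos 0" using nonempty
    by (auto simp: sum_expos_def cnt_def intro!: poly_mapping_eqI exI[of _ "\<lambda>_. SOME X. X \<in> \<B>"])
  then have "(MI (sum_expos 0) :: ('n, 'k) mpoly set) = UNIV"
    unfolding MI_def by (auto simp: expo_le_def intro!: bexI[of _ 0])
  then show ?case by simp
next
  case (Suc k)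
  then show ?case by (simp only: ideal_power.simps ideal_mult_MI sum_expos_add)
qed

section \<open>The monomial \<open>x_X^k / x_i\<close> and its colon ideals\<close>

definition basis_power_div :: "nat \<Rightarrow> 'n set \<Rightarrow> 'n \<Rightarrow> 'n expo" where
  "basis_power_div k X i = expo_of (\<lambda>x. if x = i then k - 1 else if x \<in> X then k else 0)"

lemma sum_expos_le_basis_power_div:
  assumes X: "X \<in> \<B>" "i \<in> X" and k: "k \<ge> 1" and j: "j \<in> cocircuit X i"
  shows "\<exists>v\<in>sum_expos k. v \<preceq> unit_expo j + basis_power_div k X i"
proof -
  \<comment> \<open>Multiplying \<open>x_X^k / x_i\<close> by \<open>x_j\<close> gives one copy of
    the exchanged basis and \<open>k - 1\<close> copies of \<open>X\<close>.\<close>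
  define U where "U l = (if l = 0 then insert j (X - {i}) else X)" for l :: nat
  have U0: "U 0 = insert j (X - {i})" by (simp add: U_def)
  have cnt_U: "cnt k U x = of_bool (x \<in> insert j (X - {i})) + (k - 1) * of_bool (x \<in> X)" for x
  proof -
    have "cnt k U x = of_bool (x \<in> U 0) + (\<Sum>l\<in>{..<k} - {0}. of_bool (x \<in> U l))"
      unfolding cnt_def using k by (intro sum.remove) auto
    also have "(\<Sum>l\<in>{..<k} - {0}. of_bool (x \<in> U l)) = (\<Sum>l\<in>{..<k} - {0}. of_bool (x \<in> X) :: nat)"
      by (intro sum.cong) (auto simp: U_def)
    also have "\<dots> = (k - 1) * of_bool (x \<in> X)" using k by simp
    finally show ?thesis unfolding U0 .
  qed
  have "j \<notin> X \<or> j = i" using cocircuit_inter_basis[OF X] j by blast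
  then have "cnt k U x \<le> lookup (unit_expo j + basis_power_div k X i) x" for x
    unfolding cnt_U using k X(2)
    by (cases "x = j"; cases "x = i"; cases "x \<in> X")
      (auto simp: basis_power_div_def lookup_add lookup_single when_def)
  then have "expo_of (cnt k U) \<preceq> unit_expo j + basis_power_div k X i" by (simp add: expo_le_def)
  moreover have "expo_of (cnt k U) \<in> sum_expos k"
    unfolding sum_expos_def using X j by (auto simp: U_def cocircuit_def)
  ultimately show ?thesis by blast
qed

lemma expo_deg_basis_power_div:
  assumes X: "X \<in> \<B>" "i \<in> X" and k: "k \<ge> 1"
  shows "expo_deg (basis_power_div k X i) + 1 = d * k"
proof -
  have "expo_deg (basis_power_div k X i) = (k - 1) + (\<Sum>x\<in>UNIV - {i}. if x \<in> X then k else 0)"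
    unfolding expo_deg_def basis_power_div_def
    by (subst sum.remove[of _ i]) (auto intro!: sum.cong)
  also have "(\<Sum>x\<in>UNIV - {i}. if x \<in> X then k else 0) = (\<Sum>x\<in>X - {i}. k)"
    by (rule sum.mono_neutral_cong_right) auto
  finally have "expo_deg (basis_power_div k X i) + 1 = k + (card X - 1) * k" using k X(2) by simp
  also have "\<dots> = card X * k" using X(2) by (metis card_gt_0_iff emptyE finite mult_eq_if neq0_conv)
  finally show ?thesis using card_basis[OF X(1)] by simp
qed

lemma sum_expos_subset_cover_expos: "sum_expos k \<subseteq> cover_expos k"
  using cover_le_sum_cnt by (auto simp: sum_expos_def cover_expos_def min_cover_def)

lemma cover_expos_up_closed: "a \<in> cover_expos k \<Longrightarrow> a \<preceq> b \<Longrightarrow> b \<in> cover_expos k"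
  unfolding cover_expos_def expo_le_def by (auto intro: order_trans[OF _ sum_mono])

lemma in_MI_cover_expos_iff:
  "p \<in> MI (cover_expos k) \<longleftrightarrow> (\<forall>a\<in>keys p. a \<in> cover_expos k)"
  unfolding MI_def using cover_expos_up_closed expo_le_refl by blast

text \<open>If all \<open>k\<close> bases contain \<open>i\<close>, their sum exceeds the exponent
  \<open>k - 1\<close> at \<open>i\<close>. Otherwise a basis avoiding \<open>i\<close> supplies, by
  exchange, an element \<open>j\<close> of the cocircuit outside \<open>X\<close>, where
  \<open>x_X^k / x_i\<close> has exponent 0. Either way \<open>b\<close> must contribute a variable
  of the cocircuit.\<close>

lemma colon_power:
  assumes X: "X \<in> \<B>" "i \<in> X" and k: "k \<ge> 1"
  shows "ideal_colon (MI (sum_expos k)) (monomial (basis_power_div k X i)) =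
    (variable_ideal (cocircuit X i) :: ('n, 'k::field) mpoly set)"
proof (rule ideal_colon_MI_monomial)
  fix b assume "\<exists>v\<in>sum_expos k. v \<preceq> b + basis_power_div k X i"
  then obtain V where V: "\<forall>l<k. V l \<in> \<B>" "expo_of (cnt k V) \<preceq> b + basis_power_div k X i"
    by (auto simp: sum_expos_def)
  then have le: "cnt k V x \<le> lookup b x + lookup (basis_power_div k X i) x" for x
    by (simp add: expo_le_def lookup_add)
  show "\<exists>j\<in>cocircuit X i. lookup b j > 0"
  proof (cases "\<forall>l<k. i \<in> V l")
    case True
    then have "cnt k V i = k" by (simp add: cnt_def)
    then have "lookup b i > 0" using le[of i] k by (simp add: basis_power_div_def)
    then show ?thesis using cocircuit_inter_basis[OF X] by blast
  next
    case False
    then obtain l where l: "l < k" "i \<notin> V l" by blast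
    then obtain j where j: "j \<in> V l - X" "insert j (X - {i}) \<in> \<B>"
      using exchange[OF X(1), of "V l" i] V(1) X(2) by blast
    have "(\<Sum>l\<in>{l}. of_bool (j \<in> V l)) \<le> cnt k V j"
      unfolding cnt_def using l(1) by (intro sum_mono2) auto
    then have "cnt k V j > 0" using j(1) by simp
    moreover have "lookup (basis_power_div k X i) j = 0"
      using j(1) X(2) by (auto simp: basis_power_div_def)
    ultimately have "lookup b j > 0" using le[of j] by simp
    then show ?thesis using j(2) by (auto simp: cocircuit_def)
  qed
qed (rule sum_expos_le_basis_power_div[OF assms])

lemma sum_cocircuit_basis_power_div:
  assumes X: "X \<in> \<B>" "i \<in> X"
  shows "(\<Sum>x\<in>cocircuit X i. lookup (basis_power_div k X i) x) = k - 1"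
proof -
  have "i \<in> cocircuit X i" "\<And>x. x \<in> cocircuit X i - {i} \<Longrightarrow> x \<notin> X"
    using cocircuit_inter_basis[OF X] by blast+
  then show ?thesis by (subst sum.remove[of _ i]) (auto simp: basis_power_div_def intro!: sum.neutral)
qed

text \<open>On the fundamental cocircuit \<open>x_X^k / x_i\<close> has weight \<open>k - 1\<close>,
  just one short of the bound.\<close>

lemma colon_symbolic:
  assumes X: "X \<in> \<B>" "i \<in> X" and k: "k \<ge> 1"
  shows "ideal_colon (MI (cover_expos k)) (monomial (basis_power_div k X i)) =
    (variable_ideal (cocircuit X i) :: ('n, 'k::field) mpoly set)"
proof (rule ideal_colon_MI_monomial)
  fix b assume "\<exists>v\<in>cover_expos k. v \<preceq> b + basis_power_div k X i"
  then have "b + basis_power_div k X i \<in> cover_expos k" using cover_expos_up_closed by blast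
  then have "k \<le> (\<Sum>x\<in>cocircuit X i. lookup (b + basis_power_div k X i) x)"
    using min_cover_cocircuit[OF X] by (simp add: cover_expos_def)
  also have "\<dots> = (\<Sum>x\<in>cocircuit X i. lookup b x) + (k - 1)"
    by (simp add: lookup_add sum.distrib sum_cocircuit_basis_power_div[OF X])
  finally have "(\<Sum>x\<in>cocircuit X i. lookup b x) \<noteq> 0" using k by linarith
  then show "\<exists>j\<in>cocircuit X i. lookup b j > 0" by auto
next
  show "\<exists>v\<in>cover_expos k. v \<preceq> unit_expo j + basis_power_div k X i" if "j \<in> cocircuit X i" for j
    using sum_expos_le_basis_power_div[OF assms that] sum_expos_subset_cover_expos by blast
qed

text \<open>The fundamental cocircuit of \<open>x\<close> meets \<open>X\<close> only in
  \<open>x\<close>, so a divisor of \<open>x_X^k\<close> in the symbolic power must carry the whole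
  weight \<open>k\<close> at \<open>x\<close>.\<close>

lemma basis_power_minimal:
  fixes k :: nat
  assumes X: "X \<in> \<B>"
  defines "w \<equiv> expo_of (cnt k (\<lambda>_. X))"
  shows "w \<in> cover_expos k" "b \<in> cover_expos k \<Longrightarrow> b \<preceq> w \<Longrightarrow> b = w" "expo_deg w = d * k"
proof -
  have w: "w \<in> sum_expos k" using X by (auto simp: w_def sum_expos_def)
  then show "w \<in> cover_expos k" "expo_deg w = d * k"
    using sum_expos_subset_cover_expos expo_deg_sum_expos by auto
  have w_lookup: "lookup w x = (if x \<in> X then k else 0)" for x by (simp add: w_def cnt_def)
  assume b: "b \<in> cover_expos k" "b \<preceq> w"
  have le: "lookup b x \<le> lookup w x" for x using b(2) by (simp add: expo_le_def)
  have "lookup b x \<ge> k" if x: "x \<in> X" for x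
  proof -
    have "k \<le> (\<Sum>y\<in>cocircuit X x. lookup b y)"
      using b(1) min_cover_cocircuit[OF X x] by (simp add: cover_expos_def)
    also have "\<dots> = (\<Sum>y\<in>{x}. lookup b y)"
    proof (rule sum.mono_neutral_right)
      show "{x} \<subseteq> cocircuit X x" using cocircuit_inter_basis[OF X x] by blast
      show "\<forall>y\<in>cocircuit X x - {x}. lookup b y = 0"
      proof
        fix y assume "y \<in> cocircuit X x - {x}"
        then have "y \<notin> X" using cocircuit_inter_basis[OF X x] by blast
        then show "lookup b y = 0" using le[of y] by (simp add: w_lookup)
      qed
    qed simp
    finally show ?thesis by simp
  qed
  then have "w \<preceq> b" by (simp add: expo_le_def w_lookup)
  then show "b = w" using b(2) by (rule expo_le_antisym[rotated])
qed

text \<open>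
  If \<open>e \<notin> X\<close> could be exchanged for both \<open>b\<close> and \<open>b'\<close>, then \<open>x\<^sub>X\<^sup>k x\<^sub>e\<close> divided by the variables of
  \<open>b\<close> and \<open>b'\<close> would lie in the symbolic power.
\<close>

lemma unique_exchange_of_degrees:
  assumes k: "k \<ge> 2" and deg: "\<And>a. a \<in> cover_expos k \<Longrightarrow> expo_deg a \<ge> d * k"
    and X: "X \<in> \<B>" "e \<notin> X" "b \<in> X" "b' \<in> X" "insert e (X - {b}) \<in> \<B>" "insert e (X - {b'}) \<in> \<B>"
  shows "b = b'"
proof (rule ccontr)
  assume neq: "b \<noteq> b'"
  define a where "a = expo_of (\<lambda>x. if x = e then 1 else if x = b \<or> x = b' then k - 1 else if x \<in> X then k else 0)"
  have be: "b \<noteq> e" "b' \<noteq> e" using X by auto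
  have look: "lookup a e = 1" "lookup a b = k - 1" "lookup a b' = k - 1"
    "\<And>z. z \<in> X \<Longrightarrow> z \<noteq> b \<Longrightarrow> z \<noteq> b' \<Longrightarrow> lookup a z = k"
    using be X(2) by (auto simp: a_def)
  have "a \<in> cover_expos k"
    unfolding cover_expos_def
  proof (intro CollectI allI impI)
    fix C assume C: "min_cover C"
    then have cover: "Y \<inter> C \<noteq> {}" if "Y \<in> \<B>" for Y using that by (auto simp: min_cover_def cover_def)
    have ge: "(\<Sum>x\<in>S. lookup a x) \<le> (\<Sum>x\<in>C. lookup a x)" if "S \<subseteq> C" for S
      by (rule sum_mono2) (use that in auto)
    obtain y where y: "y \<in> X \<inter> C" using cover X(1) by blast
    \<comment> \<open>A third element of \<open>X\<close> in \<open>C\<close> has weight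
      \<open>k\<close> by itself; \<open>b\<close> and \<open>b'\<close> together have weight
      \<open>2 * (k - 1)\<close>, at least \<open>k\<close> since \<open>k \<ge> 2\<close>. If
      \<open>C\<close> meets \<open>X\<close> only in one of them, it must also contain
      \<open>e\<close> in order to meet the exchanged basis, and the weight is at least
      \<open>(k - 1) + 1\<close>.\<close>
    consider (other) "\<exists>y\<in>X \<inter> C. y \<noteq> b \<and> y \<noteq> b'" | (both) "b \<in> C" "b' \<in> C"
      | (b) "X \<inter> C = {b}" | (b') "X \<inter> C = {b'}"
    proof (cases "\<exists>y\<in>X \<inter> C. y \<noteq> b \<and> y \<noteq> b'")
      case False
      then have "X \<inter> C \<subseteq> {b, b'}" by blast
      then show ?thesis using that(2-4) y X(3,4) by (cases "b \<in> C"; cases "b' \<in> C") auto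
    qed (use that(1) in blast)
    then show "k \<le> (\<Sum>x\<in>C. lookup a x)"
    proof cases
      case other
      then obtain z where "z \<in> X \<inter> C" "z \<noteq> b" "z \<noteq> b'" by blast
      then show ?thesis using ge[of "{z}"] look(4)[of z] by simp
    next
      case both
      then show ?thesis using ge[of "{b, b'}"] neq k look by simp
    next
      case b
      then have "e \<in> C" using cover[OF X(5)] by blast
      moreover have "b \<in> C" using b by blast
      ultimately show ?thesis using ge[of "{b, e}"] be k look by simp
    next
      case b'
      then have "e \<in> C" using cover[OF X(6)] by blast
      moreover have "b' \<in> C" using b' by blast
      ultimately show ?thesis using ge[of "{b', e}"] be k look by simp
    qed
  qed
  moreover have "a + unit_expo b + unit_expo b' = expo_of (cnt k (\<lambda>_. X)) + unit_expo e"
    using neq X k by (intro poly_mapping_eqI) (auto simp: a_def cnt_def lookup_add lookup_single when_def)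
  then have "expo_deg (a + unit_expo b + unit_expo b') = d * k + 1"
    using basis_power_minimal(3)[OF X(1), of k] expo_deg_unit[of e] by simp
  then have "expo_deg a + 1 = d * k" using expo_deg_unit[of b] expo_deg_unit[of b'] by simp
  ultimately show False using deg by fastforce
qed

lemma MI_cover_expos_eq:
  assumes "\<And>X e b b'. X \<in> \<B> \<Longrightarrow> e \<notin> X \<Longrightarrow> b \<in> X \<Longrightarrow> b' \<in> X \<Longrightarrow>
      insert e (X - {b}) \<in> \<B> \<Longrightarrow> insert e (X - {b'}) \<in> \<B> \<Longrightarrow> b = b'"
  shows "MI (cover_expos k) = (MI (sum_expos k) :: ('n, 'k::field) mpoly set)"
proof
  show "(MI (sum_expos k) :: ('n, 'k) mpoly set) \<subseteq> MI (cover_expos k)"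
    unfolding MI_subset_iff using sum_expos_subset_cover_expos expo_le_refl by blast
  show "(MI (cover_expos k) :: ('n, 'k) mpoly set) \<subseteq> MI (sum_expos k)"
    unfolding MI_subset_iff
  proof
    fix a assume "a \<in> cover_expos k"
    then have "\<exists>U. (\<forall>l<k. U l \<in> \<B>) \<and> (\<forall>x. cnt k U x \<le> lookup a x)"
      by (intro unique_exchange_sum[OF assms]) (auto simp: cover_expos_def)
    then obtain U where "\<forall>l<k. U l \<in> \<B>" "\<forall>x. cnt k U x \<le> lookup a x" by blast
    then show "\<exists>u\<in>sum_expos k. u \<preceq> a"
      by (intro bexI[of _ "expo_of (cnt k U)"]) (auto simp: sum_expos_def expo_le_def)
  qed
qed

end

locale ordered_basis_system = basis_system \<B> d
  for \<B> :: "'n::{finite,linorder} set set" and d :: nat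
begin

lemma sum_expos_exchange:
  assumes "u \<in> sum_expos k" "v \<in> sum_expos k" "lookup u i < lookup v i"
  shows "\<exists>j w. lookup v j < lookup u j \<and> w \<in> sum_expos k \<and> w + unit_expo j = u + unit_expo i"
proof -
  obtain U V where U: "u = expo_of (cnt k U)" "\<forall>l<k. U l \<in> \<B>" and V: "v = expo_of (cnt k V)" "\<forall>l<k. V l \<in> \<B>"
    using assms by (auto simp: sum_expos_def)
  obtain j U' where j: "cnt k V j < cnt k U j" "\<forall>l<k. U' l \<in> \<B>"
    "\<And>x. cnt k U' x + of_bool (x = j) = cnt k U x + of_bool (x = i)"
    using sum_exchange[OF U(2) V(2), of i] assms(3) U V by auto
  have "expo_of (cnt k U') + unit_expo j = u + unit_expo i"
  proof (rule poly_mapping_eqI)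
    fix x show "lookup (expo_of (cnt k U') + unit_expo j) x = lookup (u + unit_expo i) x"
      using j(3)[of x]
      by (cases "x = i"; cases "x = j") (auto simp: U lookup_add lookup_single when_def)
  qed
  then show ?thesis using j U V
    by (intro exI[of _ j] exI[of _ "expo_of (cnt k U')"]) (auto simp: sum_expos_def)
qed

text \<open>The generators in descending lexicographic order have linear quotients.\<close>

lemma power_linear_resolution:
  assumes "d \<ge> 1" "k \<ge> 1"
  shows "\<exists>s \<phi>. minimal_graded_resolution UNIV (MI (sum_expos k) :: ('n, 'k::field) mpoly set) s one_vec1 \<phi> \<and>
    s 0 = [0] \<and> (\<forall>i. set (s (Suc i)) \<subseteq> {d * k + i}) \<and> s 1 \<noteq> []"
proof -
  define us where "us = rev (sorted_list_of_set (sum_expos k))"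
  have set_us: "set us = sum_expos k" by (simp add: us_def finite_sum_expos)
  have "sorted_wrt (<) (sorted_list_of_set (sum_expos k))"
    by (simp add: strict_sorted_iff)
  then have desc: "sorted_wrt (\<lambda>v u. u < v) us" unfolding us_def by (simp add: sorted_wrt_rev)
  have "\<exists>s \<phi>. minimal_graded_resolution UNIV (MI (set us) :: ('n, 'k) mpoly set) s one_vec1 \<phi> \<and>
    s 0 = [0] \<and> (\<forall>i. set (s (Suc i)) \<subseteq> {d * k + i}) \<and> length (s 1) = length us"
  proof (rule linear_quotients_resolution)
    show "expo_deg u = d * k" if "u \<in> set us" for u using that by (simp add: set_us expo_deg_sum_expos)
    show "0 < d * k" using assms by simp
    fix l l' assume l: "l < length us" "l' < l"
    define u v where "u = us ! l" and "v = us ! l'"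
    have uv: "u \<in> sum_expos k" "v \<in> sum_expos k" using l by (auto simp: u_def v_def simp flip: set_us)
    have "u < v" using sorted_wrt_nth_less[OF desc l(2,1)] by (simp add: u_def v_def)
    then obtain i where i: "lookup u i < lookup v i" "\<And>i'. i' < i \<Longrightarrow> lookup u i' = lookup v i'"
      by (auto simp: less_poly_mapping.rep_eq less_fun_def)
    obtain j w where w: "lookup v j < lookup u j" "w \<in> sum_expos k" "w + unit_expo j = u + unit_expo i"
      using sum_expos_exchange[OF uv i(1)] by blast
    \<comment> \<open>\<open>u\<close> and \<open>v\<close> agree before \<open>i\<close>, so
      \<open>j\<close> comes later. Raising \<open>u\<close> at \<open>i\<close> and lowering it at
      \<open>j\<close> thus gives a lexicographically larger \<open>w\<close>, which precedes
      \<open>u\<close> in the descending list.\<close>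
    have "i < j" using i w(1) by (metis linorder_neqE less_irrefl less_asym)
    have w_lookup: "lookup w x + (if x = j then 1 else 0) = lookup u x + (if x = i then 1 else 0)" for x
      using arg_cong[OF w(3), of "\<lambda>a. lookup a x"]
      by (cases "x = i"; cases "x = j") (auto simp: lookup_add lookup_single when_def)
    have "u < w"
      unfolding less_poly_mapping.rep_eq less_fun_def
    proof (intro exI conjI allI impI)
      show "lookup u i < lookup w i" using w_lookup[of i] \<open>i < j\<close> by (simp split: if_splits)
      show "lookup u i' = lookup w i'" if "i' < i" for i' using w_lookup[of i'] \<open>i < j\<close> that by (simp split: if_splits)
    qed
    obtain l'' where l'': "l'' < length us" "us ! l'' = w"
      using w(2) by (auto simp: in_set_conv_nth simp flip: set_us)
    have "l'' < l"
    proof (rule ccontr)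
      assume "\<not> l'' < l"
      then have "w \<le> u" using sorted_wrt_nth_less[OF desc, of l l''] l'' by (cases "l = l''") (auto simp: u_def)
      then show False using \<open>u < w\<close> by simp
    qed
    moreover have "w \<preceq> unit_expo i + u" by (metis add.commute expo_le_add1 w(3))
    ultimately show "\<exists>j. lookup (us ! l) j < lookup (us ! l') j \<and> (\<exists>l''<l. us ! l'' \<preceq> unit_expo j + us ! l)"
      using i(1) l''(2) by (auto simp: u_def v_def)
  qed
  moreover have "us \<noteq> []" using set_us sum_expos_nonempty[of k] by auto
  ultimately show ?thesis unfolding set_us by (metis length_0_conv)
qed

section \<open>Minimal primes and symbolic powers\<close>

lemma variable_ideal_superset_iff:
  "(MI (sum_expos 1) :: ('n, 'k::field) mpoly set) \<subseteq> variable_ideal C \<longleftrightarrow> cover C"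
proof -
  have meets: "(\<exists>b\<in>unit_expo ` C. b \<preceq> expo_of (cnt 1 U)) \<longleftrightarrow> U 0 \<inter> C \<noteq> {}" for U
    by (auto simp: unit_expo_le_iff cnt_def split: if_splits)
  have "(MI (sum_expos 1) :: ('n, 'k) mpoly set) \<subseteq> variable_ideal C \<longleftrightarrow>
      (\<forall>U. U (0::nat) \<in> \<B> \<longrightarrow> U 0 \<inter> C \<noteq> {})"
    unfolding variable_ideal_def MI_subset_iff meets[symmetric] by (auto simp: sum_expos_def)
  also have "\<dots> \<longleftrightarrow> cover C"
    unfolding cover_def
  proof (intro iffI ballI allI impI)
    fix X assume "\<forall>U. U (0::nat) \<in> \<B> \<longrightarrow> U 0 \<inter> C \<noteq> {}" "X \<in> \<B>"
    then show "X \<inter> C \<noteq> {}" using spec[of _ "\<lambda>_. X"] by fastforce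
  qed auto
  finally show ?thesis .
qed

lemma prime_contains_cover:
  fixes P :: "('n, 'k::field) mpoly set"
  assumes P: "is_prime_ideal P" "MI (sum_expos 1) \<subseteq> P"
  defines "C \<equiv> {i. monomial (unit_expo i) \<in> P}"
  shows "cover C" "variable_ideal C \<subseteq> P"
proof -
  show "variable_ideal C \<subseteq> P"
    unfolding variable_ideal_def using P(1) by (intro MI_minimal) (auto simp: is_prime_ideal_def C_def)
  show "cover C"
    unfolding cover_def
  proof
    fix X assume X: "X \<in> \<B>"
    have "expo_of (cnt 1 (\<lambda>_. X)) \<in> sum_expos 1" using X by (auto simp: sum_expos_def)
    then have "monomial (expo_of (cnt 1 (\<lambda>_. X))) \<in> P" using P(2) monomial_in_MI by blast
    then obtain i where "cnt 1 (\<lambda>_. X) i > 0" "monomial (unit_expo i) \<in> P"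
      using prime_ideal_variable[OF P(1)] by fastforce
    then show "X \<inter> C \<noteq> {}" by (auto simp: cnt_def C_def split: if_splits)
  qed
qed

lemma variable_ideal_mono_iff:
  "(variable_ideal C :: ('n, 'k::field) mpoly set) \<subseteq> variable_ideal D \<longleftrightarrow> C \<subseteq> D"
proof
  assume sub: "(variable_ideal C :: ('n, 'k) mpoly set) \<subseteq> variable_ideal D"
  show "C \<subseteq> D"
  proof
    fix i assume "i \<in> C"
    then have "(monomial (unit_expo i) :: ('n, 'k) mpoly) \<in> variable_ideal C" by simp
    then have "(monomial (unit_expo i) :: ('n, 'k) mpoly) \<in> variable_ideal D" using sub by blast
    then show "i \<in> D" by simp
  qed
next
  assume "C \<subseteq> D"
  then show "(variable_ideal C :: ('n, 'k) mpoly set) \<subseteq> variable_ideal D"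
    unfolding variable_ideal_def MI_subset_iff using expo_le_refl by blast
qed

text \<open>A prime containing the ideal contains the variables of a cover, hence the variable ideal
  of that cover, which is itself a prime over the ideal. Minimality of primes thus becomes
  minimality of covers.\<close>

lemma minimal_primes_eq:
  "minimal_primes (MI (sum_expos 1)) = (variable_ideal ` {C. min_cover C} :: ('n, 'k::field) mpoly set set)"
proof (intro equalityI subsetI)
  fix P :: "('n, 'k) mpoly set" assume P: "P \<in> minimal_primes (MI (sum_expos 1))"
  then have prime: "is_prime_ideal P" "MI (sum_expos 1) \<subseteq> P"
    and min: "\<And>Q. is_prime_ideal Q \<Longrightarrow> MI (sum_expos 1) \<subseteq> Q \<Longrightarrow> Q \<subseteq> P \<Longrightarrow> Q = P"
    by (auto simp: minimal_primes_def)
  define C where "C = {i. monomial (unit_expo i) \<in> P}"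
  have C: "cover C" "variable_ideal C \<subseteq> P" using prime_contains_cover[OF prime] by (auto simp: C_def)
  have P_eq: "variable_ideal D = P" if "cover D" "D \<subseteq> C" for D
  proof (rule min[OF is_prime_variable_ideal])
    show "MI (sum_expos 1) \<subseteq> (variable_ideal D :: ('n, 'k) mpoly set)"
      using that variable_ideal_superset_iff by blast
    show "variable_ideal D \<subseteq> P" using C(2) that variable_ideal_mono_iff by blast
  qed
  have "\<not> cover D" if "D \<subset> C" for D
  proof
    assume "cover D"
    then have "(variable_ideal D :: ('n, 'k) mpoly set) = variable_ideal C" using P_eq that C(1) by blast
    then have "C \<subseteq> D" using variable_ideal_mono_iff by blast
    then show False using that by blast
  qed
  then show "P \<in> variable_ideal ` {C. min_cover C}"
    using P_eq[OF C(1)] C(1) by (auto simp: min_cover_def)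
next
  fix P :: "('n, 'k) mpoly set" assume "P \<in> variable_ideal ` {C. min_cover C}"
  then obtain C where C: "min_cover C" "P = variable_ideal C" by blast
  have "Q = P" if Q: "is_prime_ideal Q" "MI (sum_expos 1) \<subseteq> Q" "Q \<subseteq> P" for Q
  proof -
    define D where "D = {i. monomial (unit_expo i) \<in> Q}"
    have D: "cover D" "variable_ideal D \<subseteq> Q" using prime_contains_cover[OF Q(1,2)] by (auto simp: D_def)
    have "D \<subseteq> C" using Q(3) by (auto simp: D_def C(2))
    then have "D = C" using C(1) D(1) by (auto simp: min_cover_def)
    then show ?thesis using D(2) Q(3) C(2) by blast
  qed
  moreover have "is_prime_ideal P" unfolding C(2) by (rule is_prime_variable_ideal)
  moreover have "MI (sum_expos 1) \<subseteq> P"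
    unfolding C(2) variable_ideal_superset_iff using C(1) by (simp add: min_cover_def)
  ultimately show "P \<in> minimal_primes (MI (sum_expos 1))" unfolding minimal_primes_def by blast
qed

text \<open>A multiplier outside the prime has least weight 0 on \<open>C\<close>, so
  \<open>r\<close> must already have weight at least \<open>k\<close>. Conversely each term of
  \<open>r\<close> is divisible by \<open>k\<close> variables of \<open>C\<close>; each of them is
  the only element of \<open>C\<close> in some basis, and the missing variables of these bases come
  from the multiplier.\<close>

lemma symbolic_component:
  fixes r :: "('n, 'k::field) mpoly"
  assumes C: "min_cover C"
  shows "(\<exists>s. s \<notin> variable_ideal C \<and> r * s \<in> MI (sum_expos k)) \<longleftrightarrow>
    (\<forall>a\<in>keys r. k \<le> (\<Sum>x\<in>C. lookup a x))"
proof
  assume "\<exists>s. s \<notin> variable_ideal C \<and> r * s \<in> MI (sum_expos k)"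
  then obtain s where s: "s \<notin> variable_ideal C" "r * s \<in> MI (sum_expos k)" by blast
  show "\<forall>a\<in>keys r. k \<le> (\<Sum>x\<in>C. lookup a x)"
  proof
    fix a assume a: "a \<in> keys r"
    then have "r \<noteq> 0" by auto
    then obtain c where c: "c \<in> keys (r * s)"
      "(\<Sum>x\<in>C. lookup c x) = Min ((\<lambda>a. \<Sum>x\<in>C. lookup a x) ` keys r)"
      using keys_mult_weight_min[of "\<lambda>a. \<Sum>x\<in>C. lookup a x" r s] min_weight_notin_variable_ideal[OF s(1)]
      by (auto simp: lookup_add sum.distrib)
    obtain u where u: "u \<in> sum_expos k" "u \<preceq> c" using s(2) c(1) by (auto simp: MI_def)
    then have "c \<in> cover_expos k" using sum_expos_subset_cover_expos cover_expos_up_closed by blast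
    then have "k \<le> (\<Sum>x\<in>C. lookup c x)" using C by (simp add: cover_expos_def)
    also have "\<dots> \<le> (\<Sum>x\<in>C. lookup a x)" unfolding c(2) using a by (intro Min_le) auto
    finally show "k \<le> (\<Sum>x\<in>C. lookup a x)" .
  qed
next
  assume r: "\<forall>a\<in>keys r. k \<le> (\<Sum>x\<in>C. lookup a x)"
  \<comment> \<open>Outside \<open>C\<close> the exponents of a sum of \<open>k\<close> bases are at
    most \<open>k\<close>, so one multiplier serves for all terms of \<open>r\<close>.\<close>
  define \<sigma> where "\<sigma> = expo_of (\<lambda>x. if x \<in> C then 0 else k)"
  have "\<forall>i\<in>C. \<exists>X. X \<in> \<B> \<and> X \<inter> C = {i}" using min_cover_basis[OF C] by blast
  then obtain X where X: "\<And>i. i \<in> C \<Longrightarrow> X i \<in> \<B> \<and> X i \<inter> C = {i}" by metis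
  have "\<exists>v\<in>sum_expos k. v \<preceq> a + \<sigma>" if a: "a \<in> keys r" for a
  proof -
    obtain i where i: "\<forall>l<k. i l \<in> C" "\<And>x. cnt k (\<lambda>l. {i l}) x \<le> lookup a x"
      using select_with_multiplicity[of k "lookup a" C] r a by blast
    have "expo_of (cnt k (\<lambda>l. X (i l))) \<preceq> a + \<sigma>"
      unfolding expo_le_def
    proof
      fix x
      show "lookup (expo_of (cnt k (\<lambda>l. X (i l)))) x \<le> lookup (a + \<sigma>) x"
      proof (cases "x \<in> C")
        case True
        have "cnt k (\<lambda>l. X (i l)) x \<le> cnt k (\<lambda>l. {i l}) x"
          unfolding cnt_def
        proof (rule sum_mono)
          fix l assume "l \<in> {..<k}"
          then have "X (i l) \<inter> C = {i l}" using X i(1) by auto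
          then have "x \<in> X (i l) \<longleftrightarrow> x \<in> {i l}" using True by blast
          then show "of_bool (x \<in> X (i l)) \<le> (of_bool (x \<in> {i l}) :: nat)" by simp
        qed
        then show ?thesis using i(2)[of x] by (simp add: lookup_add)
      next
        case False
        then show ?thesis using cnt_le[of k "\<lambda>l. X (i l)" x] by (simp add: lookup_add \<sigma>_def)
      qed
    qed
    moreover have "expo_of (cnt k (\<lambda>l. X (i l))) \<in> sum_expos k"
      using X i(1) unfolding sum_expos_def by blast
    ultimately show ?thesis by blast
  qed
  then have "r * monomial \<sigma> \<in> MI (sum_expos k)" by (simp add: mult_monomial_in_MI_iff)
  moreover have "(monomial \<sigma> :: ('n, 'k) mpoly) \<notin> variable_ideal C"
    by (simp add: variable_ideal_iff \<sigma>_def)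
  ultimately show "\<exists>s. s \<notin> variable_ideal C \<and> r * s \<in> MI (sum_expos k)" by blast
qed

lemma symbolic_power_eq:
  "symbolic_power (MI (sum_expos 1)) k = (MI (cover_expos k) :: ('n, 'k::field) mpoly set)"
proof (rule Set.set_eqI)
  fix r :: "('n, 'k) mpoly"
  have "r \<in> symbolic_power (MI (sum_expos 1)) k \<longleftrightarrow>
      (\<forall>C. min_cover C \<longrightarrow> (\<exists>s. s \<notin> variable_ideal C \<and> r * s \<in> MI (sum_expos k)))"
    unfolding symbolic_power_def minimal_primes_eq ideal_power_eq
    by (simp add: in_symbolic_component_iff[OF is_prime_variable_ideal])
  also have "\<dots> \<longleftrightarrow> r \<in> MI (cover_expos k)"
    unfolding in_MI_cover_expos_iff by (auto simp: cover_expos_def symbolic_component)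
  finally show "r \<in> symbolic_power (MI (sum_expos 1)) k \<longleftrightarrow> r \<in> MI (cover_expos k)" .
qed

section \<open>v-numbers, regularities and the linear case\<close>

context
  assumes d: "d \<ge> 1"
begin

lemma basis_element: "\<exists>X\<in>\<B>. \<exists>i. i \<in> X"
proof -
  obtain X where "X \<in> \<B>" using nonempty by blast
  moreover have "X \<noteq> {}" using card_basis[OF calculation] d by auto
  ultimately show ?thesis by blast
qed

lemma v_number_power:
  assumes k: "k \<ge> 1"
  shows "v_number (MI (sum_expos k) :: ('n, 'k::field) mpoly set) + 1 = d * k"
proof -
  obtain X i where X: "X \<in> \<B>" "i \<in> X" using basis_element by blast
  note colon = colon_power[OF X k]
  have "d * k \<le> v_number (MI (sum_expos k) :: ('n, 'k) mpoly set) + 1"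
    by (rule v_number_ge[OF sum_expos_nonempty _ colon]) (simp add: expo_deg_sum_expos)
  moreover have "v_number (MI (sum_expos k) :: ('n, 'k) mpoly set) \<le> expo_deg (basis_power_div k X i)"
    by (rule v_number_le_monomial[OF colon])
  ultimately show ?thesis using expo_deg_basis_power_div[OF X k] by linarith
qed

lemma v_number_symbolic:
  assumes k: "k \<ge> 1"
  shows "v_number (MI (cover_expos k) :: ('n, 'k::field) mpoly set) + 1 \<le> d * k"
proof -
  obtain X i where X: "X \<in> \<B>" "i \<in> X" using basis_element by blast
  have "v_number (MI (cover_expos k) :: ('n, 'k) mpoly set) \<le> expo_deg (basis_power_div k X i)"
    by (rule v_number_le_monomial[OF colon_symbolic[OF X k]])
  then show ?thesis using expo_deg_basis_power_div[OF X k] by linarith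
qed

lemma reg_quot_power:
  assumes k: "k \<ge> 1"
  shows "reg_quot (MI (sum_expos k) :: ('n, 'k::field) mpoly set) = int d * int k - 1"
proof -
  define J where "J = (MI (sum_expos k) :: ('n, 'k) mpoly set)"
  obtain s \<phi> where F: "minimal_graded_resolution UNIV J s one_vec1 \<phi>" "s 0 = [0]"
    "\<And>i. set (s (Suc i)) \<subseteq> {d * k + i}" "s 1 \<noteq> []"
    using power_linear_resolution[OF d k] unfolding J_def by blast
  have J: "homogeneous_ideal J" by (simp add: J_def homogeneous_ideal_MI)
  have b: "betti_degrees UNIV J i = set (s i)" for i by (rule betti_degrees_eq[OF F(1) J])
  define M where "M = (\<Union>i. (\<lambda>j. int j - int i) ` betti_degrees UNIV J i)"
  \<comment> \<open>Position 0 contributes 0, position \<open>i + 1\<close> at most the value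
    \<open>d * k + i - (i + 1)\<close>. The maximum is the latter because
    \<open>d * k \<ge> 1\<close>.\<close>
  have "M \<subseteq> {0, int d * int k - 1}"
  proof
    fix x assume "x \<in> M"
    then obtain i j where x: "x = int j - int i" "j \<in> set (s i)" by (auto simp: M_def b)
    show "x \<in> {0, int d * int k - 1}" using x F(2) F(3)[of "i - 1"] by (cases i) auto
  qed
  moreover have "d * k \<in> set (s 1)" using F(3)[of 0] F(4) by (cases "s 1") auto
  then have "int d * int k - 1 \<in> M" unfolding M_def b by (intro UN_I[of 1] image_eqI[of _ _ "d * k"]) auto
  moreover have "int d * int k \<ge> 1" using d k by (metis mult_le_mono of_nat_1 of_nat_le_iff of_nat_mult mult_1)
  ultimately have "Max M = int d * int k - 1" by (intro Max_eqI) (auto intro: finite_subset)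
  then show ?thesis by (simp add: reg_quot_eq M_def J_def)
qed

lemma MI_cover_expos_proper:
  assumes k: "k \<ge> 1"
  shows "(MI (cover_expos k) :: ('n, 'k::field) mpoly set) \<noteq> UNIV"
proof -
  obtain X i where X: "X \<in> \<B>" "i \<in> X" using basis_element by blast
  have "0 \<notin> cover_expos k" using min_cover_cocircuit[OF X] k by (auto simp: cover_expos_def)
  then have "(1 :: ('n, 'k) mpoly) \<notin> MI (cover_expos k)" by (simp add: in_MI_cover_expos_iff)
  then show ?thesis by blast
qed

lemma symbolic_generator_degree:
  assumes k: "k \<ge> 1"
  shows "d * k \<in> betti_degrees UNIV (MI (cover_expos k) :: ('n, 'k::field) mpoly set) 1"
proof -
  obtain X where X: "X \<in> \<B>" using nonempty by blast
  note w = basis_power_minimal[OF X]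
  have "expo_deg (expo_of (cnt k (\<lambda>_. X))) \<in> betti_degrees UNIV (MI (cover_expos k) :: ('n, 'k) mpoly set) 1"
  proof (rule first_betti_degree[OF _ _ MI_cover_expos_proper[OF k]])
    show "\<exists>u\<in>cover_expos k. u \<preceq> expo_of (cnt k (\<lambda>_. X))" using w(1) expo_le_refl by blast
    show "b = expo_of (cnt k (\<lambda>_. X))"
      if "\<exists>u\<in>cover_expos k. u \<preceq> b" "b \<preceq> expo_of (cnt k (\<lambda>_. X))" for b
      using w(2) that cover_expos_up_closed by blast
  qed
  then show ?thesis using basis_power_minimal(3)[OF X] by simp
qed

lemma reg_quot_symbolic:
  assumes k: "k \<ge> 1"
  shows "int d * int k - 1 \<le> reg_quot (MI (cover_expos k) :: ('n, 'k::field) mpoly set)"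
  unfolding reg_quot_eq
proof (rule Max_ge)
  show "finite (\<Union>i. (\<lambda>j. int j - int i) ` betti_degrees UNIV (MI (cover_expos k) :: ('n, 'k) mpoly set) i)"
    by (rule finite_betti_differences[OF MI_cover_expos_proper[OF k]])
  show "int d * int k - 1 \<in>
      (\<Union>i. (\<lambda>j. int j - int i) ` betti_degrees UNIV (MI (cover_expos k) :: ('n, 'k) mpoly set) i)"
    using symbolic_generator_degree[OF k] by (intro UN_I[of 1] image_eqI[of _ _ "d * k"]) auto
qed

text \<open>A single exponent \<open>k\<close> decides about all \<open>l\<close>, because the
  uniqueness of exchanges extracted from it is a property of the matroid alone.\<close>

lemma linear_symbolic_imp_eq:
  assumes k: "k \<ge> 2" and lin: "has_linear_resolution (MI (cover_expos k) :: ('n, 'k::field) mpoly set)"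
  shows "MI (cover_expos l) = (MI (sum_expos l) :: ('n, 'k) mpoly set)"
proof -
  have k1: "k \<ge> 1" using k by simp
  obtain q where q: "betti_degrees UNIV (MI (cover_expos k) :: ('n, 'k) mpoly set) 1 \<subseteq> {q}"
    "\<And>p a. p \<in> (MI (cover_expos k) :: ('n, 'k) mpoly set) \<Longrightarrow> a \<in> keys p \<Longrightarrow> expo_deg a \<ge> q"
    using linear_resolution_generator_degree[OF homogeneous_ideal_MI MI_cover_expos_proper[OF k1] lin] by blast
  have "q = d * k" using q(1) symbolic_generator_degree[OF k1] by blast
  then have "expo_deg a \<ge> d * k" if "a \<in> cover_expos k" for a
    using q(2)[OF monomial_in_MI[OF that], of a] by simp
  from unique_exchange_of_degrees[OF k this] show ?thesis by (rule MI_cover_expos_eq)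
qed

end

end

text \<open>A square-free exponent vector is the indicator function of its support. On supports the
  polymatroidal exchange becomes basis exchange, and the common degree becomes the common
  cardinality.\<close>

lemma squarefree_polymatroidal_basis_system:
  fixes I :: "('n::{finite,linorder}, 'k::field) mpoly set"
  assumes poly: "polymatroidal I" and sqf: "squarefree_ideal I" and gen: "generated_in_degree d I"
    and "I \<noteq> {0}"
  defines "\<B> \<equiv> keys ` min_gens I"
  shows "basis_system \<B> d" "I = MI (basis_system.sum_expos \<B> 1)"
proof -
  have I: "I = MI (min_gens I)" using poly by (intro MI_min_gens) (simp add: polymatroidal_def)
  have look: "lookup a x = of_bool (x \<in> keys a)" if "a \<in> min_gens I" for a x
  proof -
    have "lookup a x \<le> 1" using sqf that by (simp add: squarefree_ideal_def)
    then show ?thesis by (auto simp: in_keys_iff)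
  qed
  show bs: "basis_system \<B> d"
  proof
    show "\<B> \<noteq> {}"
    proof
      assume "\<B> = {}"
      then have "I = {0}" using I by (auto simp: \<B>_def MI_def)
      then show False using assms(4) by simp
    qed
    show "card X = d" if X: "X \<in> \<B>" for X
    proof -
      obtain a where a: "a \<in> min_gens I" "X = keys a" using X by (auto simp: \<B>_def)
      have "expo_deg a = card (keys a)" by (simp add: expo_deg_def look[OF a(1)])
      then show ?thesis using gen a by (simp add: generated_in_degree_def)
    qed
    show "\<exists>j\<in>Y - X. insert j (X - {i}) \<in> \<B>" if XY: "X \<in> \<B>" "Y \<in> \<B>" "i \<in> X - Y" for X Y i
    proof -
      obtain a b where ab: "a \<in> min_gens I" "X = keys a" "b \<in> min_gens I" "Y = keys b"
        using XY by (auto simp: \<B>_def)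
      have "lookup b i < lookup a i" using XY(3) ab look by simp
      then obtain j where j: "lookup a j < lookup b j" "a - unit_expo i + unit_expo j \<in> min_gens I"
        using poly ab unfolding polymatroidal_def by (metis One_nat_def)
      have "j \<in> Y - X" using j(1) ab by (auto simp: look split: if_splits)
      moreover have "lookup (a - unit_expo i + unit_expo j) x = of_bool (x \<in> insert j (X - {i}))" for x
        using XY(3) ab(2) \<open>j \<in> Y - X\<close> look[OF ab(1), of x]
        by (cases "x = i"; cases "x = j") (auto simp: lookup_add lookup_minus lookup_single)
      then have "keys (a - unit_expo i + unit_expo j) = insert j (X - {i})"
        by (auto simp: in_keys_iff)
      ultimately show ?thesis using j(2) unfolding \<B>_def by (metis image_eqI)
    qed
  qed
  have eq: "a = expo_of (cnt 1 U)" if "a \<in> min_gens I" "U 0 = keys a" for a U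
    using that by (intro poly_mapping_eqI) (simp add: look cnt_def)
  have "min_gens I = basis_system.sum_expos \<B> 1"
    unfolding basis_system.sum_expos_def[OF bs] unfolding \<B>_def
  proof (intro equalityI subsetI)
    fix a assume "a \<in> min_gens I"
    then show "a \<in> {expo_of (cnt 1 U) |U. \<forall>l<1. U l \<in> keys ` min_gens I}"
      using eq[of a "\<lambda>_. keys a"] by auto
  next
    fix a assume "a \<in> {expo_of (cnt 1 U) |U. \<forall>l<1. U l \<in> keys ` min_gens I}"
    then obtain U b where "a = expo_of (cnt 1 U)" "b \<in> min_gens I" "U 0 = keys b" by auto
    then show "a \<in> min_gens I" using eq by metis
  qed
  then show "I = MI (basis_system.sum_expos \<B> 1)" using I by simp
qed

theorem proposition4p10:
  fixes I :: "('n::{finite,linorder}, 'k::field) mpoly set" and d :: nat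
  assumes "polymatroidal I"
    and "squarefree_ideal I"
    and "generated_in_degree d I"
    and "I \<noteq> {0}"
    and "I \<noteq> UNIV"
  shows
    "(\<forall>k\<ge>1.
        v_number (symbolic_power I k) \<le> v_number (ideal_power I k) \<and>
        int (v_number (ideal_power I k)) = int d * int k - 1 \<and>
        int d * int k - 1 = reg_quot (ideal_power I k) \<and>
        reg_quot (ideal_power I k) \<le> reg_quot (symbolic_power I k)) \<and>
     ((\<exists>k\<ge>2. has_linear_resolution (symbolic_power I k)) \<longrightarrow>
      (\<forall>k\<ge>1.
        v_number (symbolic_power I k) = v_number (ideal_power I k) \<and>
        int (v_number (ideal_power I k)) = int d * int k - 1 \<and>
        int d * int k - 1 = reg_quot (ideal_power I k) \<and>
        reg_quot (ideal_power I k) = reg_quot (symbolic_power I k)))"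
proof -
  define \<B> where "\<B> = keys ` min_gens I"
  interpret basis_system \<B> d
    unfolding \<B>_def by (rule squarefree_polymatroidal_basis_system(1)[OF assms(1-4)])
  interpret ordered_basis_system \<B> d by unfold_locales
  have I: "I = MI (sum_expos 1)"
    unfolding \<B>_def by (rule squarefree_polymatroidal_basis_system(2)[OF assms(1-4)])
  have power: "ideal_power I k = MI (sum_expos k)" for k unfolding I by (rule ideal_power_eq)
  have symbolic: "symbolic_power I k = MI (cover_expos k)" for k unfolding I by (rule symbolic_power_eq)
  \<comment> \<open>Here properness of the ideal enters: a generator of degree 0 would be the
    monomial 1.\<close>
  have d: "d \<ge> 1"
  proof (rule ccontr)
    assume "\<not> d \<ge> 1"
    then have "d = 0" by simp
    moreover obtain u where u: "u \<in> sum_expos 1" using sum_expos_nonempty by blast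
    ultimately have "u = 0" using expo_deg_sum_expos[OF u] by (simp add: expo_deg_eq_0_iff)
    then have "\<exists>v\<in>sum_expos 1. v \<preceq> a" for a using u by (intro bexI[of _ 0]) (auto simp: expo_le_def)
    then have "I = UNIV" unfolding I MI_def by blast
    then show False using assms(5) by simp
  qed
  have first: "v_number (symbolic_power I k) \<le> v_number (ideal_power I k) \<and>
        int (v_number (ideal_power I k)) = int d * int k - 1 \<and>
        int d * int k - 1 = reg_quot (ideal_power I k) \<and>
        reg_quot (ideal_power I k) \<le> reg_quot (symbolic_power I k)" if k: "k \<ge> 1" for k
  proof (intro conjI)
    have v: "v_number (ideal_power I k) + 1 = d * k" unfolding power by (rule v_number_power[OF d k])
    have "v_number (symbolic_power I k) + 1 \<le> d * k" unfolding symbolic by (rule v_number_symbolic[OF d k])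
    then show "v_number (symbolic_power I k) \<le> v_number (ideal_power I k)" using v by simp
    have "int (v_number (ideal_power I k) + 1) = int (d * k)" by (simp only: v)
    then show "int (v_number (ideal_power I k)) = int d * int k - 1" by simp
    show reg: "int d * int k - 1 = reg_quot (ideal_power I k)"
      unfolding power by (rule reg_quot_power[OF d k, symmetric])
    show "reg_quot (ideal_power I k) \<le> reg_quot (symbolic_power I k)"
      unfolding reg[symmetric] symbolic by (rule reg_quot_symbolic[OF d k])
  qed
  moreover have "symbolic_power I k = ideal_power I k"
    if "\<exists>k\<ge>2. has_linear_resolution (symbolic_power I k)" for k
    using that linear_symbolic_imp_eq[OF d] unfolding symbolic power by blast
  ultimately show ?thesis by metis
qed

end
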